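(* Let $X$ be a smooth projective variety over $\mathbb{C}$ with a very ample line bundle $\mathcal{L}$. Suppose that the family $\{S_t\mid t\in\mathbb{T}\}$ of finitely generated semigroups $S_t=S(\mathcal{L},v_t,h)$ has a tropical cluster structure (and hence the family $\{\Delta_t\mid t\in\mathbb{T}\}$ of corresponding Newton--Okounkov bodies $\Delta_t=\Delta(\mathcal{L},v_t,h)$ of $X$ also has a tropical cluster structure). If (1) the semigroup $S_{t_0}$ is saturated, (2) the Newton--Okounkov polytope $\Delta_{t_0}$ is a $\mathbb{Q}$-Gorenstein Fano polytope of size $\nu$ for some $\nu\in\mathbb{N}$ with center $\mathbf{u}_0$, and (3) the center $\mathbf{u}_0$ is fixed under the tropicalized cluster mutation of each direction, in the sense that $\mu_k^T(\mathbf{u}_{t,0})=\mathbf{u}_{t',0}$ for every $k\in J_{\mathrm{uf}}$ and every pair $(t,t')$ of vertices of $\mathbb{T}$ with $t'=\mu_k(t)$, where $\mathbf{u}_{t,0}\in\mathbb{R}^J$ denotes the coordinate vector of $\mathbf{u}_0\in M_{\mathbb{R}}$ with respect to the seed $\mathsf{s}_t$, then each polytope $\Delta_t$ in the family is also a $\mathbb{Q}$-Gorenstein Fano polytope of size $\nu$ with center $\mathbf{u}_{t,0}$, and the central fiber of the toric degeneration associated with $\Delta_t$ is a normal toric variety.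
   Context: Newton--Okounkov data. Let $m=\dim_{\mathbb{C}}X$ and let $J$ be a finite index set with $|J|=m$. A valuation $v\colon\mathbb{C}(X)\setminus\{0\}\to\mathbb{Z}^J$ (with respect to a total order on $\mathbb{Z}^J$ respecting addition) satisfies $v(fg)=v(f)+v(g)$, $v(f+g)\ge\min(v(f),v(g))$, $v(cf)=v(f)$ for $c\in\mathbb{C}^*$; it has one-dimensional leaves if whenever $v(f)=v(g)$ there is $c\in\mathbb{C}^*$ with $g=cf$ or $v(g-cf)>v(g)$. For $0\ne h\in H^0(X,\mathcal{L})$ and $R=\bigoplus_kR_k$ the homogeneous coordinate ring of $X$ in the embedding by $\mathcal{L}$, $S(\mathcal{L},v,h)=\bigcup_{k\ge1}\{(k,v(f/h^k)) : 0\neq f\in R_k\}\subset\mathbb{Z}_{\ge0}\times\mathbb{Z}^J$, and $\Delta(\mathcal{L},v,h)$ is the closure of the convex hull of $\bigcup_{k\ge 1}\{x/k : (k,x)\in S(\mathcal{L},v,h)\}$. When $S$ is finitely generated, $\Delta$ is a rational polytope and (Anderson) there is an associated toric degeneration of $X$: a flat family over $\mathbb{C}$ in $\mathbb{CP}^N\times\mathbb{C}$, trivial over $\mathbb{C}^*$ with fiber $X$, whose central fiber is a projective toric variety whose normalization is the toric variety of $\Delta$. $S$ is saturated if $(r,\mathbf{u})\in\mathbb{N}\times\mathbb{Z}^J$, $n\in\mathbb{N}$ and $n(r,\mathbf{u})\in S$ imply $(r,\mathbf{u})\in S$. Seeds. Fix a lattice $N$ of rank $|J|$ with a skew-symmetric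 form $\{\cdot,\cdot\}\colon N\times N\to\mathbb{Q}$, a subset $J_{\mathrm{uf}}\subset J$ (unfrozen indices), a saturated sublattice $N_{\mathrm{uf}}\subset N$ of rank $|J_{\mathrm{uf}}|$, positive integers $d_j$ ($j\in J$) with greatest common divisor $1$, and a finite-index sublattice $N^\circ\subset N$ with $\{N_{\mathrm{uf}},N^\circ\}\subset\mathbb{Z}$ and $\{N,N_{\mathrm{uf}}\cap N^\circ\}\subset\mathbb{Z}$. A seed is a tuple $\mathsf{s}=(\mathbf{e}_j\mid j\in J)$ that is a $\mathbb{Z}$-basis of $N$, with $\{\mathbf{e}_j\}_{j\in J_{\mathrm{uf}}}$ a $\mathbb{Z}$-basis of $N_{\mathrm{uf}}$ and $\{d_j\mathbf{e}_j\}_{j\in J}$ a $\mathbb{Z}$-basis of $N^\circ$. Its exchange matrix has entries $\varepsilon_{r,s}=\{\mathbf{e}_r,\mathbf{e}_s\}d_s$. Let $M=\mathrm{Hom}(N,\mathbb{Z})$, $M_{\mathbb{R}}=M\otimes\mathbb{R}$, let $\{\mathbf{e}_j^*\}$ be the dual basis and $\mathbf{f}_j=d_j^{-1}\mathbf{e}_j^*$. With $[a]_+=\max\{a,0\}$, the mutation of $\mathsf{s}$ in direction $k\in J_{\mathrm{uf}}$ is the seed $(\mathbf{e}'_j)$ with $\mathbf{e}'_k=-\mathbf{e}_k$ and $\mathbf{e}'_j=\mathbf{e}_j+[\varepsilon_{j,k}]_+\mathbf{e}_k$ for $j\neq k$; correspondingly $\mathbf{f}'_k=-\mathbf{f}_k+\sum_i[\varepsilon_{k,i}]_+\mathbf{f}_i$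 and $\mathbf{f}'_j=\mathbf{f}_j$ for $j\ne k$. $\mathbb{T}$ is the oriented rooted tree with root $t_0$ in which each vertex has $|J_{\mathrm{uf}}|$ outgoing edges labeled by $J_{\mathrm{uf}}$; if the edge labeled $k$ goes from $t$ to $t'$, write $t'=\mu_k(t)$. An initial seed $\mathsf{s}_{t_0}$ is given, and $\mathsf{s}_{t'}$ is the mutation of $\mathsf{s}_t$ in direction $k$ whenever $t'=\mu_k(t)$. For each $t$, the basis $\{\mathbf{f}_j\}$ attached to $\mathsf{s}_t$ identifies $M_{\mathbb{R}}=\{\sum_ju_j\mathbf{f}_j\}$ with $\mathbb{R}^J$, and $S_t$, $\Delta_t$ are regarded as subsets of $\mathbb{R}_{\ge0}\times M_{\mathbb{R}}\simeq\mathbb{R}_{\ge0}\times\mathbb{R}^J$ and $M_{\mathbb{R}}\simeq\mathbb{R}^J$ through it. The center of $\Delta_{t_0}$ is a point $\mathbf{u}_{t_0,0}\in\mathbb{R}^J$; the corresponding vector of $M_{\mathbb{R}}$ (through $\mathsf{s}_{t_0}$) is $\mathbf{u}_0$, and $\mathbf{u}_{t,0}\in\mathbb{R}^J$ is the image of $\mathbf{u}_0$ under the identification $M_{\mathbb{R}}\simeq\mathbb{R}^J$ given by $\mathsf{s}_t$. Tropical cluster structure. For $t'=\mu_k(t)$ the tropicalized cluster mutation $\mu_k^T\colon\mathbb{R}^J\to\mathbb{R}^J$ (from the chart of $\mathsf{s}_t$ to the chart of $\mathsf{s}_{t'}$) sends $\mathbf{u}=(u_j)$ to $\mathbf{u}'=(u_j')$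 with $u'_k=-u_k$, and for $j\ne k$: $u'_j=u_j+[\varepsilon_{k,j}]_+u_k$ if $u_k\ge0$, $u_j'=u_j+[-\varepsilon_{k,j}]_+u_k$ if $u_k\le0$, where $\varepsilon_{k,j}$ are entries of the exchange matrix of $\mathsf{s}_t$. Put $\widehat\mu_k^T(r,\mathbf{u})=(r,\mu_k^T(\mathbf{u}))$. For each $t\in\mathbb{T}$ there is given a valuation $v_t\colon\mathbb{C}(X)\setminus\{0\}\to\mathbb{Z}^J$ with one-dimensional leaves; $h$ is a fixed non-zero section of $\mathcal{L}$. The family $\{S_t\}$ (resp. $\{\Delta_t\}$) has a tropical cluster structure if $S_{t'}=\widehat\mu_k^T(S_t)$ (resp. $\Delta_{t'}=\mu_k^T(\Delta_t)$) whenever $t'=\mu_k(t)$. Polytopes. For a full-dimensional polytope $P\subset\mathbb{R}^J$ with $\mathbf{0}$ in its interior, $P^\circ=\{\mathbf{v}\in\mathbb{R}^J : \langle\mathbf{u},\mathbf{v}\rangle+1\ge0\ \forall\mathbf{u}\in P\}$ (standard pairing). A full-dimensional rational polytope $\Delta\subset\mathbb{R}^J$ is $\mathbb{Q}$-Gorenstein Fano of size $\nu\in\mathbb{N}$ with center $\mathbf{c}\in\mathbb{R}^J$ if $\nu\cdot(\Delta-\mathbf{c})^\circ$ is a lattice polytope each of whose vertices is a primitive lattice vector. *)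

theory Defs
  imports
    "HOL-Analysis.Analysis"
    "HOL-Library.Poly_Mapping"
    "HOL-Computational_Algebra.Polynomial"
    "HOL-Algebra.Ring"
begin

section \<open>Polynomials\<close>

text \<open>
  Polynomials over \<open>'c\<close> in the variables \<open>'v\<close> are elements of the monoid algebra
  \<open>('v \<Rightarrow>\<^sub>0 nat) \<Rightarrow>\<^sub>0 'c\<close>. With \<open>'c = complex poly\<close> the coefficients are polynomials
  in the parameter \<open>\<tau>\<close> of a one-parameter family.
\<close>

type_synonym ('v, 'c) mpoly = "('v \<Rightarrow>\<^sub>0 nat) \<Rightarrow>\<^sub>0 'c"

definition eval_with :: "('c::zero \<Rightarrow> 'a::comm_ring_1) \<Rightarrow> ('v \<Rightarrow> 'a) \<Rightarrow> ('v, 'c) mpoly \<Rightarrow> 'a" where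
  "eval_with \<phi> x F =
     (\<Sum>e\<in>Poly_Mapping.keys F. \<phi> (Poly_Mapping.lookup F e) *
        (\<Prod>i\<in>Poly_Mapping.keys e. x i ^ Poly_Mapping.lookup e i))"

abbreviation eval :: "('v, complex) mpoly \<Rightarrow> complex ^ 'v \<Rightarrow> complex" where
  "eval F x \<equiv> eval_with (\<lambda>c. c) (($) x) F"

abbreviation eval_at :: "complex \<Rightarrow> ('v, complex poly) mpoly \<Rightarrow> complex ^ 'v \<Rightarrow> complex" where
  "eval_at \<tau> F x \<equiv> eval_with (\<lambda>p. poly p \<tau>) (($) x) F"

definition homogeneous :: "nat \<Rightarrow> ('v::finite, 'c::zero) mpoly \<Rightarrow> bool" where
  "homogeneous k F \<longleftrightarrow>
     (\<forall>e\<in>Poly_Mapping.keys F. (\<Sum>i\<in>UNIV. Poly_Mapping.lookup e i) = k)"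

section \<open>Projective varieties\<close>

text \<open>
  A subset of the projective space \<open>\<P>(\<complex>\<^sup>n)\<close> with homogeneous coordinates indexed by \<open>'n\<close>
  is represented by the set of all nonzero vectors whose class belongs to it.
\<close>

definition proj_eq :: "complex ^ 'n \<Rightarrow> complex ^ 'n \<Rightarrow> bool" where
  "proj_eq x y \<longleftrightarrow> (\<exists>c. c \<noteq> 0 \<and> x = c *s y)"

definition zero_locus :: "('n::finite, complex) mpoly set \<Rightarrow> (complex ^ 'n) set" where
  "zero_locus A = {x. x \<noteq> 0 \<and> (\<forall>F\<in>A. eval F x = 0)}"

definition proj_closed :: "(complex ^ 'n::finite) set \<Rightarrow> bool" where
  "proj_closed X \<longleftrightarrow> (\<exists>A. (\<forall>F\<in>A. \<exists>k. homogeneous k F) \<and> X = zero_locus A)"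

definition proj_variety :: "(complex ^ 'n::finite) set \<Rightarrow> bool" where
  "proj_variety X \<longleftrightarrow> proj_closed X \<and> X \<noteq> {} \<and>
     (\<forall>Y Z. proj_closed Y \<longrightarrow> proj_closed Z \<longrightarrow> X = Y \<union> Z \<longrightarrow> X = Y \<or> X = Z)"

definition vanishing_ideal :: "(complex ^ 'n::finite) set \<Rightarrow> ('n, complex) mpoly set" where
  "vanishing_ideal X = {F. \<forall>x\<in>X. eval F x = 0}"

definition has_variety_chain :: "(complex ^ 'n::finite) set \<Rightarrow> nat \<Rightarrow> bool" where
  "has_variety_chain X k \<longleftrightarrow>
     (\<exists>Z. (\<forall>i\<le>k. proj_variety (Z i) \<and> Z i \<subseteq> X) \<and> (\<forall>i<k. Z i \<subset> Z (Suc i)))"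

definition has_dim :: "(complex ^ 'n::finite) set \<Rightarrow> nat \<Rightarrow> bool" where
  "has_dim X m \<longleftrightarrow> has_variety_chain X m \<and> \<not> has_variety_chain X (Suc m)"

definition partial_deriv :: "'n::finite \<Rightarrow> ('n, complex) mpoly \<Rightarrow> complex ^ 'n \<Rightarrow> complex" where
  "partial_deriv i F x = deriv (\<lambda>z. eval F (\<chi> j. if j = i then z else x $ j)) (x $ i)"

text \<open>
  The Jacobian criterion: \<open>cone_tangent_space X x\<close> is the Zariski tangent space at \<open>x\<close> of the
  affine cone over \<open>X\<close>, whose dimension exceeds that of \<open>X\<close> by one.
\<close>

definition cone_tangent_space :: "(complex ^ 'n::finite) set \<Rightarrow> complex ^ 'n \<Rightarrow> (complex ^ 'n) set" where
  "cone_tangent_space X x =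
     {w. \<forall>F\<in>vanishing_ideal X. (\<Sum>i\<in>UNIV. partial_deriv i F x * w $ i) = 0}"

definition smooth :: "(complex ^ 'n::finite) set \<Rightarrow> bool" where
  "smooth X \<longleftrightarrow> (\<forall>m. has_dim X m \<longrightarrow> (\<forall>x\<in>X. vec.dim (cone_tangent_space X x) = m + 1))"

text \<open>
  \<open>sections_O1 X\<close> is \<open>H\<^sup>0(X, \<O>\<^sub>X(1))\<close>: functions on the punctured cone which are locally quotients of
  forms whose degrees differ by one. A variety with a very ample line bundle \<open>\<L>\<close> is given by its
  embedding by \<open>\<L>\<close>, that is, as a subvariety \<open>X\<close> of \<open>\<P>(H\<^sup>0(X, \<L>)\<^sup>*)\<close> for which the linear
  forms restrict isomorphically onto \<open>H\<^sup>0(X, \<O>\<^sub>X(1))\<close>; then \<open>\<L> = \<O>\<^sub>X(1)\<close>.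
\<close>

definition sections_O1 :: "(complex ^ 'n::finite) set \<Rightarrow> (complex ^ 'n \<Rightarrow> complex) set" where
  "sections_O1 X = {s. \<forall>x\<in>X. \<exists>k F G. homogeneous (k + 1) F \<and> homogeneous k G \<and> eval G x \<noteq> 0 \<and>
     (\<forall>y\<in>X. eval G y \<noteq> 0 \<longrightarrow> s y = eval F y / eval G y)}"

definition embedded_by_complete_linear_system :: "(complex ^ 'n::finite) set \<Rightarrow> bool" where
  "embedded_by_complete_linear_system X \<longleftrightarrow>
     (\<forall>l. homogeneous 1 l \<and> l \<in> vanishing_ideal X \<longrightarrow> l = 0) \<and>
     (\<forall>s\<in>sections_O1 X. \<exists>l. homogeneous 1 l \<and> (\<forall>x\<in>X. s x = eval l x))"

section \<open>Rational functions, local rings, normality\<close>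

text \<open>
  \<open>ratfun X F G\<close> is the rational function \<open>F / G\<close> on \<open>X\<close>, as a class of pairs of forms of equal degree
  modulo the vanishing ideal. The operations of \<open>function_field\<close> are unions of classes all of
  which coincide.
\<close>

definition ratfun :: "(complex ^ 'n::finite) set \<Rightarrow> ('n, complex) mpoly \<Rightarrow> ('n, complex) mpoly
    \<Rightarrow> (('n, complex) mpoly \<times> ('n, complex) mpoly) set" where
  "ratfun X F G = {(F', G'). (\<exists>k. homogeneous k F' \<and> homogeneous k G') \<and>
     G' \<notin> vanishing_ideal X \<and> F * G' - F' * G \<in> vanishing_ideal X}"

definition function_field :: "(complex ^ 'n::finite) set
    \<Rightarrow> (('n, complex) mpoly \<times> ('n, complex) mpoly) set ring" where
  "function_field X =
     \<lparr>carrier = {ratfun X F G | F G k. homogeneous k F \<and> homogeneous k G \<and> G \<notin> vanishing_ideal X},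
      monoid.mult = (\<lambda>a b. \<Union>(F, G)\<in>a. \<Union>(F', G')\<in>b. ratfun X (F * F') (G * G')),
      one = ratfun X 1 1,
      zero = ratfun X 0 1,
      add = (\<lambda>a b. \<Union>(F, G)\<in>a. \<Union>(F', G')\<in>b. ratfun X (F * G' + F' * G) (G * G'))\<rparr>"

definition const_fun :: "(complex ^ 'n::finite) set \<Rightarrow> complex
    \<Rightarrow> (('n, complex) mpoly \<times> ('n, complex) mpoly) set" where
  "const_fun X c = ratfun X (Poly_Mapping.single 0 c) 1"

definition local_ring :: "(complex ^ 'n::finite) set \<Rightarrow> complex ^ 'n
    \<Rightarrow> (('n, complex) mpoly \<times> ('n, complex) mpoly) set set" where
  "local_ring X x = {ratfun X F G | F G k. homogeneous k F \<and> homogeneous k G \<and> eval G x \<noteq> 0}"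

definition integral_over :: "('a, 'b) ring_scheme \<Rightarrow> 'a set \<Rightarrow> 'a \<Rightarrow> bool" where
  "integral_over K A a \<longleftrightarrow> (\<exists>n c. (\<forall>i<n. c i \<in> A) \<and>
     a [^]\<^bsub>K\<^esub> (n::nat) \<oplus>\<^bsub>K\<^esub> (\<Oplus>\<^bsub>K\<^esub>i\<in>{..<n}. c i \<otimes>\<^bsub>K\<^esub> a [^]\<^bsub>K\<^esub> i) = \<zero>\<^bsub>K\<^esub>)"

definition normal_at_all_points :: "(complex ^ 'n::finite) set \<Rightarrow> bool" where
  "normal_at_all_points X \<longleftrightarrow> (\<forall>x\<in>X. \<forall>a\<in>carrier (function_field X).
     integral_over (function_field X) (local_ring X x) a \<longrightarrow> a \<in> local_ring X x)"

section \<open>Toric varieties\<close>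

text \<open>
  The torus \<open>(\<complex>\<^sup>*)\<^sup>r\<close>, with coordinates indexed by \<open>{..<r}\<close> and padded by \<open>1\<close>.
  Morphisms from it (or from its product with \<open>V\<close>) to a projective space are given
  locally by tuples of polynomials; negative powers of the torus coordinates can be cleared.
  In \<open>regular_on_product\<close> the variables \<open>Inl i\<close> are torus coordinates, the
  variables \<open>Inr i\<close> homogeneous coordinates.
\<close>

definition torus :: "nat \<Rightarrow> (nat \<Rightarrow> complex) set" where
  "torus r = {z. \<forall>i. if i < r then z i \<noteq> 0 else z i = 1}"

definition regular_on_torus :: "nat \<Rightarrow> ((nat \<Rightarrow> complex) \<Rightarrow> complex ^ 'p::finite) \<Rightarrow> bool" where
  "regular_on_torus r \<phi> \<longleftrightarrow> (\<forall>z\<in>torus r. \<exists>F :: 'p \<Rightarrow> (nat, complex) mpoly.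
     (\<exists>i. eval_with (\<lambda>c. c) z (F i) \<noteq> 0) \<and>
     (\<forall>z'\<in>torus r. (\<exists>i. eval_with (\<lambda>c. c) z' (F i) \<noteq> 0) \<longrightarrow>
        proj_eq (\<phi> z') (\<chi> i. eval_with (\<lambda>c. c) z' (F i))))"

definition regular_on_product :: "nat \<Rightarrow> (complex ^ 'p::finite) set
    \<Rightarrow> ((nat \<Rightarrow> complex) \<Rightarrow> complex ^ 'p \<Rightarrow> complex ^ 'p) \<Rightarrow> bool" where
  "regular_on_product r V a \<longleftrightarrow> (\<forall>z\<in>torus r. \<forall>x\<in>V. \<exists>k (F :: 'p \<Rightarrow> (nat + 'p, complex) mpoly).
     (\<forall>i. \<forall>e\<in>Poly_Mapping.keys (F i). (\<Sum>j\<in>UNIV. Poly_Mapping.lookup e (Inr j)) = k) \<and>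
     (\<exists>i. eval_with (\<lambda>c. c) (case_sum z (($) x)) (F i) \<noteq> 0) \<and>
     (\<forall>z'\<in>torus r. \<forall>x'\<in>V. (\<exists>i. eval_with (\<lambda>c. c) (case_sum z' (($) x')) (F i) \<noteq> 0) \<longrightarrow>
        proj_eq (a z' x') (\<chi> i. eval_with (\<lambda>c. c) (case_sum z' (($) x')) (F i))))"

definition toric_structure :: "(complex ^ 'p::finite) set \<Rightarrow> nat
    \<Rightarrow> ((nat \<Rightarrow> complex) \<Rightarrow> complex ^ 'p) \<Rightarrow> ((nat \<Rightarrow> complex) \<Rightarrow> complex ^ 'p \<Rightarrow> complex ^ 'p) \<Rightarrow> bool" where
  "toric_structure V r \<phi> a \<longleftrightarrow>
     \<comment> \<open>\<open>\<phi>\<close> is an isomorphism of the torus onto a Zariski open subset of \<open>V\<close>\<close>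
     (\<forall>z\<in>torus r. \<phi> z \<in> V) \<and> regular_on_torus r \<phi> \<and>
     (\<forall>z\<in>torus r. \<forall>z'\<in>torus r. proj_eq (\<phi> z) (\<phi> z') \<longrightarrow> z = z') \<and>
     proj_closed {x\<in>V. \<forall>z\<in>torus r. \<not> proj_eq x (\<phi> z)} \<and>
     (\<forall>i<r. \<forall>z\<in>torus r. \<exists>k F G. homogeneous k F \<and> homogeneous k G \<and> eval G (\<phi> z) \<noteq> 0 \<and>
        (\<forall>z'\<in>torus r. eval G (\<phi> z') \<noteq> 0 \<longrightarrow> z' i = eval F (\<phi> z') / eval G (\<phi> z'))) \<and>
     \<comment> \<open>\<open>a\<close> is an algebraic action on \<open>V\<close> that extends the action of the torus on itself\<close>
     (\<forall>z\<in>torus r. \<forall>x\<in>V. a z x \<in> V) \<and> regular_on_product r V a \<and>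
     (\<forall>x\<in>V. proj_eq (a (\<lambda>_. 1) x) x) \<and>
     (\<forall>z\<in>torus r. \<forall>z'\<in>torus r. \<forall>x\<in>V. proj_eq (a (\<lambda>i. z i * z' i) x) (a z (a z' x))) \<and>
     (\<forall>z\<in>torus r. \<forall>z'\<in>torus r. proj_eq (a z (\<phi> z')) (\<phi> (\<lambda>i. z i * z' i)))"

definition toric_variety :: "(complex ^ 'p::finite) set \<Rightarrow> bool" where
  "toric_variety V \<longleftrightarrow> proj_variety V \<and> (\<exists>r \<phi> a. toric_structure V r \<phi> a)"

text \<open>
  The closed subscheme of projective space cut out by the homogeneous ideal \<open>I\<close> is a normal toric
  variety. The first conjunct says that the subscheme is reduced.
\<close>

definition normal_toric_variety :: "('p::finite, complex) mpoly set \<Rightarrow> bool" where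
  "normal_toric_variety I \<longleftrightarrow> vanishing_ideal (zero_locus I) = I \<and>
     toric_variety (zero_locus I) \<and> normal_at_all_points (zero_locus I)"

section \<open>Valuations and Newton--Okounkov bodies\<close>

definition compatible_order :: "(int ^ 'j) rel \<Rightarrow> bool" where
  "compatible_order ordr \<longleftrightarrow> linear_order ordr \<and>
     (\<forall>a b c. (a, b) \<in> ordr \<longrightarrow> (a + c, b + c) \<in> ordr)"

definition is_valuation :: "(complex ^ 'n::finite) set \<Rightarrow> (int ^ 'j) rel
    \<Rightarrow> ((('n, complex) mpoly \<times> ('n, complex) mpoly) set \<Rightarrow> int ^ 'j) \<Rightarrow> bool" where
  "is_valuation X ordr v \<longleftrightarrow> compatible_order ordr \<and> (let K = function_field X in
     (\<forall>f\<in>carrier K - {\<zero>\<^bsub>K\<^esub>}. \<forall>g\<in>carrier K - {\<zero>\<^bsub>K\<^esub>}.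
        v (f \<otimes>\<^bsub>K\<^esub> g) = v f + v g \<and>
        (f \<oplus>\<^bsub>K\<^esub> g \<noteq> \<zero>\<^bsub>K\<^esub> \<longrightarrow> (v f, v (f \<oplus>\<^bsub>K\<^esub> g)) \<in> ordr \<or> (v g, v (f \<oplus>\<^bsub>K\<^esub> g)) \<in> ordr)) \<and>
     (\<forall>f\<in>carrier K - {\<zero>\<^bsub>K\<^esub>}. \<forall>c. c \<noteq> 0 \<longrightarrow> v (const_fun X c \<otimes>\<^bsub>K\<^esub> f) = v f))"

definition one_dim_leaves :: "(complex ^ 'n::finite) set \<Rightarrow> (int ^ 'j) rel
    \<Rightarrow> ((('n, complex) mpoly \<times> ('n, complex) mpoly) set \<Rightarrow> int ^ 'j) \<Rightarrow> bool" where
  "one_dim_leaves X ordr v \<longleftrightarrow> (let K = function_field X in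
     \<forall>f\<in>carrier K - {\<zero>\<^bsub>K\<^esub>}. \<forall>g\<in>carrier K - {\<zero>\<^bsub>K\<^esub>}. v f = v g \<longrightarrow>
       (\<exists>c. c \<noteq> 0 \<and> (g = const_fun X c \<otimes>\<^bsub>K\<^esub> f \<or>
          (v g, v (g \<ominus>\<^bsub>K\<^esub> const_fun X c \<otimes>\<^bsub>K\<^esub> f)) \<in> ordr - Id)))"

text \<open>
  \<open>R\<^sub>k\<close> is the space of forms of degree \<open>k\<close> modulo the vanishing ideal, and \<open>h\<close> is a linear form.
\<close>

definition NO_semigroup :: "(complex ^ 'n::finite) set \<Rightarrow> ('n, complex) mpoly
    \<Rightarrow> ((('n, complex) mpoly \<times> ('n, complex) mpoly) set \<Rightarrow> int ^ 'j) \<Rightarrow> (nat \<times> (int ^ 'j)) set" where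
  "NO_semigroup X h v =
     {(k, v (ratfun X f (h ^ k))) | k f. k \<ge> 1 \<and> homogeneous k f \<and> f \<notin> vanishing_ideal X}"

definition real_vec :: "int ^ 'j \<Rightarrow> real ^ 'j" where
  "real_vec u = (\<chi> j. real_of_int (u $ j))"

definition real_points :: "(nat \<times> (int ^ 'j)) set \<Rightarrow> (real \<times> (real ^ 'j)) set" where
  "real_points S = (\<lambda>(k, u). (real k, real_vec u)) ` S"

definition NO_body :: "(nat \<times> (int ^ 'j::finite)) set \<Rightarrow> (real ^ 'j) set" where
  "NO_body S = closure (convex hull {(1 / real k) *\<^sub>R real_vec u | k u. (k, u) \<in> S})"

definition fin_gen_semigroup :: "'a::comm_monoid_add set \<Rightarrow> bool" where
  "fin_gen_semigroup S \<longleftrightarrow> (\<exists>A. finite A \<and> S = {sum_list xs | xs. xs \<noteq> [] \<and> set xs \<subseteq> A})"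

definition saturated :: "(nat \<times> (int ^ 'j)) set \<Rightarrow> bool" where
  "saturated S \<longleftrightarrow> (\<forall>r u n. (n * r, int n *s u) \<in> S \<longrightarrow> (r, u) \<in> S)"

section \<open>Toric degenerations\<close>

text \<open>
  A closed subscheme of \<open>\<P>(\<complex>\<^sup>p) \<times> \<complex>\<close> is given by an ideal of \<open>\<complex>[\<tau>][y]\<close> homogeneous in \<open>y\<close>.
\<close>

definition flat_family :: "('p, complex poly) mpoly set \<Rightarrow> bool" where
  \<comment> \<open>over the principal ideal domain \<open>\<complex>[\<tau>]\<close> flat means torsion-free\<close>
  "flat_family I \<longleftrightarrow> (\<forall>q F. q \<noteq> 0 \<longrightarrow> Poly_Mapping.single 0 q * F \<in> I \<longrightarrow> F \<in> I)"

definition fiber_ideal :: "('p, complex poly) mpoly set \<Rightarrow> complex \<Rightarrow> ('p, complex) mpoly set" where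
  "fiber_ideal I \<tau> = Poly_Mapping.map (\<lambda>q. poly q \<tau>) ` I"

text \<open>
  Anderson's degeneration is the relative \<open>Proj\<close> of a finitely generated graded
  \<open>\<complex>[\<tau>]\<close>-subalgebra \<open>\<R>\<close> of \<open>R[\<tau>]\<close> with \<open>\<R>[\<tau>\<^sup>-\<^sup>1] = R[\<tau>, \<tau>\<^sup>-\<^sup>1]\<close> and \<open>\<R>/\<tau>\<R>\<close> isomorphic, as a
  graded algebra, to the semigroup algebra \<open>\<complex>[S]\<close>, so that the central fiber is \<open>Proj \<complex>[S]\<close>. It is
  embedded by generators \<open>G\<^sub>i\<close> of a Veronese subalgebra
  \<open>\<Oplus>\<^sub>l \<R>\<^sub>d\<^sub>l\<close> that is generated in degree \<open>d\<close>: the ideal \<open>I\<close> of the family is the kernel of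
  \<open>y\<^sub>i \<mapsto> G\<^sub>i\<close>, and \<open>g\<^sub>i\<close> is the image of \<open>G\<^sub>i\<close> in \<open>\<complex>[S]\<close>.
\<close>

definition trivial_off_zero :: "(complex ^ 'n::finite) set \<Rightarrow> nat
    \<Rightarrow> ('p::finite \<Rightarrow> ('n, complex poly) mpoly) \<Rightarrow> bool" where
  "trivial_off_zero X d G \<longleftrightarrow> (\<forall>l (f :: ('n, complex) mpoly). homogeneous (d * l) f \<longrightarrow>
     (\<exists>m (F :: ('p, complex poly) mpoly). homogeneous l F \<and>
        (\<forall>\<tau>. \<forall>x\<in>X. \<tau> ^ m * eval f x = eval_at \<tau> F (\<chi> i. eval_at \<tau> (G i) x))))"

definition is_Proj_semigroup_algebra :: "(nat \<times> (int ^ 'j)) set \<Rightarrow> nat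
    \<Rightarrow> ('p::finite, complex) mpoly set \<Rightarrow> bool" where
  "is_Proj_semigroup_algebra S d I \<longleftrightarrow> (\<exists>g :: 'p \<Rightarrow> (nat \<times> (int ^ 'j)) \<Rightarrow>\<^sub>0 complex.
     I = {F. eval_with (Poly_Mapping.single 0) g F = 0} \<and>
     (\<forall>i. Poly_Mapping.keys (g i) \<subseteq> {s\<in>S. fst s = d}) \<and>
     (\<forall>l\<ge>1. eval_with (Poly_Mapping.single 0) g ` {F. homogeneous l F} =
              {b. Poly_Mapping.keys b \<subseteq> {s\<in>S. fst s = d * l}}))"

definition toric_degeneration :: "(complex ^ 'n::finite) set \<Rightarrow> (nat \<times> (int ^ 'j)) set
    \<Rightarrow> ('p::finite, complex poly) mpoly set \<Rightarrow> bool" where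
  "toric_degeneration X S I \<longleftrightarrow> flat_family I \<and>
     (\<exists>d (G :: 'p \<Rightarrow> ('n, complex poly) mpoly). d \<ge> 1 \<and> (\<forall>i. homogeneous d (G i)) \<and>
        I = {F. \<forall>\<tau>. \<forall>x\<in>X. eval_at \<tau> F (\<chi> i. eval_at \<tau> (G i) x) = 0} \<and>
        trivial_off_zero X d G \<and>
        is_Proj_semigroup_algebra S d (fiber_ideal I 0))"

section \<open>Seeds and tropical mutations\<close>

text \<open>The lattice \<open>N\<close> of rank \<open>|J|\<close> is \<open>int ^ 'j\<close>; a seed is one of its bases.\<close>

definition subgroup_of :: "(int ^ 'j) set \<Rightarrow> bool" where
  "subgroup_of L \<longleftrightarrow> 0 \<in> L \<and> (\<forall>x\<in>L. \<forall>y\<in>L. x - y \<in> L)"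

definition lattice_basis :: "('j \<Rightarrow> int ^ 'j) \<Rightarrow> 'j set \<Rightarrow> (int ^ 'j::finite) set \<Rightarrow> bool" where
  "lattice_basis b I L \<longleftrightarrow> L = {\<Sum>i\<in>I. c i *s b i | c. True} \<and>
     (\<forall>c. (\<Sum>i\<in>I. c i *s b i) = 0 \<longrightarrow> (\<forall>i\<in>I. c i = 0))"

definition fixed_data :: "(int ^ 'j \<Rightarrow> int ^ 'j \<Rightarrow> rat) \<Rightarrow> 'j set \<Rightarrow> (int ^ 'j::finite) set
    \<Rightarrow> ('j \<Rightarrow> int) \<Rightarrow> (int ^ 'j) set \<Rightarrow> bool" where
  "fixed_data form Juf Nuf d Ncirc \<longleftrightarrow>
     (\<forall>x y z. form (x + y) z = form x z + form y z) \<and> (\<forall>x y. form x y = - form y x) \<and>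
     subgroup_of Nuf \<and> (\<exists>b. lattice_basis b Juf Nuf) \<and>
     (\<forall>n x. n \<noteq> 0 \<longrightarrow> n *s x \<in> Nuf \<longrightarrow> x \<in> Nuf) \<and>
     (\<forall>j. d j > 0) \<and> Gcd (range d) = 1 \<and>
     subgroup_of Ncirc \<and> finite (range (\<lambda>x. (+) x ` Ncirc)) \<and>
     (\<forall>x\<in>Nuf. \<forall>y\<in>Ncirc. form x y \<in> \<int>) \<and> (\<forall>x. \<forall>y\<in>Nuf \<inter> Ncirc. form x y \<in> \<int>)"

definition is_seed :: "'j set \<Rightarrow> (int ^ 'j::finite) set \<Rightarrow> ('j \<Rightarrow> int) \<Rightarrow> (int ^ 'j) set
    \<Rightarrow> ('j \<Rightarrow> int ^ 'j) \<Rightarrow> bool" where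
  "is_seed Juf Nuf d Ncirc s \<longleftrightarrow> lattice_basis s UNIV UNIV \<and> lattice_basis s Juf Nuf \<and>
     lattice_basis (\<lambda>j. d j *s s j) UNIV Ncirc"

definition exchange_matrix :: "(int ^ 'j \<Rightarrow> int ^ 'j \<Rightarrow> rat) \<Rightarrow> ('j \<Rightarrow> int) \<Rightarrow> ('j \<Rightarrow> int ^ 'j)
    \<Rightarrow> 'j \<Rightarrow> 'j \<Rightarrow> rat" where
  "exchange_matrix form d s r r' = form (s r) (s r') * of_int (d r')"

definition mutate_seed :: "(int ^ 'j \<Rightarrow> int ^ 'j \<Rightarrow> rat) \<Rightarrow> ('j \<Rightarrow> int) \<Rightarrow> 'j \<Rightarrow> ('j \<Rightarrow> int ^ 'j)
    \<Rightarrow> 'j \<Rightarrow> int ^ 'j" where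
  \<comment> \<open>the floor is exact: \<open>\<epsilon>\<^sub>j\<^sub>k\<close> is an integer for unfrozen \<open>k\<close>\<close>
  "mutate_seed form d k s j =
     (if j = k then - s k else s j + \<lfloor>max (exchange_matrix form d s j k) 0\<rfloor> *s s k)"

text \<open>
  A vertex of the tree is the list of labels on the path from the root \<open>[]\<close>, the last edge coming
  first. The vertex set is \<open>lists Juf\<close>, and \<open>\<mu>\<^sub>k(t) = k # t\<close>.
\<close>

fun seed_at :: "(int ^ 'j \<Rightarrow> int ^ 'j \<Rightarrow> rat) \<Rightarrow> ('j \<Rightarrow> int) \<Rightarrow> ('j \<Rightarrow> int ^ 'j) \<Rightarrow> 'j list
    \<Rightarrow> 'j \<Rightarrow> int ^ 'j" where
  "seed_at form d s0 [] = s0"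
| "seed_at form d s0 (k # t) = mutate_seed form d k (seed_at form d s0 t)"

text \<open>\<open>M\<^sub>\<real> = Hom(N, \<int>) \<otimes> \<real>\<close> is the space of additive maps from \<open>N\<close> to \<open>\<real>\<close>.\<close>

definition M_real :: "(int ^ 'j \<Rightarrow> real) set" where
  "M_real = {u. \<forall>x y. u (x + y) = u x + u y}"

definition dual_basis :: "('j \<Rightarrow> int ^ 'j) \<Rightarrow> 'j \<Rightarrow> int ^ 'j::finite \<Rightarrow> int" where
  "dual_basis s j n = (THE c. n = (\<Sum>i\<in>UNIV. c i *s s i)) j"

definition f_basis :: "('j \<Rightarrow> int) \<Rightarrow> ('j \<Rightarrow> int ^ 'j) \<Rightarrow> 'j \<Rightarrow> int ^ 'j::finite \<Rightarrow> real" where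
  "f_basis d s j n = (1 / real_of_int (d j)) * real_of_int (dual_basis s j n)"

definition seed_coords :: "('j \<Rightarrow> int) \<Rightarrow> ('j \<Rightarrow> int ^ 'j) \<Rightarrow> (int ^ 'j::finite \<Rightarrow> real) \<Rightarrow> real ^ 'j" where
  "seed_coords d s u = (THE c. \<forall>n. u n = (\<Sum>j\<in>UNIV. c $ j * f_basis d s j n))"

definition trop_mutation :: "('j \<Rightarrow> 'j \<Rightarrow> rat) \<Rightarrow> 'j \<Rightarrow> real ^ 'j \<Rightarrow> real ^ 'j" where
  "trop_mutation \<epsilon> k u = (\<chi> j.
     if j = k then - (u $ k)
     else if u $ k \<ge> 0 then u $ j + real_of_rat (max (\<epsilon> k j) 0) * u $ k
     else u $ j + real_of_rat (max (- \<epsilon> k j) 0) * u $ k)"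

definition trop_mutation_hat :: "('j \<Rightarrow> 'j \<Rightarrow> rat) \<Rightarrow> 'j \<Rightarrow> real \<times> (real ^ 'j) \<Rightarrow> real \<times> (real ^ 'j)" where
  "trop_mutation_hat \<epsilon> k = (\<lambda>(r, u). (r, trop_mutation \<epsilon> k u))"

definition semigroups_tropical_cluster :: "'j set \<Rightarrow> ('j list \<Rightarrow> 'j \<Rightarrow> 'j \<Rightarrow> rat)
    \<Rightarrow> ('j list \<Rightarrow> (nat \<times> (int ^ 'j)) set) \<Rightarrow> bool" where
  "semigroups_tropical_cluster Juf \<epsilon> S \<longleftrightarrow> (\<forall>t\<in>lists Juf. \<forall>k\<in>Juf.
     real_points (S (k # t)) = trop_mutation_hat (\<epsilon> t) k ` real_points (S t))"

section \<open>\<open>\<rat>\<close>-Gorenstein Fano polytopes\<close>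

definition polar_dual :: "(real ^ 'j::finite) set \<Rightarrow> (real ^ 'j) set" where
  "polar_dual P = {v. \<forall>u\<in>P. u \<bullet> v + 1 \<ge> 0}"

definition rational_polytope :: "(real ^ 'j::finite) set \<Rightarrow> bool" where
  "rational_polytope P \<longleftrightarrow> (\<exists>A. finite A \<and> (\<forall>x\<in>A. \<forall>j. x $ j \<in> \<rat>) \<and> P = convex hull A)"

definition lattice_polytope :: "(real ^ 'j::finite) set \<Rightarrow> bool" where
  "lattice_polytope P \<longleftrightarrow> (\<exists>A. finite A \<and> A \<subseteq> range real_vec \<and> P = convex hull A)"

definition primitive_vector :: "real ^ 'j::finite \<Rightarrow> bool" where
  "primitive_vector x \<longleftrightarrow> (\<exists>u. x = real_vec u \<and> Gcd (range (($) u)) = 1)"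

definition Q_Gorenstein_Fano :: "(real ^ 'j::finite) set \<Rightarrow> nat \<Rightarrow> real ^ 'j \<Rightarrow> bool" where
  "Q_Gorenstein_Fano P \<nu> c \<longleftrightarrow> rational_polytope P \<and> interior P \<noteq> {} \<and> c \<in> interior P \<and>
     (let D = (*\<^sub>R) (real \<nu>) ` polar_dual ((\<lambda>x. x - c) ` P) in
        lattice_polytope D \<and> (\<forall>x. x extreme_point_of D \<longrightarrow> primitive_vector x))"

end

theory Submission
  imports Defs "HOL-Computational_Algebra.Fundamental_Theorem_Algebra"
begin

text \<open>
  A center that is fixed by the mutations in direction \<open>k\<close> from both ends of an edge lies on the wall
  \<open>u\<^sub>k = 0\<close>, unless the mutation is linear. Hence the mutation commutes with the translation that
  moves the center to the origin, and on either side of the wall it is a unimodular shear. A vertex of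
  the dual polytope after the mutation has an active constraint off the wall, and the transposed shear
  on the side of that constraint carries it to a vertex of the dual polytope before the mutation. So
  primitive lattice vertices stay primitive lattice vertices.

  The mutation is homogeneous and preserves the lattice, so saturation also passes along edges. The
  central fiber is \<open>Proj \<complex>[S]\<close> for a saturated semigroup \<open>S\<close>. Its torus is \<open>(\<complex>\<^sup>*)\<^sup>J\<close> because the
  Newton--Okounkov body is full-dimensional. For normality, a fraction that is integral over a local
  ring becomes almost integral over \<open>\<complex>[S]\<close> after clearing a denominator. It is a Laurent polynomial:
  substituting \<open>t\<^bsup>w(e)\<^esup> e\<close> for each exponent \<open>e\<close>, with generic weights \<open>w\<close>, makes the leading coefficient
  of the denominator invertible, so division with remainder is possible, and the remainder vanishes
  because \<open>\<complex>[t]\<close> is normal. Its exponents lie in \<open>S\<close> by Dickson's lemma and saturation.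
\<close>

section \<open>Monoid algebras\<close>

\<comment> \<open>The obstacle is that a tropical mutation is only piecewise linear: in general it
  neither commutes with convex hulls nor preserves convexity. Convexity of the mutated polytope
  therefore comes from the semigroups. The points \<open>u / k\<close> with \<open>(k, u)\<close> in
  \<open>S\<close> are dense in the Newton-Okounkov body, so the mutation carries one body onto the
  next, and finite generation makes the new body a rational polytope. The linear coordinate change
  of a seed mutation coincides with the branch of the tropical mutation for nonpositive coordinate
  \<open>k\<close>. A fixed center thus imposes a condition only on the positive side of the wall;
  for a center on the negative side the condition has to be read at the next edge with the same
  label. In the normality argument \<open>S\<close> has no element of degree zero and forms can be
  lifted only in positive degrees. For this reason the unit is adjoined to \<open>S\<close>, and
  denominators are multiplied by a linear form.\<close>
alias keys = Poly_Mapping.keys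
alias lookup = Poly_Mapping.lookup
alias single = Poly_Mapping.single

definition ring_map :: "('a::comm_ring_1 \<Rightarrow> 'b::comm_ring_1) \<Rightarrow> bool" where
  "ring_map f \<longleftrightarrow> f 1 = 1 \<and> (\<forall>x y. f (x + y) = f x + f y) \<and> (\<forall>x y. f (x * y) = f x * f y)"

lemma ring_map_simps:
  assumes "ring_map f"
  shows ring_map_1: "f 1 = 1" and ring_map_add: "f (x + y) = f x + f y"
    and ring_map_mult: "f (x * y) = f x * f y" and ring_map_0: "f 0 = 0"
    and ring_map_diff: "f (x - y) = f x - f y" and ring_map_power: "f (x ^ n) = f x ^ n"
proof -
  show 1: "f 1 = 1" "f (x + y) = f x + f y" and m: "f (x * y) = f x * f y" for x y
    using assms by (auto simp: ring_map_def)
  show "f 0 = 0"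
    using 1(2)[of 0 0] by simp
  show "f (x - y) = f x - f y"
    using 1(2)[of "x - y" y] by simp
  show "f (x ^ n) = f x ^ n" by (induction n) (auto simp: 1 m)
qed

lemma ring_map_sum: "ring_map f \<Longrightarrow> f (sum g A) = (\<Sum>x\<in>A. f (g x))"
  by (induction A rule: infinite_finite_induct) (auto simp: ring_map_simps)

lemma ring_map_prod: "ring_map f \<Longrightarrow> f (prod g A) = (\<Prod>x\<in>A. f (g x))"
  by (induction A rule: infinite_finite_induct) (auto simp: ring_map_simps)

lemma ring_map_comp: "ring_map f \<Longrightarrow> ring_map g \<Longrightarrow> ring_map (\<lambda>x. f (g x))"
  by (auto simp: ring_map_def)

lemma ring_map_id: "ring_map (\<lambda>x. x)"
  by (auto simp: ring_map_def)

lemma ring_map_single_0: "ring_map (single (0::'m::comm_monoid_add))"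
  by (auto simp: ring_map_def single_add mult_single)

definition character :: "('m::comm_monoid_add \<Rightarrow> 'a::comm_ring_1) \<Rightarrow> bool" where
  "character \<omega> \<longleftrightarrow> \<omega> 0 = 1 \<and> (\<forall>x y. \<omega> (x + y) = \<omega> x * \<omega> y)"

text \<open>The universal map out of a monoid algebra. Evaluation of polynomials, evaluation at
  torus points, the torus action and forgetting the degree are all instances and share one proof of
  multiplicativity.\<close>

definition lift_char :: "('c::zero \<Rightarrow> 'a::comm_ring_1) \<Rightarrow> ('m \<Rightarrow> 'a) \<Rightarrow> ('m \<Rightarrow>\<^sub>0 'c) \<Rightarrow> 'a" where
  "lift_char \<phi> \<omega> f = (\<Sum>e\<in>keys f. \<phi> (lookup f e) * \<omega> e)"

lemma lift_char_superset:
  assumes "finite A" "keys f \<subseteq> A" "\<phi> 0 = 0"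
  shows "lift_char \<phi> \<omega> f = (\<Sum>e\<in>A. \<phi> (lookup f e) * \<omega> e)"
  unfolding lift_char_def using assms
  by (intro sum.mono_neutral_left) (auto simp: in_keys_iff)

lemma lift_char_add:
  assumes "ring_map \<phi>"
  shows "lift_char \<phi> \<omega> (f + g) = lift_char \<phi> \<omega> f + lift_char \<phi> \<omega> g"
proof -
  let ?A = "keys f \<union> keys g"
  have "lift_char \<phi> \<omega> h = (\<Sum>e\<in>?A. \<phi> (lookup h e) * \<omega> e)"
    if "keys h \<subseteq> ?A" for h
    by (rule lift_char_superset) (use that assms in \<open>auto simp: ring_map_simps\<close>)
  then show ?thesis
    using keys_add[of f g]
    by (simp add: lookup_add ring_map_add[OF assms] algebra_simps sum.distrib)
qed

lemma lift_char_single: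
  assumes "ring_map \<phi>"
  shows "lift_char \<phi> \<omega> (single e c) = \<phi> c * \<omega> e"
  by (auto simp: lift_char_def ring_map_0[OF assms])

lemma lift_char_sum:
  assumes "ring_map \<phi>"
  shows "lift_char \<phi> \<omega> (sum f A) = (\<Sum>x\<in>A. lift_char \<phi> \<omega> (f x))"
proof -
  have "lift_char \<phi> \<omega> 0 = 0" by (simp add: lift_char_def)
  then show ?thesis
    by (induction A rule: infinite_finite_induct) (auto simp: lift_char_add[OF assms])
qed

lemma poly_mapping_expand:
  "f = (\<Sum>e\<in>keys f. single e (lookup f e))"
  by (rule poly_mapping_eqI) (auto simp: lookup_sum lookup_single when_def in_keys_iff)

lemma mult_expand:
  fixes f g :: "'m::comm_monoid_add \<Rightarrow>\<^sub>0 'c::comm_ring_1"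
  shows "f * g = (\<Sum>x\<in>keys f. \<Sum>y\<in>keys g.
    single (x + y) (lookup f x * lookup g y))"
  by (subst (1) poly_mapping_expand[of f], subst (1) poly_mapping_expand[of g])
     (simp add: sum_product mult_single)

lemma ring_map_lift_char:
  assumes "ring_map \<phi>" "character \<omega>"
  shows "ring_map (lift_char \<phi> \<omega>)"
proof -
  have "lift_char \<phi> \<omega> (f * g) = lift_char \<phi> \<omega> f * lift_char \<phi> \<omega> g" for f g
  proof -
    have "lift_char \<phi> \<omega> (f * g) = (\<Sum>x\<in>keys f. \<Sum>y\<in>keys g.
        \<phi> (lookup f x * lookup g y) * \<omega> (x + y))"
      by (subst mult_expand) (simp add: lift_char_sum[OF assms(1)] lift_char_single[OF assms(1)])
    also have "\<dots> = lift_char \<phi> \<omega> f * lift_char \<phi> \<omega> g"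
      using assms by (simp add: lift_char_def sum_product ring_map_simps character_def mult_ac)
    finally show ?thesis .
  qed
  moreover have "lift_char \<phi> \<omega> 1 = 1"
    using lift_char_single[OF assms(1), of \<omega> 0 1] assms by (simp add: character_def ring_map_simps)
  ultimately show ?thesis
    using assms by (simp add: ring_map_def lift_char_add)
qed

lemma ring_map_eq_on_monoid_algebra:
  fixes f g :: "('m::comm_monoid_add \<Rightarrow>\<^sub>0 'c::comm_ring_1) \<Rightarrow> 'a::comm_ring_1"
  assumes "ring_map f" "ring_map g"
    and "\<And>c. f (single 0 c) = g (single 0 c)"
    and "\<And>e. f (single e 1) = g (single e 1)"
  shows "f F = g F"
proof -
  have "f (single e c) = g (single e c)" for e c
  proof -
    have "single e c = single 0 c * single e 1" by (simp add: mult_single)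
    then show ?thesis
      using assms by (simp add: ring_map_mult)
  qed
  then show ?thesis
    by (subst (1 2) poly_mapping_expand[of F]) (simp add: ring_map_sum assms(1,2))
qed

lemma keys_mult_subset:
  fixes F G :: "'m::comm_monoid_add \<Rightarrow>\<^sub>0 'c::comm_ring_1"
  assumes "keys F \<subseteq> A" "keys G \<subseteq> B" "\<And>x y. x \<in> A \<Longrightarrow> y \<in> B \<Longrightarrow> x + y \<in> C"
  shows "keys (F * G) \<subseteq> C"
  using keys_mult[of F G] assms by fastforce

text \<open>The sets \<open>A k\<close> may overlap. Besides honest degrees this allows auxiliary
  gradings that only record which exponents can occur in a product.\<close>

locale graded_exponents =
  fixes A :: "'k::comm_monoid_add \<Rightarrow> 'm::comm_monoid_add set"
  assumes zero: "0 \<in> A 0" and add: "x \<in> A i \<Longrightarrow> y \<in> A j \<Longrightarrow> x + y \<in> A (i + j)"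
begin

abbreviation piece :: "'k \<Rightarrow> ('m \<Rightarrow>\<^sub>0 'c::comm_ring_1) \<Rightarrow> bool" where
  "piece k F \<equiv> keys F \<subseteq> A k"

lemma piece_one: "piece 0 1"
  using zero by simp

lemma piece_mult: "piece i F \<Longrightarrow> piece j G \<Longrightarrow> piece (i + j) (F * G)"
  by (rule keys_mult_subset) (auto intro: add)

lemma piece_sum: "(\<And>x. x \<in> X \<Longrightarrow> piece k (F x)) \<Longrightarrow> piece k (\<Sum>x\<in>X. F x)"
  using keys_sum[of F X] by blast

lemma piece_prod: "(\<And>x. x \<in> X \<Longrightarrow> piece (k x) (F x)) \<Longrightarrow> piece (\<Sum>x\<in>X. k x) (\<Prod>x\<in>X. F x)"
proof (induction X rule: infinite_finite_induct)
  case (insert x X)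
  then have "piece (k x) (F x)" "piece (sum k X) (prod F X)" by auto
  from piece_mult[OF this] show ?case
    using insert by simp
qed (auto simp: zero)

end

locale nat_graded_exponents = graded_exponents A for A :: "nat \<Rightarrow> 'm::comm_monoid_add set"
begin

lemma piece_power: "piece k F \<Longrightarrow> piece (n * k) (F ^ n)"
proof (induction n)
  case (Suc n)
  then show ?case
    using piece_mult[of F k "F ^ n" "n * k"] by simp
qed (auto simp: zero)

end

section \<open>Polynomials and forms\<close>

abbreviation expo_eval :: "('v \<Rightarrow> 'a::comm_ring_1) \<Rightarrow> ('v \<Rightarrow>\<^sub>0 nat) \<Rightarrow> 'a" where
  "expo_eval x e \<equiv> \<Prod>i\<in>keys e. x i ^ lookup e i"

lemma expo_eval_superset:
  "finite A \<Longrightarrow> keys e \<subseteq> A \<Longrightarrow> expo_eval x e = (\<Prod>i\<in>A. x i ^ lookup e i)"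
  by (intro prod.mono_neutral_left) (auto simp: in_keys_iff)

lemma character_expo_eval: "character (expo_eval x)"
proof -
  have "expo_eval x (e + e') = expo_eval x e * expo_eval x e'" for e e'
    using keys_add[of e e']
    by (subst (1 2 3) expo_eval_superset[of "keys e \<union> keys e'"])
       (auto simp: lookup_add power_add prod.distrib)
  then show ?thesis by (simp add: character_def)
qed

lemma eval_with_lift_char: "eval_with \<phi> x = lift_char \<phi> (expo_eval x)"
  by (simp add: eval_with_def lift_char_def fun_eq_iff)

lemma ring_map_eval_with: "ring_map \<phi> \<Longrightarrow> ring_map (eval_with \<phi> x)"
  by (simp add: eval_with_lift_char ring_map_lift_char character_expo_eval)

lemmas ring_map_eval = ring_map_eval_with[OF ring_map_id]

definition Var :: "'v \<Rightarrow> ('v, 'c::comm_ring_1) mpoly" where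
  "Var i = single (single i 1) 1"

abbreviation Const :: "'c \<Rightarrow> ('v, 'c::comm_ring_1) mpoly" where
  "Const \<equiv> single 0"

lemma eval_with_Var [simp]: "ring_map \<phi> \<Longrightarrow> eval_with \<phi> x (Var i) = x i"
  by (simp add: eval_with_lift_char Var_def lift_char_single ring_map_1)

lemma eval_with_Const [simp]: "ring_map \<phi> \<Longrightarrow> eval_with \<phi> x (Const c) = \<phi> c"
  by (simp add: eval_with_lift_char lift_char_single)

lemma single_expo_eval_Var:
  "single e 1 = expo_eval (Var :: 'v \<Rightarrow> ('v, 'c::comm_ring_1) mpoly) e"
proof -
  have pow: "Var i ^ n = (single (single i n) 1 :: ('v, 'c) mpoly)" for i n
    by (induction n) (auto simp: Var_def mult_single single_add[symmetric])
  have "(\<Prod>i\<in>A. single (f i) (1::'c)) = single (\<Sum>i\<in>A. f i) 1"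
    if "finite A" for A and f :: "'v \<Rightarrow> 'v \<Rightarrow>\<^sub>0 nat"
    using that by (induction A rule: finite_induct) (auto simp: mult_single)
  then show ?thesis by (simp add: pow poly_mapping_expand[symmetric])
qed

lemma ring_map_eq_on_mpoly:
  fixes f g :: "('v, 'c::comm_ring_1) mpoly \<Rightarrow> 'a::comm_ring_1"
  assumes "ring_map f" "ring_map g"
    and "\<And>c. f (Const c) = g (Const c)" and "\<And>i. f (Var i) = g (Var i)"
  shows "f F = g F"
proof (rule ring_map_eq_on_monoid_algebra[OF assms(1-3)])
  fix e :: "'v \<Rightarrow>\<^sub>0 nat"
  show "f (single e 1) = g (single e 1)"
    by (simp add: single_expo_eval_Var ring_map_prod ring_map_power assms)
qed

text \<open>Both sides are ring maps in \<open>F\<close> that agree on constants and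
  variables.\<close>

lemma eval_with_comp:
  assumes "ring_map \<phi>" "ring_map f"
  shows "f (eval_with \<phi> x F) = eval_with (\<lambda>c. f (\<phi> c)) (\<lambda>i. f (x i)) F"
  by (rule ring_map_eq_on_mpoly[of "\<lambda>F. f (eval_with \<phi> x F)"])
     (use ring_map_comp[OF assms(2,1)] in
       \<open>auto intro!: ring_map_comp[OF assms(2)] ring_map_eval_with assms(1) simp: assms(1)\<close>)

definition expo_deg :: "('v::finite \<Rightarrow>\<^sub>0 nat) \<Rightarrow> nat" where
  "expo_deg e = (\<Sum>i\<in>UNIV. lookup e i)"

interpretation forms: nat_graded_exponents "\<lambda>k. {e :: 'v::finite \<Rightarrow>\<^sub>0 nat. expo_deg e = k}"
  by unfold_locales (auto simp: expo_deg_def lookup_add sum.distrib)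

lemma homogeneous_iff: "homogeneous k F \<longleftrightarrow> keys F \<subseteq> {e. expo_deg e = k}"
  by (auto simp: homogeneous_def expo_deg_def)

lemma homogeneous_0: "homogeneous k 0"
  by (auto simp: homogeneous_def)

lemma homogeneous_1: "homogeneous 0 (1 :: ('v::finite, 'c::comm_ring_1) mpoly)"
  unfolding homogeneous_iff by (rule forms.piece_one)

lemma homogeneous_add: "homogeneous k F \<Longrightarrow> homogeneous k G \<Longrightarrow> homogeneous k (F + G)"
  unfolding homogeneous_iff using keys_add[of F G] by blast

lemma homogeneous_uminus:
  fixes F :: "('v::finite, 'c::comm_ring_1) mpoly"
  shows "homogeneous k F \<Longrightarrow> homogeneous k (- F)"
  by (auto simp: homogeneous_def in_keys_iff)

lemma homogeneous_diff:
  fixes F :: "('v::finite, 'c::comm_ring_1) mpoly"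
  shows "homogeneous k F \<Longrightarrow> homogeneous k G \<Longrightarrow> homogeneous k (F - G)"
  using homogeneous_add[OF _ homogeneous_uminus, of k F G] by simp

lemma homogeneous_mult:
  fixes F :: "('v::finite, 'c::comm_ring_1) mpoly"
  shows "homogeneous i F \<Longrightarrow> homogeneous j G \<Longrightarrow> homogeneous (i + j) (F * G)"
  unfolding homogeneous_iff by (rule forms.piece_mult)

lemma homogeneous_power:
  fixes F :: "('v::finite, 'c::comm_ring_1) mpoly"
  shows "homogeneous k F \<Longrightarrow> homogeneous (n * k) (F ^ n)"
  unfolding homogeneous_iff by (rule forms.piece_power)

lemma homogeneous_sum:
  fixes F :: "'a \<Rightarrow> ('v::finite, 'c::comm_ring_1) mpoly"
  shows "(\<And>x. x \<in> X \<Longrightarrow> homogeneous k (F x)) \<Longrightarrow> homogeneous k (\<Sum>x\<in>X. F x)"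
  unfolding homogeneous_iff by (rule forms.piece_sum)

lemma homogeneous_prod:
  fixes F :: "'a \<Rightarrow> ('v::finite, 'c::comm_ring_1) mpoly"
  shows "(\<And>x. x \<in> X \<Longrightarrow> homogeneous (k x) (F x)) \<Longrightarrow> homogeneous (\<Sum>x\<in>X. k x) (\<Prod>x\<in>X. F x)"
  unfolding homogeneous_iff by (rule forms.piece_prod)

definition component :: "nat \<Rightarrow> ('v::finite, 'c::comm_ring_1) mpoly \<Rightarrow> ('v, 'c) mpoly" where
  "component k F =
     (\<Sum>e\<in>{e\<in>keys F. expo_deg e = k}. single e (lookup F e))"

lemma homogeneous_component: "homogeneous k (component k F)"
  unfolding component_def by (rule homogeneous_sum) (auto simp: homogeneous_iff)

lemma sum_component: "F = (\<Sum>k\<in>expo_deg ` keys F. component k F)"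
proof -
  have "(\<Sum>k\<in>expo_deg ` keys F. component k F) =
    (\<Sum>e\<in>keys F. single e (lookup F e))"
    unfolding component_def by (rule sum.group) auto
  then show ?thesis
    using poly_mapping_expand by metis
qed

lemma eval_with_homogeneous_scale:
  fixes F :: "('v::finite, 'c::comm_ring_1) mpoly"
  assumes "homogeneous k F"
  shows "eval_with \<phi> (\<lambda>i. c * x i) F = c ^ k * eval_with \<phi> x F"
proof -
  have "expo_eval (\<lambda>i. c * x i) e = c ^ k * expo_eval x e" if "e \<in> keys F" for e
  proof -
    have "k = (\<Sum>i\<in>UNIV. lookup e i)"
      using assms that by (auto simp: homogeneous_def)
    then show ?thesis
      by (simp add: expo_eval_superset[of UNIV] power_mult_distrib prod.distrib power_sum)
  qed
  then show ?thesis by (simp add: eval_with_def sum_distrib_left mult_ac)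
qed

section \<open>Leading terms\<close>

definition additive_weight :: "('m::comm_monoid_add \<Rightarrow> int) \<Rightarrow> bool" where
  "additive_weight w \<longleftrightarrow> (\<forall>x y. w (x + y) = w x + w y)"

lemma additive_weight_0: "additive_weight w \<Longrightarrow> w 0 = 0"
  unfolding additive_weight_def by (metis add_cancel_right_right add_0_right)

lemma additive_weight_add: "additive_weight w \<Longrightarrow> w (x + y) = w x + w y"
  by (simp add: additive_weight_def)

lemma additive_weight_uminus:
  fixes x :: "'m::ab_group_add"
  assumes "additive_weight w"
  shows "w (- x) = - w x"
  using additive_weight_add[OF assms, of x "- x"] additive_weight_0[OF assms] by simp

text \<open>The weight \<open>K * w1 + w2\<close> encodes the lexicographic order of the two
  weights, because \<open>K\<close> exceeds every difference of values of \<open>w2\<close> on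
  \<open>E\<close>.\<close>

lemma additive_weight_combine:
  assumes "additive_weight w1" "additive_weight w2" "finite E"
  shows "\<exists>w. additive_weight w \<and> (\<forall>x\<in>E. \<forall>y\<in>E. w x = w y \<longrightarrow> w1 x = w1 y \<and> w2 x = w2 y)"
proof -
  define K where "K = 1 + 2 * (\<Sum>x\<in>E. \<bar>w2 x\<bar>)"
  have K: "\<bar>w2 x - w2 y\<bar> < K" if "x \<in> E" "y \<in> E" for x y
  proof -
    have "\<bar>w2 z\<bar> \<le> (\<Sum>x\<in>E. \<bar>w2 x\<bar>)" if "z \<in> E" for z
      using that assms(3) by (intro member_le_sum) auto
    from this[OF that(1)] this[OF that(2)] show ?thesis
      by (simp add: K_def)
  qed
  define w where "w x = K * w1 x + w2 x" for x
  have "additive_weight w"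
    using assms by (simp add: additive_weight_def w_def algebra_simps)
  moreover have "w1 x = w1 y \<and> w2 x = w2 y" if "x \<in> E" "y \<in> E" "w x = w y" for x y
  proof -
    have "K * (w1 x - w1 y) = w2 y - w2 x"
      using that(3) by (simp add: w_def algebra_simps)
    moreover have "K \<le> K * \<bar>w1 x - w1 y\<bar>" if "w1 x \<noteq> w1 y"
      using K[of x x] \<open>x \<in> E\<close> that by (simp add: mult_le_cancel_left1)
    moreover have "\<bar>K * (w1 x - w1 y)\<bar> = K * \<bar>w1 x - w1 y\<bar>"
      using K[of x x] \<open>x \<in> E\<close> by (simp add: abs_mult)
    ultimately show ?thesis
      using K[OF that(2,1)] by (cases "w1 x = w1 y") auto
  qed
  ultimately show ?thesis by blast
qed

text \<open>Generic integer weights take the place of a monomial order. A class is used because both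
  the graded exponents \<open>nat \<times> int ^ 'j\<close> and the Laurent exponents
  \<open>int ^ 'j\<close> occur; the instances combine weights of the components.\<close>

class int_separated = cancel_comm_monoid_add +
  assumes separating_weight': "finite E \<Longrightarrow> \<exists>w::'a \<Rightarrow> int. (\<forall>x y. w (x + y) = w x + w y) \<and> inj_on w E"

lemma separating_weight:
  fixes E :: "'m::int_separated set"
  assumes "finite E"
  obtains w where "additive_weight w" "inj_on w E"
  using separating_weight'[OF assms] unfolding additive_weight_def by blast

instance nat :: int_separated
proof
  show "\<exists>w::nat \<Rightarrow> int. (\<forall>x y. w (x + y) = w x + w y) \<and> inj_on w E" for E
    by (rule exI[of _ int]) auto
qed

instance int :: int_separated
proof
  show "\<exists>w::int \<Rightarrow> int. (\<forall>x y. w (x + y) = w x + w y) \<and> inj_on w E" for E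
    by (rule exI[of _ "\<lambda>x. x"]) auto
qed

instance prod :: (int_separated, int_separated) int_separated
proof
  fix E :: "('a \<times> 'b) set" assume E: "finite E"
  obtain w1 where w1: "additive_weight w1" "inj_on w1 (fst ` E)"
    by (rule separating_weight[of "fst ` E"]) (use E in auto)
  obtain w2 where w2: "additive_weight w2" "inj_on w2 (snd ` E)"
    by (rule separating_weight[of "snd ` E"]) (use E in auto)
  have "additive_weight (\<lambda>x::'a \<times> 'b. w1 (fst x))" "additive_weight (\<lambda>x::'a \<times> 'b. w2 (snd x))"
    using w1(1) w2(1) by (auto simp: additive_weight_def)
  from additive_weight_combine[OF this E] obtain w where w: "additive_weight w"
    "\<And>x y. x \<in> E \<Longrightarrow> y \<in> E \<Longrightarrow> w x = w y \<Longrightarrow> w1 (fst x) = w1 (fst y) \<and> w2 (snd x) = w2 (snd y)"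
    by blast
  have "inj_on w E"
    using w(2) w1(2) w2(2) by (intro inj_onI prod_eqI) (meson imageI inj_onD)+
  then show "\<exists>w::'a \<times> 'b \<Rightarrow> int. (\<forall>x y. w (x + y) = w x + w y) \<and> inj_on w E"
    using w(1) unfolding additive_weight_def by blast
qed

instance vec :: (int_separated, finite) int_separated
proof
  fix E :: "('a ^ 'b) set" assume E: "finite E"
  have "\<exists>w. additive_weight w \<and> (\<forall>x\<in>E. \<forall>y\<in>E. w x = w y \<longrightarrow> (\<forall>i\<in>I. x $ i = y $ i))" for I :: "'b set"
  proof (induction I rule: infinite_finite_induct)
    case (insert i I)
    then obtain w1 where w1: "additive_weight w1"
      "\<forall>x\<in>E. \<forall>y\<in>E. w1 x = w1 y \<longrightarrow> (\<forall>i\<in>I. x $ i = y $ i)"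
      by blast
    obtain w2 where w2: "additive_weight w2" "inj_on w2 ((\<lambda>x. x $ i) ` E)"
      by (rule separating_weight[of "(\<lambda>x. x $ i) ` E"]) (use E in auto)
    have "additive_weight (\<lambda>x::'a ^ 'b. w2 (x $ i))"
      using w2(1) by (auto simp: additive_weight_def)
    from additive_weight_combine[OF w1(1) this E] obtain w where w: "additive_weight w"
      "\<And>x y. x \<in> E \<Longrightarrow> y \<in> E \<Longrightarrow> w x = w y \<Longrightarrow> w1 x = w1 y \<and> w2 (x $ i) = w2 (y $ i)"
      by blast
    have "x $ k = y $ k" if "x \<in> E" "y \<in> E" "w x = w y" "k \<in> insert i I" for x y k
      using w(2)[OF that(1-3)] that w1(2) w2(2) by (auto simp: inj_on_def)
    with w(1) show ?case
      by blast
  qed (auto simp: additive_weight_def intro!: exI[of _ "\<lambda>_. 0"])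
  from this[of UNIV] show "\<exists>w::'a ^ 'b \<Rightarrow> int. (\<forall>x y. w (x + y) = w x + w y) \<and> inj_on w E"
    unfolding additive_weight_def inj_on_def vec_eq_iff by blast
qed

section \<open>Leading exponents\<close>

definition leads :: "('m \<Rightarrow> int) \<Rightarrow> ('m \<Rightarrow>\<^sub>0 'c::zero) \<Rightarrow> 'm \<Rightarrow> bool" where
  "leads w f u \<longleftrightarrow> u \<in> keys f \<and> (\<forall>v\<in>keys f. v \<noteq> u \<longrightarrow> w v < w u)"

lemma leads_exists:
  assumes "f \<noteq> 0" "inj_on w (keys f)"
  obtains u where "leads w f u"
proof -
  have ne: "keys f \<noteq> {}"
    using assms(1) by (metis poly_mapping_eqI lookup_zero not_in_keys_iff_lookup_eq_zero empty_iff)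
  then have "Max (w ` keys f) \<in> w ` keys f" by (intro Max_in) auto
  then obtain u where "u \<in> keys f" "w u = Max (w ` keys f)"
    by force
  then have "u \<in> keys f" "\<And>v. v \<in> keys f \<Longrightarrow> w v \<le> w u" by auto
  then have "leads w f u"
    using assms(2) by (fastforce simp: leads_def inj_on_def order_less_le)
  then show ?thesis by (rule that)
qed

lemma leads_one: "leads w (1 :: 'm::comm_monoid_add \<Rightarrow>\<^sub>0 'c::comm_ring_1) 0"
  by (auto simp: leads_def)

text \<open>Only the pair \<open>(u, v)\<close> reaches the weight of \<open>u + v\<close>, so the
  leading coefficient is a product of two nonzero elements of a domain and nothing cancels
  it.\<close>

lemma leads_mult:
  fixes f g :: "'m::cancel_comm_monoid_add \<Rightarrow>\<^sub>0 'c::idom"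
  assumes "additive_weight w" "leads w f u" "leads w g v"
  shows "leads w (f * g) (u + v)"
proof -
  have uv: "x = u \<and> y = v \<or> w (x + y) < w (u + v)"
    if "x \<in> keys f" "y \<in> keys g" for x y
    using that assms by (cases "x = u"; cases "y = v") (fastforce simp: leads_def additive_weight_def)+
  have "lookup (f * g) (u + v) = (\<Sum>x\<in>keys f. \<Sum>y\<in>keys g.
      if x = u \<and> y = v then lookup f u * lookup g v else 0)"
    unfolding mult_expand[of f g] lookup_sum lookup_single when_def
    using uv by (intro sum.cong refl) fastforce
  also have "\<dots> = (\<Sum>x\<in>keys f. if x = u then
      (\<Sum>y\<in>keys g. if y = v then lookup f u * lookup g v else 0) else 0)"
    by (intro sum.cong) auto
  also have "\<dots> = lookup f u * lookup g v"
    using assms(2,3) by (simp add: leads_def)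
  finally have "u + v \<in> keys (f * g)"
    using assms(2,3) by (simp add: leads_def in_keys_iff)
  moreover have "w z < w (u + v)" if "z \<in> keys (f * g)" "z \<noteq> u + v" for z
    using keys_mult[of f g] that uv by fastforce
  ultimately show ?thesis by (simp add: leads_def)
qed

lemma leads_nonzero: "leads w f u \<Longrightarrow> f \<noteq> 0"
  by (auto simp: leads_def)

lemma monoid_algebra_no_zero_divisors:
  fixes f g :: "'m::int_separated \<Rightarrow>\<^sub>0 'c::idom"
  assumes "f \<noteq> 0" "g \<noteq> 0"
  shows "f * g \<noteq> 0"
proof -
  obtain w where w: "additive_weight w" "inj_on w (keys f \<union> keys g)"
    by (rule separating_weight[of "keys f \<union> keys g"]) auto
  then obtain u v where "leads w f u" "leads w g v"
    using leads_exists assms by (metis inj_on_Un)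
  from leads_mult[OF w(1) this] show ?thesis
    by (rule leads_nonzero)
qed

lemma monoid_algebra_power_nonzero:
  fixes f :: "'m::int_separated \<Rightarrow>\<^sub>0 'c::idom"
  shows "f \<noteq> 0 \<Longrightarrow> f ^ n \<noteq> 0"
proof (induction n)
  case (Suc n)
  then show ?case
    using monoid_algebra_no_zero_divisors[of f "f ^ n"] by simp
qed auto

text \<open>A nonzero polynomial has finitely many roots. The value 0 is left out because
  one-parameter subgroups are defined only for \<open>a \<noteq> 0\<close>.\<close>

lemma poly_eqI_nonzero:
  fixes p q :: "complex poly"
  assumes "\<And>a. a \<noteq> 0 \<Longrightarrow> poly p a = poly q a"
  shows "p = q"
proof (rule ccontr)
  assume "p \<noteq> q"
  then have "finite {a. poly (p - q) a = 0}" by (intro poly_roots_finite) simp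
  then have "finite (insert 0 {a. poly (p - q) a = 0})" by simp
  moreover have "insert 0 {a. poly (p - q) a = 0} = UNIV"
    using assms by auto
  ultimately show False
    using infinite_UNIV_char_0 by metis
qed

lemma coeff_sum_monom_inj:
  assumes "finite A" "inj_on n A" "u \<in> A"
  shows "coeff (\<Sum>e\<in>A. monom (c e) (n e)) (n u) = c u"
proof -
  have "coeff (\<Sum>e\<in>A. monom (c e) (n e)) (n u) = (\<Sum>e\<in>A. if e = u then c e else 0)"
    unfolding coeff_sum using assms(2,3) by (intro sum.cong) (auto simp: inj_on_def)
  also have "\<dots> = c u"
    using assms by simp
  finally show ?thesis .
qed

section \<open>Points of the torus and one-parameter subgroups\<close>

definition torus_character :: "('m::comm_monoid_add \<Rightarrow> complex) \<Rightarrow> bool" where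
  "torus_character \<omega> \<longleftrightarrow> character \<omega> \<and> (\<forall>x. \<omega> x \<noteq> 0)"

text \<open>Translating the point \<open>\<omega>\<close> along the one-parameter subgroup with weights \<open>w\<close>.\<close>

lemma torus_character_translate:
  assumes "torus_character \<omega>" "additive_weight w" "a \<noteq> 0"
  shows "torus_character (\<lambda>x. \<omega> x * a powi w x)"
  using assms additive_weight_0[OF assms(2)]
  by (auto simp: torus_character_def character_def additive_weight_def power_int_add)

lemma torus_character_one: "torus_character (\<lambda>_. 1)"
  by (simp add: torus_character_def character_def)

abbreviation at_point :: "('m \<Rightarrow> complex) \<Rightarrow> ('m \<Rightarrow>\<^sub>0 complex) \<Rightarrow> complex" where
  "at_point \<equiv> lift_char (\<lambda>c. c)"

lemma ring_map_at_point: "torus_character \<omega> \<Longrightarrow> ring_map (at_point \<omega>)"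
  by (simp add: torus_character_def ring_map_lift_char ring_map_id)

text \<open>Along a one-parameter subgroup the value is a Laurent polynomial in \<open>a\<close>;
  the factor \<open>a ^ N\<close> clears its negative powers.\<close>

lemma at_point_translate_poly:
  assumes "\<And>e. e \<in> keys f \<Longrightarrow> w e + int N \<ge> 0" "a \<noteq> 0"
  shows "a ^ N * at_point (\<lambda>x. \<omega> x * a powi w x) f =
    poly (\<Sum>e\<in>keys f. monom (lookup f e * \<omega> e) (nat (w e + int N))) a"
proof -
  have "a ^ nat (w e + int N) = a ^ N * a powi w e" if "e \<in> keys f" for e
    using assms(1)[OF that] assms(2)
    by (metis power_int_add power_int_of_nat mult.commute nat_0_le)
  then show ?thesis by (simp add: lift_char_def poly_sum poly_monom sum_distrib_left mult_ac)
qed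

lemma weight_shift:
  assumes "finite A"
  obtains N where "\<And>e. e \<in> A \<Longrightarrow> w e + int N \<ge> 0"
proof
  have "\<bar>w e\<bar> \<le> (\<Sum>e\<in>A. \<bar>w e\<bar>)" if "e \<in> A" for e
    using that assms by (intro member_le_sum) auto
  then show "w e + int (nat (\<Sum>e\<in>A. \<bar>w e\<bar>)) \<ge> 0" if "e \<in> A" for e
    using that by fastforce
qed

text \<open>For a weight that separates the exponents, the restriction to the one-parameter subgroup
  is, up to a power of \<open>a\<close>, a polynomial in \<open>a\<close> whose coefficients are
  those of \<open>f\<close>.\<close>

lemma vanishing_at_all_points:
  fixes f :: "'m::int_separated \<Rightarrow>\<^sub>0 complex"
  assumes "\<And>\<omega>. torus_character \<omega> \<Longrightarrow> at_point \<omega> f = 0"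
  shows "f = 0"
proof (rule ccontr)
  assume "f \<noteq> 0"
  obtain w where w: "additive_weight w" "inj_on w (keys f)"
    by (rule separating_weight[of "keys f"]) auto
  obtain u where u: "u \<in> keys f"
    using leads_exists[OF \<open>f \<noteq> 0\<close> w(2)] by (auto simp: leads_def)
  obtain N where N: "\<And>e. e \<in> keys f \<Longrightarrow> w e + int N \<ge> 0"
    by (rule weight_shift[of "keys f" w]) auto
  define p where "p = (\<Sum>e\<in>keys f. monom (lookup f e * 1) (nat (w e + int N)))"
  have "p = 0"
  proof (rule poly_eqI_nonzero)
    fix a :: complex assume "a \<noteq> 0"
    then show "poly p a = poly 0 a"
      using at_point_translate_poly[of f w N a "\<lambda>_. 1"] N
        assms[OF torus_character_translate[OF torus_character_one w(1)]]
      by (simp add: p_def)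
  qed
  moreover have "inj_on (\<lambda>e. nat (w e + int N)) (keys f)"
    using N w(2) by (intro inj_onI) (smt (verit) inj_onD nat_eq_iff2 int_nat_eq)
  from coeff_sum_monom_inj[OF finite_keys this u] have "coeff p (nat (w u + int N)) = lookup f u"
    by (simp add: p_def)
  ultimately show False
    using u by (simp add: in_keys_iff)
qed

section \<open>Laurent polynomials are completely integrally closed\<close>

text \<open>Complete integral closedness of \<complex>[t], up to powers of t. A root
  \<open>a\<close> of \<open>g\<close> is nonzero and must be a root of \<open>f\<close>: otherwise,
  for \<open>m\<close> one more than the order of \<open>c\<close> at \<open>a\<close>, the power
  \<open>g ^ m\<close> vanishes at \<open>a\<close> to order at least \<open>m\<close>, but the
  right-hand side only to the order of \<open>c\<close>. Cancelling the linear factor lowers the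
  degree of \<open>g\<close>.\<close>

lemma poly_dvd_if_powers_dvd:
  fixes f g c :: "complex poly"
  assumes "c \<noteq> 0" "poly g 0 \<noteq> 0" "\<And>m. \<exists>N. g ^ m dvd [:0, 1:] ^ N * (c * f ^ m)"
  shows "g dvd f"
  using assms(2,3)
proof (induction "degree g" arbitrary: f g)
  case 0
  then have "is_unit g" by (metis is_unit_iff_degree poly_0)
  then show ?case by (rule unit_imp_dvd)
next
  case (Suc n)
  have g0: "g \<noteq> 0"
    using Suc.prems(1) by auto
  obtain a where a: "poly g a = 0"
    using fundamental_theorem_of_algebra[of g] Suc.hyps(2) constant_degree[of g] by auto
  then obtain g' where g': "g = [:- a, 1:] * g'"
    by (auto simp: poly_eq_0_iff_dvd)
  have "a \<noteq> 0"
    using a Suc.prems(1) by auto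
  have "poly f a = 0"
  proof (rule ccontr)
    assume fa: "poly f a \<noteq> 0"
    then have "f \<noteq> 0" by auto
    obtain N where N: "g ^ Suc (order a c) dvd [:0, 1:] ^ N * (c * f ^ Suc (order a c))"
      using Suc.prems(2) by blast
    have "[:- a, 1:] ^ Suc (order a c) dvd g ^ Suc (order a c)"
      unfolding g' power_mult_distrib by (rule dvd_triv_left)
    then have "[:- a, 1:] ^ Suc (order a c) dvd [:0, 1:] ^ N * (c * f ^ Suc (order a c))"
      using N dvd_trans by blast
    moreover have nz: "[:0, 1:] ^ N * (c * f ^ Suc (order a c)) \<noteq> 0"
      using assms(1) \<open>f \<noteq> 0\<close> by simp
    ultimately have "Suc (order a c) \<le> order a ([:0, 1:] ^ N * (c * f ^ Suc (order a c)))"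
      by (simp add: order_divides del: power_Suc)
    also have "\<dots> = order a ([:0, 1:] ^ N) + (order a c + order a (f ^ Suc (order a c)))"
      using nz by (subst order_mult, simp, subst order_mult) auto
    also have "\<dots> = order a c"
      using fa \<open>a \<noteq> 0\<close> by (simp add: order_0I del: power_Suc)
    finally show False
      by simp
  qed
  then obtain f' where f': "f = [:- a, 1:] * f'"
    by (auto simp: poly_eq_0_iff_dvd)
  have "g' dvd f'"
  proof (rule Suc.hyps(1))
    have "degree g = Suc (degree g')"
      using g0 unfolding g' by (subst degree_mult_eq) auto
    then show "n = degree g'"
      using Suc.hyps(2) by simp
    show "poly g' 0 \<noteq> 0"
      using Suc.prems(1) by (auto simp: g')
    show "\<exists>N. g' ^ m dvd [:0, 1:] ^ N * (c * f' ^ m)" for m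
    proof -
      obtain N where "g ^ m dvd [:0, 1:] ^ N * (c * f ^ m)"
        using Suc.prems(2) by blast
      moreover have "[:0, 1:] ^ N * (c * f ^ m) = [:- a, 1:] ^ m * ([:0, 1:] ^ N * (c * f' ^ m))"
        by (simp only: f' power_mult_distrib mult_ac)
      moreover have "g ^ m = [:- a, 1:] ^ m * g' ^ m" by (simp only: g' power_mult_distrib)
      ultimately have "[:- a, 1:] ^ m * g' ^ m dvd [:- a, 1:] ^ m * ([:0, 1:] ^ N * (c * f' ^ m))"
        by simp
      then have "g' ^ m dvd [:0, 1:] ^ N * (c * f' ^ m)"
        by (subst (asm) dvd_mult_cancel_left) auto
      then show ?thesis ..
    qed
  qed
  then show ?case
    unfolding g' f' by (rule mult_dvd_mono[OF dvd_refl])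
qed

lemma ring_map_map_poly:
  assumes "ring_map h"
  shows "ring_map (map_poly h)"
proof -
  have c: "coeff (map_poly h p) n = h (coeff p n)" for p n
    by (rule coeff_map_poly) (rule ring_map_0[OF assms])
  have "map_poly h (p + q) = map_poly h p + map_poly h q" for p q
    by (rule poly_eqI) (simp add: c ring_map_simps[OF assms])
  moreover have "map_poly h (p * q) = map_poly h p * map_poly h q" for p q
    by (rule poly_eqI) (simp add: c coeff_mult ring_map_sum[OF assms] ring_map_simps[OF assms])
  moreover have "map_poly h 1 = 1"
    by (rule poly_eqI) (auto simp: c ring_map_simps[OF assms] coeff_1)
  ultimately show ?thesis by (simp add: ring_map_def)
qed

text \<open>The substitution of \<open>t\<^bsup>w(e)\<^esup> \<cdot> e\<close> for each exponent \<open>e\<close>, which makes \<open>g\<close> a polynomial in \<open>t\<close>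
  whose leading coefficient is a unit as soon as \<open>w\<close> separates the exponents of \<open>g\<close>.\<close>

definition twist :: "('m::comm_monoid_add \<Rightarrow> int) \<Rightarrow> ('m \<Rightarrow>\<^sub>0 complex) \<Rightarrow> ('m \<Rightarrow>\<^sub>0 complex) poly" where
  "twist w f = (\<Sum>e\<in>keys f. monom (single e (lookup f e)) (nat (w e)))"

lemma poly_twist_1: "poly (twist w f) 1 = f"
  by (simp add: twist_def poly_sum poly_monom poly_mapping_expand[symmetric])

lemma coeff_twist:
  assumes "\<And>e. e \<in> keys f \<Longrightarrow> w e \<ge> 0" "inj_on w (keys f)"
    "u \<in> keys f"
  shows "coeff (twist w f) (nat (w u)) = single u (lookup f u)"
  unfolding twist_def using assms
  by (intro coeff_sum_monom_inj) (auto simp: inj_on_def eq_nat_nat_iff)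

lemma map_poly_twist:
  assumes "torus_character \<omega>"
  shows "map_poly (at_point \<omega>) (twist w f) =
    (\<Sum>e\<in>keys f. monom (lookup f e * \<omega> e) (nat (w e)))"
proof -
  have "ring_map (map_poly (at_point \<omega>))" by (intro ring_map_map_poly ring_map_at_point assms)
  then show ?thesis
    unfolding twist_def
    by (simp add: ring_map_sum map_poly_monom lift_char_single ring_map_id lift_char_def[of _ _ 0])
qed

lemma poly_map_poly_twist:
  assumes "torus_character \<omega>" "\<And>e. e \<in> keys f \<Longrightarrow> w e \<ge> 0" "a \<noteq> 0"
  shows "poly (map_poly (at_point \<omega>) (twist w f)) a = at_point (\<lambda>x. \<omega> x * a powi w x) f"
  using at_point_translate_poly[of f w 0 a \<omega>] assms by (simp add: map_poly_twist)

lemma at_point_single: "torus_character \<omega> \<Longrightarrow> at_point \<omega> (single e c) = c * \<omega> e"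
  by (simp add: lift_char_single ring_map_id)

text \<open>Exponents of the quotient may have negative weight, so its image is a Laurent polynomial
  in t; this is the origin of the power of t. The two sides are compared at nonzero
  \<open>a\<close>, where \<open>T\<close> becomes evaluation at a translated point.\<close>

lemma twisted_powers_dvd:
  fixes f g c :: "'m::comm_monoid_add \<Rightarrow>\<^sub>0 complex"
  assumes w: "additive_weight w" and \<omega>: "torus_character \<omega>"
    and nonneg: "\<And>e. e \<in> keys f \<union> keys g \<union> keys c \<Longrightarrow> w e \<ge> 0"
    and dvd: "g ^ m dvd c * f ^ m"
  defines "T \<equiv> \<lambda>f. map_poly (at_point \<omega>) (twist w f)"
  shows "\<exists>N. T g ^ m dvd [:0, 1:] ^ N * (T c * T f ^ m)"
proof -
  obtain q where q: "c * f ^ m = g ^ m * q"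
    using dvd by (auto simp: dvd_def)
  obtain N where N: "\<And>e. e \<in> keys q \<Longrightarrow> w e + int N \<ge> 0"
    by (rule weight_shift[of "keys q" w]) auto
  define Q where "Q = (\<Sum>e\<in>keys q. monom (lookup q e * \<omega> e) (nat (w e + int N)))"
  have "[:0, 1:] ^ N * (T c * T f ^ m) = T g ^ m * Q"
  proof (rule poly_eqI_nonzero)
    fix a :: complex assume a: "a \<noteq> 0"
    let ?h = "at_point (\<lambda>x. \<omega> x * a powi w x)"
    have h: "ring_map ?h" by (intro ring_map_at_point torus_character_translate \<omega> w a)
    have T: "poly (T k) a = ?h k" if "\<And>e. e \<in> keys k \<Longrightarrow> w e \<ge> 0" for k
      unfolding T_def by (rule poly_map_poly_twist[OF \<omega> that a])
    have "?h c * ?h f ^ m = ?h g ^ m * ?h q"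
      using arg_cong[OF q, of ?h] by (simp add: ring_map_simps[OF h])
    moreover have "poly Q a = a ^ N * ?h q"
      using at_point_translate_poly[of q w N a \<omega>] N a by (simp add: Q_def)
    ultimately show "poly ([:0, 1:] ^ N * (T c * T f ^ m)) a = poly (T g ^ m * Q) a"
      using T[of c] T[of f] T[of g] nonneg by (simp add: mult_ac)
  qed
  then have "T g ^ m dvd [:0, 1:] ^ N * (T c * T f ^ m)" by (rule dvdI)
  then show ?thesis ..
qed

text \<open>The coefficients form no field, hence pseudo-division; its multiplier is a power of the
  leading monomial of \<open>g\<close> and thus a unit. Since the weights are nonnegative and
  separate the exponents of \<open>g\<close>, among which is \<open>0\<close>, the constant term
  stays nonzero at every torus point, as the one-variable case requires.\<close>

lemma twisted_dvd:
  fixes f g c :: "'m::{int_separated, ab_group_add} \<Rightarrow>\<^sub>0 complex"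
  assumes w: "additive_weight w"
    and nonneg: "\<And>e. e \<in> keys f \<union> keys g \<union> keys c \<Longrightarrow> w e \<ge> 0"
    and inj: "inj_on w (keys g)" "inj_on w (keys c)"
    and g0: "0 \<in> keys g" and "c \<noteq> 0"
    and dvd: "\<And>m. g ^ m dvd c * f ^ m"
  shows "g dvd f"
proof -
  let ?G = "twist w g"
  obtain u where u: "leads w g u"
    using leads_exists[OF _ inj(1)] g0 by (metis keys_zero empty_iff)
  then have u_key: "u \<in> keys g" by (simp add: leads_def)
  note coeff_G = coeff_twist[OF nonneg inj(1)]
  have lead: "coeff ?G (nat (w u)) = single u (lookup g u)"
    by (rule coeff_G) (use u_key in auto)
  have lead_nz: "lookup g u \<noteq> 0"
    using u_key by (simp add: in_keys_iff)
  have lead_single_nz: "single u (lookup g u) \<noteq> 0"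
    using lead_nz by (metis lookup_single_eq lookup_zero)
  have "degree ?G \<le> nat (w u)"
    unfolding twist_def
  proof (rule degree_sum_le)
    fix e assume "e \<in> keys g"
    then have "w e \<le> w u"
      using u by (cases "e = u") (auto simp: leads_def less_imp_le)
    then show "degree (monom (single e (lookup g e)) (nat (w e))) \<le> nat (w u)"
      using degree_monom_le[of "single e (lookup g e)" "nat (w e)"] by linarith
  qed auto
  moreover have "nat (w u) \<le> degree ?G"
    using lead lead_single_nz by (intro le_degree) simp
  ultimately have deg_G: "degree ?G = nat (w u)" by simp
  have "?G \<noteq> 0"
    using lead lead_single_nz by auto
  obtain q r where qr: "pseudo_divmod (twist w f) ?G = (q, r)"
    by (cases "pseudo_divmod (twist w f) ?G")
  define k where "k = Suc (degree (twist w f)) - degree ?G"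
  define l where "l = single u (lookup g u)"
  have div: "smult (l ^ k) (twist w f) = ?G * q + r" and deg_r: "r = 0 \<or> degree r < degree ?G"
    using pseudo_divmod[OF \<open>?G \<noteq> 0\<close> qr] by (simp_all add: deg_G lead k_def l_def)
  \<comment> \<open>At each torus point the one-variable case makes the twisted \<open>g\<close>
    divide the remainder. Its leading coefficient survives there, so comparing degrees forces the
    remainder to vanish.\<close>
  have "map_poly (at_point \<omega>) r = 0" if \<omega>: "torus_character \<omega>" for \<omega>
  proof -
    define T where "T = map_poly (at_point \<omega>)"
    have T: "ring_map T"
      unfolding T_def by (intro ring_map_map_poly ring_map_at_point \<omega>)
    have coeff_T: "coeff (T p) n = at_point \<omega> (coeff p n)" for p n
      unfolding T_def by (rule coeff_map_poly) (rule ring_map_0[OF ring_map_at_point[OF \<omega>]])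
    have \<omega>_nz: "\<omega> e \<noteq> 0" for e
      using \<omega> by (simp add: torus_character_def)
    have "T ?G dvd T (twist w f)"
    proof (rule poly_dvd_if_powers_dvd)
      have "c \<noteq> 0" by fact
      then obtain v where "leads w c v"
        by (rule leads_exists[OF _ inj(2)])
      then have v: "v \<in> keys c" by (simp add: leads_def)
      have "coeff (T (twist w c)) (nat (w v)) = lookup c v * \<omega> v"
        using coeff_twist[OF nonneg inj(2) v] by (simp add: coeff_T at_point_single[OF \<omega>])
      then show "T (twist w c) \<noteq> 0"
        using v \<omega>_nz by (auto simp: in_keys_iff)
      have "coeff (T ?G) (nat (w 0)) = lookup g 0 * \<omega> 0"
        using coeff_G[OF _ g0] by (simp add: coeff_T at_point_single[OF \<omega>])
      then show "poly (T ?G) 0 \<noteq> 0"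
        using g0 \<omega>_nz by (simp add: additive_weight_0[OF w] poly_0_coeff_0 in_keys_iff)
      show "\<exists>N. T ?G ^ m dvd [:0, 1:] ^ N * (T (twist w c) * T (twist w f) ^ m)" for m
        unfolding T_def by (rule twisted_powers_dvd[OF w \<omega> nonneg dvd])
    qed
    moreover have "T (smult (l ^ k) (twist w f)) = smult (at_point \<omega> (l ^ k)) (T (twist w f))"
      by (rule poly_eqI) (simp add: coeff_T ring_map_mult[OF ring_map_at_point[OF \<omega>]])
    ultimately have "T ?G dvd T ?G * T q + T r"
      using arg_cong[OF div, of T] by (simp add: ring_map_simps[OF T] dvd_smult)
    then have dvd_r: "T ?G dvd T r" by (simp add: dvd_add_right_iff)
    show "T r = 0"
    proof (rule ccontr)
      assume nz: "T r \<noteq> 0"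
      then have "r \<noteq> 0" by (auto simp: ring_map_0[OF T])
      have "coeff (T ?G) (degree ?G) \<noteq> 0"
        using lead_nz \<omega>_nz by (simp add: coeff_T deg_G lead at_point_single[OF \<omega>])
      then have "degree ?G \<le> degree (T ?G)" by (rule le_degree)
      also have "\<dots> \<le> degree (T r)" by (rule dvd_imp_degree_le[OF dvd_r nz])
      also have "\<dots> \<le> degree r"
        unfolding T_def by (rule Polynomial.map_poly_degree_leq)
      finally show False
        using deg_r \<open>r \<noteq> 0\<close> by simp
    qed
  qed
  note r_vanishes = this
  have "coeff r n = 0" for n
  proof (rule vanishing_at_all_points)
    fix \<omega> :: "'m \<Rightarrow> complex" assume \<omega>: "torus_character \<omega>"
    show "at_point \<omega> (coeff r n) = 0"
      using coeff_map_poly[of "at_point \<omega>" r n] ring_map_0[OF ring_map_at_point[OF \<omega>]]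
        r_vanishes[OF \<omega>] by simp
  qed
  then have "r = 0" by (simp add: poly_eq_iff)
  \<comment> \<open>Setting t = 1 undoes the twist; the inverse monomial then removes the multiplier
    \<open>l ^ k\<close>.\<close>
  then have div1: "l ^ k * f = g * poly q 1"
    using arg_cong[OF div, of "\<lambda>p. poly p 1"] by (simp add: poly_twist_1)
  define l' where "l' = single (- u) (inverse (lookup g u))"
  have "l ^ k * l' ^ k = 1"
    unfolding power_mult_distrib[symmetric] l_def l'_def using lead_nz by (simp add: mult_single)
  moreover have "(l ^ k * l' ^ k) * f = (l ^ k * f) * l' ^ k" by (simp only: mult_ac)
  ultimately have "f = g * (poly q 1 * l' ^ k)" by (simp add: div1 mult.assoc)
  then show ?thesis by (rule dvdI)
qed

lemma keys_single_mult:
  fixes f :: "'m::ab_group_add \<Rightarrow>\<^sub>0 'c::comm_ring_1"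
  shows "keys (single u 1 * f) = (+) u ` keys f"
proof
  show sub: "keys (single u 1 * f) \<subseteq> (+) u ` keys f" for u and f :: "'m \<Rightarrow>\<^sub>0 'c"
    using keys_mult[of "single u 1" f] by auto
  have "f = single (- u) 1 * (single u 1 * f)" by (simp add: mult.assoc[symmetric] mult_single)
  then have "keys f \<subseteq> (+) (- u) ` keys (single u 1 * f)"
    using sub by metis
  then show "(+) u ` keys f \<subseteq> keys (single u 1 * f)" by auto
qed

text \<open>Monomials are units, so divisibility ignores them.\<close>

lemma dvd_unit_single_mult:
  fixes f g :: "'m::ab_group_add \<Rightarrow>\<^sub>0 'c::comm_ring_1"
  shows "single u 1 * f dvd single v 1 * g \<longleftrightarrow> f dvd g"
proof
  have "single u 1 * f dvd single v 1 * g" if fg: "f dvd g" for u v and f g :: "'m \<Rightarrow>\<^sub>0 'c"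
  proof -
    obtain q where "g = f * q"
      using fg by (rule dvdE)
    moreover have "single v 1 = single u 1 * single (v - u) (1::'c)" by (simp add: mult_single)
    ultimately have "single v 1 * g =
        (single u 1 * f) * (single (v - u) 1 * q)"
      by (simp only: mult_ac)
    then show ?thesis by (rule dvdI)
  qed
  note * = this
  show "single u 1 * f dvd single v 1 * g" if "f dvd g" by (rule *[OF that])
  show "f dvd g" if "single u 1 * f dvd single v 1 * g"
    using *[OF that, of "- u" "- v"] by (simp add: mult.assoc[symmetric] mult_single)
qed

theorem laurent_dvd_if_powers_dvd:
  fixes f g c :: "'m::{int_separated, ab_group_add} \<Rightarrow>\<^sub>0 complex"
  assumes "g \<noteq> 0" "c \<noteq> 0" "\<And>m. g ^ m dvd c * f ^ m"
  shows "g dvd f"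
proof -
  obtain w where w: "additive_weight w" "inj_on w (keys g \<union> keys c)"
    by (rule separating_weight[of "keys g \<union> keys c"]) auto
  \<comment> \<open>Translating by minus an exponent of least weight makes all weights nonnegative
    and puts \<open>0\<close> among the exponents, as \<open>twisted_dvd\<close> requires.\<close>
  have shift: "\<exists>u. (\<forall>e\<in>keys (single u 1 * k). w e \<ge> 0) \<and>
      (k \<noteq> 0 \<longrightarrow> 0 \<in> keys (single u 1 * k))" for k :: "'m \<Rightarrow>\<^sub>0 complex"
  proof (cases "k = 0")
    case False
    then have "keys k \<noteq> {}"
      by (metis poly_mapping_eqI lookup_zero not_in_keys_iff_lookup_eq_zero empty_iff)
    then have "Min (w ` keys k) \<in> w ` keys k" by (intro Min_in) auto
    then obtain e where e: "e \<in> keys k" "w e = Min (w ` keys k)"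
      by force
    then have "w e \<le> w e'" if "e' \<in> keys k" for e'
      using that by simp
    moreover have "w (e' - e) = w e' - w e" for e'
      using additive_weight_uminus[OF w(1), of e] additive_weight_add[OF w(1), of e' "- e"] by simp
    ultimately show ?thesis
      using e(1) by (intro exI[of _ "- e"]) (auto simp: keys_single_mult image_iff)
  qed auto
  obtain uf ug uc where u:
    "\<forall>e\<in>keys (single uf 1 * f). w e \<ge> 0"
    "\<forall>e\<in>keys (single ug 1 * g). w e \<ge> 0"
    "0 \<in> keys (single ug 1 * g)"
    "\<forall>e\<in>keys (single uc 1 * c). w e \<ge> 0"
    using shift[of f] shift[of g] shift[of c] assms(1) by blast
  have inj: "inj_on w (keys (single u 1 * k))"
    if "inj_on w (keys k)" for u and k :: "'m \<Rightarrow>\<^sub>0 complex"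
    using that by (auto simp: keys_single_mult inj_on_def additive_weight_add[OF w(1)])
  have "single ug 1 * g dvd single uf 1 * f"
  proof (rule twisted_dvd[OF w(1)])
    show "single uc 1 * c \<noteq> 0"
      using assms(2) by (intro monoid_algebra_no_zero_divisors) (auto simp: poly_mapping_eq_iff fun_eq_iff lookup_single)
    show "(single ug 1 * g) ^ m dvd
        single uc 1 * c * (single uf 1 * f) ^ m" for m
    proof -
      \<comment> \<open>\<open>((+) v ^^ m) 0\<close> is the m-fold sum of \<open>v\<close>; a
        general group of exponents carries no scalar multiplication.\<close>
      have pow: "single v (1::complex) ^ m = single (((+) v ^^ m) 0) 1" for v :: 'm and m
        by (induction m) (auto simp: mult_single)
      have "single (((+) ug ^^ m) 0) 1 * g ^ m dvd
          single (uc + ((+) uf ^^ m) 0) 1 * (c * f ^ m)"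
        unfolding dvd_unit_single_mult by (rule assms(3))
      moreover have "single uc 1 * c * (single uf 1 * f) ^ m =
          (single uc 1 * single uf 1 ^ m) * (c * f ^ m)"
        by (simp only: power_mult_distrib mult_ac)
      ultimately show ?thesis by (simp add: power_mult_distrib pow mult_single)
    qed
  qed (use u w(2) in \<open>auto intro!: inj simp: inj_on_Un\<close>)
  then show ?thesis by (simp only: dvd_unit_single_mult)
qed

section \<open>Saturated affine semigroups\<close>

text \<open>If a monotone subsequence is not nondecreasing, it is nonincreasing and hence constant
  from where it attains its minimum.\<close>

lemma nat_seq_mono_subseq:
  fixes n :: "nat \<Rightarrow> nat"
  obtains r :: "nat \<Rightarrow> nat" where "strict_mono r" "mono (n \<circ> r)"
proof -
  obtain r :: "nat \<Rightarrow> nat" where r: "strict_mono r" "monoseq (\<lambda>i. n (r i))"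
    using seq_monosub by blast
  show ?thesis
  proof (cases "mono (n \<circ> r)")
    case False
    then have dec: "n (r j) \<le> n (r i)" if "i \<le> j" for i j
      using r(2) that by (auto simp: monoseq_def mono_def)
    define i0 where "i0 = (ARG_MIN (n \<circ> r) i. True)"
    have i0: "n (r i0) \<le> n (r i)" for i
      using arg_min_nat_le[of "\<lambda>_. True" i "n \<circ> r"] by (simp add: i0_def)
    show ?thesis
    proof (rule that)
      show "strict_mono (\<lambda>i. r (i0 + i))"
        using r(1) by (simp add: strict_mono_def)
      have "n (r (i0 + i)) = n (r i0)" for i
        using dec[of i0 "i0 + i"] i0[of "i0 + i"] by simp
      then show "mono (n \<circ> (\<lambda>i. r (i0 + i)))" by (simp add: mono_def)
    qed
  qed (use r that in blast)
qed

text \<open>Dickson's lemma in sequence form: coordinates are treated one at a time, and a further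
  subsequence keeps the earlier ones monotone.\<close>

lemma dickson_subseq:
  fixes n :: "nat \<Rightarrow> 'a \<Rightarrow> nat"
  assumes "finite A"
  shows "\<exists>r :: nat \<Rightarrow> nat. strict_mono r \<and> (\<forall>a\<in>A. mono (\<lambda>i. n (r i) a))"
  using assms
proof (induction A)
  case (insert a A)
  then obtain r :: "nat \<Rightarrow> nat" where r: "strict_mono r" "\<And>b. b \<in> A \<Longrightarrow> mono (\<lambda>i. n (r i) b)"
    by blast
  obtain s :: "nat \<Rightarrow> nat" where s: "strict_mono s" "mono ((\<lambda>i. n (r i) a) \<circ> s)"
    by (rule nat_seq_mono_subseq)
  have "mono (\<lambda>i. n (r (s i)) b)" if "b \<in> insert a A" for b
    using that s r(2)[of b] strict_mono_mono[OF s(1)] by (auto simp: mono_def)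
  moreover have "strict_mono (r \<circ> s)"
    using r(1) s(1) by (rule strict_mono_o)
  ultimately show ?case by (intro exI[of _ "r \<circ> s"]) (auto simp: strict_mono_def)
qed (auto intro: exI[of _ id] simp: strict_mono_id[unfolded id_def] strict_mono_def)

text \<open>Write each \<open>p m\<close> as a multiset of generators. Dickson's lemma yields two of
  these with one contained in the other, and \<open>s\<close> is the sum of their
  difference.\<close>

lemma progression_in_generated_monoid:
  fixes A :: "'s::cancel_comm_monoid_add set"
  assumes "finite A" "\<And>m. p m \<in> {sum_list xs |xs. set xs \<subseteq> A}"
  obtains i k where "k \<ge> (1::nat)" "\<exists>s\<in>{sum_list xs |xs. set xs \<subseteq> A}. p (i + k) = p i + s"
proof -
  have "\<forall>m. \<exists>xs. p m = sum_list xs \<and> set xs \<subseteq> A"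
    using assms(2) by blast
  then obtain xs where xs: "\<And>m. p m = sum_list (xs m)" "\<And>m. set (xs m) \<subseteq> A"
    by metis
  obtain r :: "nat \<Rightarrow> nat" where r: "strict_mono r" "\<And>a. a \<in> A \<Longrightarrow> mono (\<lambda>i. count (mset (xs (r i))) a)"
    using dickson_subseq[OF assms(1), of "\<lambda>m. count (mset (xs m))"] by blast
  have sub: "mset (xs (r 0)) \<subseteq># mset (xs (r 1))"
  proof (rule mset_subset_eqI)
    fix a
    show "count (mset (xs (r 0))) a \<le> count (mset (xs (r 1))) a"
    proof (cases "a \<in> A")
      case False
      then have "a \<notin># mset (xs (r 0))"
        using xs(2)[of "r 0"] by auto
      then have "count (mset (xs (r 0))) a = 0" by (simp only: not_in_iff)
      then show ?thesis by linarith
    qed (use monoD[OF r(2), of a 0 1] in auto)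
  qed
  obtain ys where ys: "mset ys = mset (xs (r 1)) - mset (xs (r 0))"
    by (metis ex_mset)
  have "set ys \<subseteq> A"
    using xs(2)[of "r 1"] in_diffD[of _ "mset (xs (r 1))" "mset (xs (r 0))"]
    by (auto simp flip: set_mset_mset[of ys] simp: ys)
  moreover have "p (r 1) = p (r 0) + sum_list ys"
  proof -
    have "mset (xs (r 1)) = mset (xs (r 0)) + mset ys"
      using sub ys by simp
    then show ?thesis by (simp add: xs(1) flip: sum_mset_sum_list)
  qed
  moreover have "r 0 < r 1"
    using r(1) by (simp add: strict_mono_def)
  ultimately have "\<exists>s\<in>{sum_list xs |xs. set xs \<subseteq> A}. p (r 0 + (r 1 - r 0)) = p (r 0) + s" "1 \<le> r 1 - r 0"
    by auto
  then show ?thesis by (rule that[rotated])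
qed

lemma leads_power:
  fixes u :: "int ^ 'j"
  shows "leads w b u \<Longrightarrow> additive_weight w \<Longrightarrow> leads w ((b :: int ^ 'j \<Rightarrow>\<^sub>0 complex) ^ m) (int m *s u)"
proof (induction m)
  case (Suc m)
  then have "leads w (b * b ^ m) (u + int m *s u)" by (intro leads_mult) auto
  moreover have "u + int m *s u = int (Suc m) *s u" by (simp add: vec_eq_iff algebra_simps)
  ultimately show ?case by (simp only: power_Suc)
next
  case 0
  have "int 0 *s u = 0" by (simp add: vec_eq_iff)
  then show ?case by (simp only: leads_one power_0)
qed

text \<open>Peel off leading terms: each lies in the semigroup by Dickson's lemma and saturation.\<close>

theorem almost_integral_in_semigroup_algebra:
  fixes b c :: "int ^ 'j::finite \<Rightarrow>\<^sub>0 complex" and A :: "(nat \<times> (int ^ 'j)) set"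
  defines "P \<equiv> {sum_list xs |xs. set xs \<subseteq> A}"
  assumes "finite A"
    and sat: "\<And>r u k. k \<ge> 1 \<Longrightarrow> (k * r, int k *s u) \<in> P \<Longrightarrow> (r, u) \<in> P"
    and "c \<noteq> 0" and cb: "\<And>m. keys (c * b ^ m) \<subseteq> {u. (a + m * e, u) \<in> P}"
  shows "keys b \<subseteq> {u. (e, u) \<in> P}"
  using cb
proof (induction "card (keys b)" arbitrary: b rule: less_induct)
  case less
  interpret graded_exponents "\<lambda>k. {u. (k, u) \<in> P}"
  proof
    show "0 \<in> {u. (0, u) \<in> P}"
      unfolding P_def by (auto intro!: exI[of _ "[]"] simp: zero_prod_def)
    show "x + y \<in> {u. (i + j, u) \<in> P}" if "x \<in> {u. (i, u) \<in> P}" "y \<in> {u. (j, u) \<in> P}" for x y i j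
    proof -
      from that obtain xs ys where "(i, x) = sum_list xs" "set xs \<subseteq> A" "(j, y) = sum_list ys" "set ys \<subseteq> A"
        by (auto simp: P_def)
      then have "(i + j, x + y) = sum_list (xs @ ys)" "set (xs @ ys) \<subseteq> A"
        by (auto simp flip: add_Pair)
      then show ?thesis
        unfolding P_def by blast
    qed
  qed
  show ?case
  proof (cases "b = 0")
    case False
    obtain w where w: "additive_weight w" "inj_on w (keys b \<union> keys c)"
      by (rule separating_weight[of "keys b \<union> keys c"]) auto
    obtain ub where ub: "leads w b ub"
      using leads_exists False w(2) by (metis inj_on_Un)
    obtain uc where uc: "leads w c uc"
      using leads_exists \<open>c \<noteq> 0\<close> w(2) by (metis inj_on_Un)
    have "uc + int m *s ub \<in> keys (c * b ^ m)" for m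
      using leads_mult[OF w(1) uc leads_power[OF ub w(1)]] by (auto simp: leads_def)
    then have "(a + m * e, uc + int m *s ub) \<in> P" for m
      using less.prems by blast
    \<comment> \<open>The leading exponents of \<open>c * b ^ m\<close> form an arithmetic
      progression of step \<open>(e, ub)\<close>. Two of its terms differ by an element
      \<open>s\<close> of the monoid; \<open>s\<close> is \<open>k\<close> times the step, so
      saturation applies.\<close>
    then obtain i k where k: "k \<ge> 1" "\<exists>s\<in>P. (a + (i + k) * e, uc + int (i + k) *s ub) = (a + i * e, uc + int i *s ub) + s"
      unfolding P_def by (rule progression_in_generated_monoid[OF \<open>finite A\<close>])
    then obtain s where s: "s \<in> P" "(a + (i + k) * e, uc + int (i + k) *s ub) = (a + i * e, uc + int i *s ub) + s"
      by blast
    have "s = (k * e, int k *s ub)"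
      using s(2) by (cases s) (auto simp: algebra_simps vec_eq_iff)
    with s(1) k(1) have ub_P: "(e, ub) \<in> P"
      using sat by blast
    define t where "t = single ub (lookup b ub)"
    have t: "piece e t"
      using ub_P by (simp add: t_def)
    \<comment> \<open>The hypothesis has to pass from \<open>b\<close> to \<open>b - t\<close>. The
      extra factor \<open>b ^ i\<close> lets the factors \<open>b - t\<close> be expanded one at a
      time.\<close>
    have "keys (c * (b ^ i * (b - t) ^ m)) \<subseteq> {u. (a + (i + m) * e, u) \<in> P}" for i m
    proof (induction m arbitrary: i)
      case 0
      then show ?case
        using less.prems by simp
    next
      case (Suc m)
      have "c * (b ^ i * (b - t) ^ Suc m) = c * (b ^ Suc i * (b - t) ^ m) - t * (c * (b ^ i * (b - t) ^ m))"
        by (simp add: algebra_simps)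
      moreover have "piece (a + (i + Suc m) * e) (c * (b ^ Suc i * (b - t) ^ m))"
        using Suc[of "Suc i"] by simp
      moreover have "piece (e + (a + (i + m) * e)) (t * (c * (b ^ i * (b - t) ^ m)))"
        by (rule piece_mult[OF t Suc[of i]])
      then have "piece (a + (i + Suc m) * e) (t * (c * (b ^ i * (b - t) ^ m)))"
        by (simp add: algebra_simps)
      ultimately show ?case
        using keys_diff[of "c * (b ^ Suc i * (b - t) ^ m)" "t * (c * (b ^ i * (b - t) ^ m))"]
        by fastforce
    qed
    from this[of 0] have bt: "keys (c * (b - t) ^ m) \<subseteq> {u. (a + m * e, u) \<in> P}" for m
      by simp
    have keys_bt: "keys (b - t) = keys b - {ub}"
      by (auto simp: t_def in_keys_iff lookup_minus lookup_single when_def split: if_splits)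
    have "ub \<in> keys b"
      using ub by (simp add: leads_def)
    then have "card (keys (b - t)) < card (keys b)"
      unfolding keys_bt by (intro card_Diff1_less) auto
    from less.hyps[OF this bt] have "keys (b - t) \<subseteq> {u. (e, u) \<in> P}"
      by simp
    then show ?thesis
      using ub_P unfolding keys_bt by blast
  qed auto
qed

section \<open>Fractions on irreducible varieties\<close>

lemmas eval_simps [simp] =
  ring_map_0[OF ring_map_eval] ring_map_1[OF ring_map_eval] ring_map_add[OF ring_map_eval]
  ring_map_mult[OF ring_map_eval] ring_map_diff[OF ring_map_eval] ring_map_power[OF ring_map_eval]
  ring_map_sum[OF ring_map_eval] ring_map_prod[OF ring_map_eval]
  eval_with_Var[OF ring_map_id] eval_with_Const[OF ring_map_id]

text \<open>Irreducibility in the algebraic form in which it cancels denominators: the vanishing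
  ideal is prime on forms.\<close>

locale irreducible_zero_set =
  fixes V :: "(complex ^ 'p::finite) set"
  assumes nonempty: "V \<noteq> {}"
    and prime: "homogeneous k F \<Longrightarrow> homogeneous l G \<Longrightarrow> F * G \<in> vanishing_ideal V \<Longrightarrow>
      F \<in> vanishing_ideal V \<or> G \<in> vanishing_ideal V"
begin

abbreviation "K \<equiv> function_field V"

definition fraction :: "nat \<Rightarrow> ('p, complex) mpoly \<Rightarrow> ('p, complex) mpoly \<Rightarrow> bool" where
  "fraction k F G \<longleftrightarrow> homogeneous k F \<and> homogeneous k G \<and> G \<notin> vanishing_ideal V"

lemma carrier_K: "carrier K = {ratfun V F G |F G k. fraction k F G}"
  by (simp add: function_field_def fraction_def)

lemma fraction_mult: "fraction k F G \<Longrightarrow> fraction l F' G' \<Longrightarrow> fraction (k + l) (F * F') (G * G')"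
  using prime[of k G l G'] by (auto simp: fraction_def intro: homogeneous_mult)

lemma fraction_add:
  "fraction k F G \<Longrightarrow> fraction l F' G' \<Longrightarrow> fraction (k + l) (F * G' + F' * G) (G * G')"
  using prime[of k G l G'] homogeneous_mult[of l F' k G]
  by (auto simp: fraction_def add.commute intro!: homogeneous_mult homogeneous_add)

lemma fraction_01: "fraction 0 0 1" "fraction 0 1 1"
  using nonempty by (auto simp: fraction_def homogeneous_0 homogeneous_1 vanishing_ideal_def)

lemma mem_ratfun:
  "(F', G') \<in> ratfun V F G \<longleftrightarrow>
     (\<exists>k. fraction k F' G') \<and> (\<forall>x\<in>V. eval F x * eval G' x = eval F' x * eval G x)"
  by (auto simp: ratfun_def fraction_def vanishing_ideal_def)

text \<open>Transitivity of equality of fractions: \<open>G\<close> times the claimed relation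
  vanishes on \<open>V\<close>, and primality cancels \<open>G\<close>.\<close>

lemma cross_mult_cancel:
  assumes "fraction k F G" "fraction k' F' G'" "fraction k'' F'' G''"
    and "\<forall>x\<in>V. eval F x * eval G' x = eval F' x * eval G x"
    and "\<forall>x\<in>V. eval F x * eval G'' x = eval F'' x * eval G x"
  shows "\<forall>x\<in>V. eval F' x * eval G'' x = eval F'' x * eval G' x"
proof -
  have "homogeneous (k' + k'') (F' * G'' - F'' * G')"
    using assms(2,3) homogeneous_mult[of k'' F'' k' G']
    by (auto simp: fraction_def add.commute intro!: homogeneous_mult homogeneous_diff)
  moreover have "G * (F' * G'' - F'' * G') \<in> vanishing_ideal V"
  proof -
    have "eval G x * (eval F' x * eval G'' x - eval F'' x * eval G' x) = 0" if "x \<in> V" for x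
    proof -
      have "eval G x * (eval F' x * eval G'' x - eval F'' x * eval G' x) =
        (eval F' x * eval G x) * eval G'' x - (eval F'' x * eval G x) * eval G' x"
        by (simp add: algebra_simps)
      also have "\<dots> = (eval F x * eval G' x) * eval G'' x - (eval F x * eval G'' x) * eval G' x"
        using assms(4,5) that by simp
      also have "\<dots> = 0" by (simp add: algebra_simps)
      finally show ?thesis .
    qed
    then show ?thesis by (simp add: vanishing_ideal_def)
  qed
  ultimately have "F' * G'' - F'' * G' \<in> vanishing_ideal V"
    using prime[of k G "k' + k''" "F' * G'' - F'' * G'"] assms(1) by (auto simp: fraction_def)
  then show ?thesis by (simp add: vanishing_ideal_def)
qed

lemma ratfun_eq_iff:
  assumes "fraction k F G" "fraction k' F' G'"
  shows "ratfun V F G = ratfun V F' G' \<longleftrightarrow> (\<forall>x\<in>V. eval F x * eval G' x = eval F' x * eval G x)"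
proof
  assume "ratfun V F G = ratfun V F' G'"
  moreover have "(F', G') \<in> ratfun V F' G'"
    using assms(2) by (auto simp: mem_ratfun)
  ultimately have "(F', G') \<in> ratfun V F G" by simp
  then show "\<forall>x\<in>V. eval F x * eval G' x = eval F' x * eval G x" by (simp add: mem_ratfun)
next
  assume eq: "\<forall>x\<in>V. eval F x * eval G' x = eval F' x * eval G x"
  show "ratfun V F G = ratfun V F' G'"
  proof (rule Set.set_eqI)
    fix a :: "('p, complex) mpoly \<times> ('p, complex) mpoly"
    obtain F'' G'' where a: "a = (F'', G'')"
      by (cases a)
    show "a \<in> ratfun V F G \<longleftrightarrow> a \<in> ratfun V F' G'"
    proof
      assume "a \<in> ratfun V F G"
      then obtain k'' where "fraction k'' F'' G''" "\<forall>x\<in>V. eval F x * eval G'' x = eval F'' x * eval G x"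
        by (auto simp: a mem_ratfun)
      with cross_mult_cancel[OF assms this(1) eq this(2)] show "a \<in> ratfun V F' G'"
        by (auto simp: a mem_ratfun)
    next
      assume "a \<in> ratfun V F' G'"
      then obtain k'' where "fraction k'' F'' G''" "\<forall>x\<in>V. eval F' x * eval G'' x = eval F'' x * eval G' x"
        by (auto simp: a mem_ratfun)
      moreover have "\<forall>x\<in>V. eval F' x * eval G x = eval F x * eval G' x"
        using eq by auto
      ultimately show "a \<in> ratfun V F G"
        using cross_mult_cancel[OF assms(2,1) \<open>fraction k'' F'' G''\<close>] by (auto simp: a mem_ratfun)
    qed
  qed
qed

text \<open>The operations of \<open>function_field\<close> are unions over all representatives;
  once \<open>R\<close> does not depend on them, the union is a single class.\<close>

lemma Union_ratfun_const:
  assumes "fraction k F G" "fraction k' F' G'"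
    and "\<And>k1 F1 G1 k2 F2 G2. fraction k1 F1 G1 \<Longrightarrow> fraction k2 F2 G2 \<Longrightarrow>
      \<forall>x\<in>V. eval F x * eval G1 x = eval F1 x * eval G x \<Longrightarrow>
      \<forall>x\<in>V. eval F' x * eval G2 x = eval F2 x * eval G' x \<Longrightarrow> R F1 G1 F2 G2 = R F G F' G'"
  shows "(\<Union>(F1, G1)\<in>ratfun V F G. \<Union>(F2, G2)\<in>ratfun V F' G'. R F1 G1 F2 G2) = R F G F' G'"
proof -
  have "R F1 G1 F2 G2 = R F G F' G'" if "(F1, G1) \<in> ratfun V F G" "(F2, G2) \<in> ratfun V F' G'" for F1 G1 F2 G2
    using that assms(3) by (auto simp: mem_ratfun)
  moreover have "(F, G) \<in> ratfun V F G" "(F', G') \<in> ratfun V F' G'"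
    using assms(1,2) by (auto simp: mem_ratfun)
  moreover have unions: "(\<Union>p\<in>ratfun V F G. \<Union>q\<in>ratfun V F' G'. R (fst p) (snd p) (fst q) (snd q)) =
      (\<Union>p\<in>ratfun V F G. \<Union>q\<in>ratfun V F' G'. R F G F' G')"
    using calculation(1) by (intro SUP_cong refl) auto
  moreover have ne: "ratfun V F G \<noteq> {}" "ratfun V F' G' \<noteq> {}"
    using calculation(2,3) by blast+
  show ?thesis
    unfolding case_prod_unfold unions using ne by simp
qed

lemma mult_ratfun:
  assumes "fraction k F G" "fraction k' F' G'"
  shows "ratfun V F G \<otimes>\<^bsub>K\<^esub> ratfun V F' G' = ratfun V (F * F') (G * G')"
  unfolding function_field_def monoid.simps
proof (rule Union_ratfun_const[OF assms])
  fix k1 F1 G1 k2 F2 G2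
  assume *: "fraction k1 F1 G1" "fraction k2 F2 G2"
    and eq: "\<forall>x\<in>V. eval F x * eval G1 x = eval F1 x * eval G x"
      "\<forall>x\<in>V. eval F' x * eval G2 x = eval F2 x * eval G' x"
  show "ratfun V (F1 * F2) (G1 * G2) = ratfun V (F * F') (G * G')"
    unfolding ratfun_eq_iff[OF fraction_mult[OF *] fraction_mult[OF assms]]
  proof
    fix x assume "x \<in> V"
    then have "(eval F x * eval G1 x) * (eval F' x * eval G2 x) =
        (eval F1 x * eval G x) * (eval F2 x * eval G' x)"
      using eq by simp
    then show "eval (F1 * F2) x * eval (G * G') x = eval (F * F') x * eval (G1 * G2) x"
      by (simp add: mult_ac)
  qed
qed

lemma add_ratfun:
  assumes "fraction k F G" "fraction k' F' G'"
  shows "ratfun V F G \<oplus>\<^bsub>K\<^esub> ratfun V F' G' = ratfun V (F * G' + F' * G) (G * G')"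
  unfolding function_field_def ring.simps
proof (rule Union_ratfun_const[OF assms])
  fix k1 F1 G1 k2 F2 G2
  assume *: "fraction k1 F1 G1" "fraction k2 F2 G2"
    and eq: "\<forall>x\<in>V. eval F x * eval G1 x = eval F1 x * eval G x"
      "\<forall>x\<in>V. eval F' x * eval G2 x = eval F2 x * eval G' x"
  show "ratfun V (F1 * G2 + F2 * G1) (G1 * G2) = ratfun V (F * G' + F' * G) (G * G')"
    unfolding ratfun_eq_iff[OF fraction_add[OF *] fraction_add[OF assms]]
  proof
    fix x assume x: "x \<in> V"
    have "(eval F1 x * eval G2 x + eval F2 x * eval G1 x) * (eval G x * eval G' x) =
        (eval F1 x * eval G x) * (eval G2 x * eval G' x) + (eval F2 x * eval G' x) * (eval G1 x * eval G x)"
      by (simp add: algebra_simps)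
    also have "\<dots> = (eval F x * eval G1 x) * (eval G2 x * eval G' x) + (eval F' x * eval G2 x) * (eval G1 x * eval G x)"
      using eq x by simp
    also have "\<dots> = (eval F x * eval G' x + eval F' x * eval G x) * (eval G1 x * eval G2 x)"
      by (simp add: algebra_simps)
    finally show "eval (F1 * G2 + F2 * G1) x * eval (G * G') x = eval (F * G' + F' * G) x * eval (G1 * G2) x"
      by simp
  qed
qed

lemma one_K: "\<one>\<^bsub>K\<^esub> = ratfun V 1 1" and zero_K: "\<zero>\<^bsub>K\<^esub> = ratfun V 0 1"
  by (simp_all add: function_field_def)

lemma carrier_K_cases:
  assumes "a \<in> carrier K"
  obtains k F G where "fraction k F G" "a = ratfun V F G"
  using assms by (auto simp: carrier_K)

lemma ratfun_in_K: "fraction k F G \<Longrightarrow> ratfun V F G \<in> carrier K"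
  by (auto simp: carrier_K)

text \<open>For the sake of the finite sum in \<open>integral_over\<close>, whose rules ask for this
  structure.\<close>

lemma abelian_monoid_K: "abelian_monoid K"
proof (rule abelian_monoidI)
  show "\<zero>\<^bsub>K\<^esub> \<in> carrier K"
    unfolding zero_K by (rule ratfun_in_K[OF fraction_01(1)])
next
  fix a b assume "a \<in> carrier K" "b \<in> carrier K"
  then obtain k F G k' F' G' where *: "fraction k F G" "a = ratfun V F G"
    "fraction k' F' G'" "b = ratfun V F' G'"
    by (meson carrier_K_cases)
  show "a \<oplus>\<^bsub>K\<^esub> b \<in> carrier K"
    unfolding * add_ratfun[OF *(1,3)] by (rule ratfun_in_K[OF fraction_add[OF *(1,3)]])
  show "a \<oplus>\<^bsub>K\<^esub> b = b \<oplus>\<^bsub>K\<^esub> a"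
    unfolding * add_ratfun[OF *(1,3)] add_ratfun[OF *(3,1)]
    by (simp add: ratfun_eq_iff[OF fraction_add[OF *(1,3)] fraction_add[OF *(3,1)]] algebra_simps)
next
  fix a b c assume "a \<in> carrier K" "b \<in> carrier K" "c \<in> carrier K"
  then obtain k F G k' F' G' k'' F'' G'' where *: "fraction k F G" "a = ratfun V F G"
    "fraction k' F' G'" "b = ratfun V F' G'" "fraction k'' F'' G''" "c = ratfun V F'' G''"
    by (meson carrier_K_cases)
  note 1 = fraction_add[OF *(1,3)] and 2 = fraction_add[OF *(3,5)]
  show "(a \<oplus>\<^bsub>K\<^esub> b) \<oplus>\<^bsub>K\<^esub> c = a \<oplus>\<^bsub>K\<^esub> (b \<oplus>\<^bsub>K\<^esub> c)"
    unfolding * add_ratfun[OF *(1,3)] add_ratfun[OF *(3,5)] add_ratfun[OF 1 *(5)] add_ratfun[OF *(1) 2]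
    by (simp add: ratfun_eq_iff[OF fraction_add[OF 1 *(5)] fraction_add[OF *(1) 2]] algebra_simps)
next
  fix a assume "a \<in> carrier K"
  then obtain k F G where *: "fraction k F G" "a = ratfun V F G"
    by (meson carrier_K_cases)
  show "\<zero>\<^bsub>K\<^esub> \<oplus>\<^bsub>K\<^esub> a = a"
    unfolding * zero_K add_ratfun[OF fraction_01(1) *(1)]
    by (simp add: ratfun_eq_iff[OF fraction_add[OF fraction_01(1) *(1)] *(1)])
qed

lemma fraction_power: "fraction k F G \<Longrightarrow> fraction (n * k) (F ^ n) (G ^ n)"
proof (induction n)
  case (Suc n)
  from fraction_mult[OF Suc.prems Suc.IH[OF Suc.prems]] show ?case
    by simp
qed (simp add: fraction_01)

lemma pow_ratfun: "fraction k F G \<Longrightarrow> ratfun V F G [^]\<^bsub>K\<^esub> (n::nat) = ratfun V (F ^ n) (G ^ n)"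
proof (induction n)
  case (Suc n)
  have "ratfun V F G [^]\<^bsub>K\<^esub> Suc n = ratfun V F G [^]\<^bsub>K\<^esub> n \<otimes>\<^bsub>K\<^esub> ratfun V F G"
    by (simp add: nat_pow_def)
  then show ?case
    using mult_ratfun[OF fraction_power[OF Suc.prems] Suc.prems] Suc by (simp add: mult.commute)
qed (simp add: nat_pow_def one_K)

lemma finsum_ratfun:
  assumes "\<And>i. i < n \<Longrightarrow> homogeneous k (P i)" "homogeneous k D" "D \<notin> vanishing_ideal V"
  shows "(\<Oplus>\<^bsub>K\<^esub>i\<in>{..<n::nat}. ratfun V (P i) D) = ratfun V (\<Sum>i<n. P i) D"
  using assms(1)
proof (induction n)
  case 0
  have "ratfun V 0 1 = ratfun V 0 D"
    using ratfun_eq_iff[OF fraction_01(1), of k 0 D] assms(2,3) by (simp add: fraction_def homogeneous_0)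
  then show ?case
    using abelian_monoid.finsum_empty[OF abelian_monoid_K] by (simp add: zero_K)
next
  case (Suc n)
  have fr: "fraction k (P i) D" if "i < Suc n" for i
    using Suc.prems that assms by (simp add: fraction_def)
  have fs: "fraction k (\<Sum>i<m. P i) D" if "m \<le> Suc n" for m
    using Suc.prems that assms by (auto simp: fraction_def intro!: homogeneous_sum)
  have "(\<Oplus>\<^bsub>K\<^esub>i\<in>{..<Suc n}. ratfun V (P i) D) =
      ratfun V (P n) D \<oplus>\<^bsub>K\<^esub> (\<Oplus>\<^bsub>K\<^esub>i\<in>{..<n}. ratfun V (P i) D)"
    unfolding lessThan_Suc
    by (rule abelian_monoid.finsum_insert[OF abelian_monoid_K]) (auto intro!: ratfun_in_K fr)
  also have "\<dots> = ratfun V (P n) D \<oplus>\<^bsub>K\<^esub> ratfun V (\<Sum>i<n. P i) D"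
    using Suc by simp
  also have "\<dots> = ratfun V (P n * D + (\<Sum>i<n. P i) * D) (D * D)"
    by (rule add_ratfun[OF fr fs]) auto
  also have "\<dots> = ratfun V (\<Sum>i<Suc n. P i) D"
    using ratfun_eq_iff[OF fraction_add[OF fr fs] fs, of n n "Suc n"] by (simp add: algebra_simps)
  finally show ?case .
qed

section \<open>Integral and almost integral fractions\<close>

lemma local_ring_cases:
  assumes "a \<in> local_ring V x" "x \<in> V"
  obtains k F G where "fraction k F G" "eval G x \<noteq> 0" "a = ratfun V F G"
  using assms by (fastforce simp: local_ring_def fraction_def vanishing_ideal_def)

text \<open>Clear denominators: \<open>H\<close> is the product of the denominators of the
  coefficients, all nonzero at \<open>x\<close>, and \<open>P i\<close> is the numerator of the i-th
  coefficient times the other denominators. The powers of \<open>G\<close> clear those of the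
  fraction itself.\<close>

lemma integral_equation:
  assumes "fraction k F G" "x \<in> V" "integral_over K (local_ring V x) (ratfun V F G)"
  obtains n e H P where "n \<ge> 1" "homogeneous e H" "eval H x \<noteq> 0" "\<And>i. i < n \<Longrightarrow> homogeneous e (P i)"
    "\<And>y. y \<in> V \<Longrightarrow> eval F y ^ n * eval H y + (\<Sum>i<n. eval (P i) y * eval F y ^ i * eval G y ^ (n - i)) = 0"
proof -
  obtain n c where c: "\<And>i. i < n \<Longrightarrow> c i \<in> local_ring V x"
    and eq: "ratfun V F G [^]\<^bsub>K\<^esub> (n::nat) \<oplus>\<^bsub>K\<^esub>
      (\<Oplus>\<^bsub>K\<^esub>i\<in>{..<n}. c i \<otimes>\<^bsub>K\<^esub> ratfun V F G [^]\<^bsub>K\<^esub> i) = \<zero>\<^bsub>K\<^esub>"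
    using assms(3) unfolding integral_over_def by blast
  have "\<forall>i. \<exists>k F G. i < n \<longrightarrow> fraction k F G \<and> eval G x \<noteq> 0 \<and> c i = ratfun V F G"
    using local_ring_cases[OF c assms(2)] by metis
  then obtain kc A B where AB: "\<And>i. i < n \<Longrightarrow> fraction (kc i) (A i) (B i)"
    "\<And>i. i < n \<Longrightarrow> eval (B i) x \<noteq> 0" "\<And>i. i < n \<Longrightarrow> c i = ratfun V (A i) (B i)"
    by metis
  define e where "e = (\<Sum>i<n. kc i)"
  define H where "H = (\<Prod>i<n. B i)"
  define P where "P i = A i * (\<Prod>j\<in>{..<n} - {i}. B j)" for i
  have H: "homogeneous e H"
    unfolding H_def e_def using AB(1) by (intro homogeneous_prod) (auto simp: fraction_def)
  have Hx: "eval H x \<noteq> 0"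
    unfolding H_def using AB(2) by simp
  have H_nz: "H \<notin> vanishing_ideal V"
    using Hx assms(2) by (auto simp: vanishing_ideal_def)
  have P: "homogeneous e (P i)" if "i < n" for i
  proof -
    have "homogeneous (kc i + (\<Sum>j\<in>{..<n} - {i}. kc j)) (P i)"
      unfolding P_def using AB(1) that
      by (intro homogeneous_mult homogeneous_prod) (auto simp: fraction_def)
    then show ?thesis
      using that by (simp add: e_def sum.remove[of "{..<n}" i])
  qed
  have HB: "H = B i * (\<Prod>j\<in>{..<n} - {i}. B j)" if "i < n" for i
    unfolding H_def using that by (intro prod.remove) auto
  define D where "D = H * G ^ n"
  have G: "homogeneous k G" "homogeneous k F" and G_nz: "G \<notin> vanishing_ideal V"
    using assms(1) by (auto simp: fraction_def)
  have D: "homogeneous (e + n * k) D"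
    unfolding D_def by (intro homogeneous_mult H homogeneous_power G)
  have D_nz: "D \<notin> vanishing_ideal V"
    unfolding D_def using prime[OF H homogeneous_power[OF G(1), of n]] H_nz fraction_power[OF assms(1), of n]
    by (auto simp: fraction_def)
  define T where "T i = P i * F ^ i * G ^ (n - i)" for i
  have T: "homogeneous (e + n * k) (T i)" if "i < n" for i
  proof -
    have "homogeneous (e + i * k + (n - i) * k) (T i)"
      unfolding T_def using that by (intro homogeneous_mult P homogeneous_power G)
    moreover have "e + i * k + (n - i) * k = e + n * k"
      using that by (simp add: add_mult_distrib[symmetric] add.assoc)
    ultimately show ?thesis by simp
  qed
  have terms: "c i \<otimes>\<^bsub>K\<^esub> ratfun V F G [^]\<^bsub>K\<^esub> i = ratfun V (T i) D" if "i < n" for i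
  proof -
    have "c i \<otimes>\<^bsub>K\<^esub> ratfun V F G [^]\<^bsub>K\<^esub> i = ratfun V (A i * F ^ i) (B i * G ^ i)"
      using AB[OF that] pow_ratfun[OF assms(1)] mult_ratfun[OF AB(1)[OF that] fraction_power[OF assms(1)]]
      by simp
    also have "\<dots> = ratfun V (T i) D"
    proof (subst ratfun_eq_iff[OF fraction_mult[OF AB(1)[OF that] fraction_power[OF assms(1)]]])
      show "fraction (e + n * k) (T i) D"
        using T[OF that] D D_nz by (simp add: fraction_def)
      have "G ^ n = G ^ i * G ^ (n - i)"
        using that by (simp add: power_add[symmetric])
      then show "\<forall>x\<in>V. eval (A i * F ^ i) x * eval D x = eval (T i) x * eval (B i * G ^ i) x"
        unfolding T_def D_def P_def HB[OF that] by simp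
    qed
    finally show ?thesis .
  qed
  have "ratfun V F G [^]\<^bsub>K\<^esub> n = ratfun V (F ^ n * H) D"
    unfolding pow_ratfun[OF assms(1)]
  proof (subst ratfun_eq_iff[OF fraction_power[OF assms(1)]])
    show "fraction (e + n * k) (F ^ n * H) D"
      using D D_nz homogeneous_mult[OF H homogeneous_power[OF G(2), of n]]
      by (simp add: fraction_def mult.commute)
  qed (simp add: D_def)
  moreover have "(\<Oplus>\<^bsub>K\<^esub>i\<in>{..<n}. c i \<otimes>\<^bsub>K\<^esub> ratfun V F G [^]\<^bsub>K\<^esub> i) = ratfun V (\<Sum>i<n. T i) D"
  proof -
    have "(\<Oplus>\<^bsub>K\<^esub>i\<in>{..<n}. c i \<otimes>\<^bsub>K\<^esub> ratfun V F G [^]\<^bsub>K\<^esub> i) = (\<Oplus>\<^bsub>K\<^esub>i\<in>{..<n}. ratfun V (T i) D)"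
      using T D D_nz
      by (intro abelian_monoid.finsum_cong'[OF abelian_monoid_K])
         (auto intro!: ratfun_in_K simp: terms fraction_def)
    also have "\<dots> = ratfun V (\<Sum>i<n. T i) D" by (rule finsum_ratfun[OF T D D_nz])
    finally show ?thesis .
  qed
  ultimately have eq': "ratfun V (F ^ n * H) D \<oplus>\<^bsub>K\<^esub> ratfun V (\<Sum>i<n. T i) D = ratfun V 0 1"
    using eq by (simp add: zero_K)
  have fr: "fraction (e + n * k) (F ^ n * H) D" "fraction (e + n * k) (\<Sum>i<n. T i) D"
    using D D_nz homogeneous_mult[OF H homogeneous_power[OF G(2), of n]] homogeneous_sum[of "{..<n}" _ T] T
    by (auto simp: fraction_def mult.commute)
  define Z where "Z = F ^ n * H + (\<Sum>i<n. T i)"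
  have Z: "homogeneous (e + n * k) Z"
    using fr by (auto simp: Z_def fraction_def intro: homogeneous_add)
  have "Z * D \<in> vanishing_ideal V"
    using eq' unfolding add_ratfun[OF fr] ratfun_eq_iff[OF fraction_add[OF fr] fraction_01(1)]
    by (simp add: Z_def vanishing_ideal_def algebra_simps)
  then have Z0: "Z \<in> vanishing_ideal V"
    using prime[OF Z D] D_nz by blast
  \<comment> \<open>For \<open>n = 0\<close> the equation would say that \<open>H\<close> vanishes
    on \<open>V\<close>, in particular at \<open>x\<close>.\<close>
  have "n \<noteq> 0"
  proof
    assume "n = 0"
    then show False
      using Z0 Hx assms(2) by (simp add: Z_def vanishing_ideal_def)
  qed
  then show ?thesis
    using Z0 by (intro that[of n e H P] H Hx P) (auto simp: Z_def T_def vanishing_ideal_def)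
qed

text \<open>\<open>G ^ (n - 1)\<close> is a common denominator of all powers of
  \<open>H F / G\<close>. For \<open>m < n\<close> this is clear; for larger \<open>m\<close>, the
  equation times \<open>H ^ (n - 1)\<close> replaces \<open>(H F) ^ n\<close> by lower
  powers.\<close>

lemma integral_imp_almost_integral:
  assumes "homogeneous k F" "homogeneous k G" "homogeneous e H" "\<And>i. i < n \<Longrightarrow> homogeneous e (P i)"
    "\<And>y. y \<in> V \<Longrightarrow> eval F y ^ n * eval H y + (\<Sum>i<n. eval (P i) y * eval F y ^ i * eval G y ^ (n - i)) = 0"
    "n \<ge> 1"
  shows "\<exists>R. homogeneous ((n - 1) * k + m * e) R \<and>
    (\<forall>y\<in>V. eval G y ^ (n - 1) * (eval H y * eval F y) ^ m = eval G y ^ m * eval R y)"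
proof (induction m rule: less_induct)
  case (less m)
  show ?case
  proof (cases "m < n")
    case True
    have "homogeneous ((n - 1 - m) * k + m * (e + k)) (G ^ (n - 1 - m) * (H * F) ^ m)"
      by (intro homogeneous_mult homogeneous_power assms)
    moreover have "(n - 1 - m) * k + m * (e + k) = (n - 1) * k + m * e"
    proof -
      have "n - 1 = (n - 1 - m) + m"
        using True by simp
      then have "(n - 1) * k = (n - 1 - m) * k + m * k" by (metis add_mult_distrib)
      then show ?thesis by (simp add: algebra_simps)
    qed
    moreover have "eval G y ^ (n - 1) * (eval H y * eval F y) ^ m =
        eval G y ^ m * eval (G ^ (n - 1 - m) * (H * F) ^ m) y" for y
    proof -
      have "eval G y ^ (n - 1) = eval G y ^ m * eval G y ^ (n - 1 - m)"
        using True by (simp add: power_add[symmetric])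
      then show ?thesis by simp
    qed
    ultimately show ?thesis by metis
  next
    case False
    define p where "p = m - n"
    have m: "m = n + p"
      using False by (simp add: p_def)
    have "\<forall>i. \<exists>R. i < n \<longrightarrow> homogeneous ((n - 1) * k + (p + i) * e) R \<and>
      (\<forall>y\<in>V. eval G y ^ (n - 1) * (eval H y * eval F y) ^ (p + i) = eval G y ^ (p + i) * eval R y)"
      using less.IH by (metis m add.commute add_less_cancel_left)
    then obtain R where R: "\<And>i. i < n \<Longrightarrow> homogeneous ((n - 1) * k + (p + i) * e) (R i)"
      "\<And>i y. i < n \<Longrightarrow> y \<in> V \<Longrightarrow>
        eval G y ^ (n - 1) * (eval H y * eval F y) ^ (p + i) = eval G y ^ (p + i) * eval (R i) y"
      by metis
    define Q where "Q = - (\<Sum>i<n. P i * H ^ (n - 1 - i) * R i)"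
    have "homogeneous ((n - 1) * k + m * e) (P i * H ^ (n - 1 - i) * R i)" if "i < n" for i
    proof -
      have "homogeneous (e + (n - 1 - i) * e + ((n - 1) * k + (p + i) * e)) (P i * H ^ (n - 1 - i) * R i)"
        using that by (intro homogeneous_mult homogeneous_power assms R)
      moreover have "e + (n - 1 - i) * e + ((n - 1) * k + (p + i) * e) = (n - 1) * k + m * e"
      proof -
        have "m = 1 + (n - 1 - i) + (p + i)"
          using that m by simp
        then have "m * e = (1 + (n - 1 - i) + (p + i)) * e" by simp
        then show ?thesis by (simp add: algebra_simps)
      qed
      ultimately show ?thesis by (simp only:)
    qed
    then have "homogeneous ((n - 1) * k + m * e) Q"
      unfolding Q_def by (intro homogeneous_uminus homogeneous_sum) auto
    moreover have "eval G y ^ (n - 1) * (eval H y * eval F y) ^ m = eval G y ^ m * eval Q y" if y: "y \<in> V" for y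
    proof -
      define f g h where "f = eval F y" "g = eval G y" "h = eval H y"
      have "f ^ n * h = - (\<Sum>i<n. eval (P i) y * f ^ i * g ^ (n - i))"
        using assms(5)[OF y] by (simp add: f_g_h_def eq_neg_iff_add_eq_0)
      moreover have "(h * f) ^ n = h ^ (n - 1) * (f ^ n * h)"
        using assms(6) by (cases n) (auto simp: power_mult_distrib)
      ultimately have "g ^ (n - 1) * (h * f) ^ m =
          g ^ (n - 1) * (h * f) ^ p * (h ^ (n - 1) * - (\<Sum>i<n. eval (P i) y * f ^ i * g ^ (n - i)))"
        by (simp add: m power_add)
      also have "\<dots> = - (\<Sum>i<n. g ^ (n - 1) * (h * f) ^ p * (h ^ (n - 1) * (eval (P i) y * f ^ i * g ^ (n - i))))"
        by (simp only: sum_distrib_left mult_minus_right)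
      also have "\<dots> = - (\<Sum>i<n. g ^ m * (eval (P i) y * h ^ (n - 1 - i) * eval (R i) y))"
      proof (rule arg_cong[of _ _ uminus], rule sum.cong)
        fix i assume "i \<in> {..<n}"
        then have i: "i < n" by simp
        have h: "h ^ (n - 1) = h ^ i * h ^ (n - 1 - i)" and g: "g ^ m = g ^ (p + i) * g ^ (n - i)"
          using i by (simp_all add: power_add[symmetric] m add.commute)
        have "g ^ (n - 1) * (h * f) ^ p * (h ^ (n - 1) * (eval (P i) y * f ^ i * g ^ (n - i))) =
          (g ^ (n - 1) * (h * f) ^ (p + i)) * (eval (P i) y * h ^ (n - 1 - i) * g ^ (n - i))"
          unfolding h by (simp add: power_add power_mult_distrib mult_ac)
        also have "\<dots> = g ^ m * (eval (P i) y * h ^ (n - 1 - i) * eval (R i) y)"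
          using R(2)[OF i y] unfolding g by (simp add: f_g_h_def mult_ac)
        finally show "g ^ (n - 1) * (h * f) ^ p * (h ^ (n - 1) * (eval (P i) y * f ^ i * g ^ (n - i))) =
          g ^ m * (eval (P i) y * h ^ (n - 1 - i) * eval (R i) y)" .
      qed simp
      also have "\<dots> = g ^ m * eval Q y"
        using ring_map_diff[OF ring_map_eval, of "($) y" 0 "\<Sum>i<n. P i * H ^ (n - 1 - i) * R i"]
        by (simp add: Q_def sum_distrib_left f_g_h_def)
      finally show ?thesis by (simp add: f_g_h_def)
    qed
    ultimately show ?thesis by blast
  qed
qed

end

section \<open>The projective variety of a saturated semigroup\<close>

definition nscale :: "nat \<Rightarrow> nat \<times> (int ^ 'j) \<Rightarrow> nat \<times> (int ^ 'j)" where
  "nscale n s = (n * fst s, int n *s snd s)"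

lemma nscale_0 [simp]: "nscale 0 s = 0"
  by (simp add: nscale_def vec_eq_iff prod_eq_iff)

lemma nscale_1 [simp]: "nscale (Suc 0) s = s"
  by (simp add: nscale_def vec_eq_iff prod_eq_iff)

lemma nscale_add: "nscale (m + n) s = nscale m s + nscale n s"
  by (simp add: nscale_def vec_eq_iff prod_eq_iff algebra_simps)

lemma nscale_Suc: "nscale (Suc n) s = s + nscale n s"
  using nscale_add[of 1 n s] by (simp add: nscale_def vec_eq_iff prod_eq_iff algebra_simps)

lemma power_single_nscale:
  "single s (1 :: complex) ^ n = single (nscale n s) 1"
  by (induction n) (auto simp: nscale_Suc mult_single)

lemma finite_bounded_int_vecs: "finite {v :: int ^ 'j::finite. \<forall>j. \<bar>v $ j\<bar> \<le> M}"
proof -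
  have "finite {f :: 'j \<Rightarrow> int. \<forall>x. (x \<in> UNIV \<longrightarrow> f x \<in> {-M..M}) \<and> (x \<notin> UNIV \<longrightarrow> f x = 0)}"
    by (rule finite_set_of_finite_funs) auto
  moreover have "{v :: int ^ 'j. \<forall>j. \<bar>v $ j\<bar> \<le> M} \<subseteq> vec_lambda ` {f :: 'j \<Rightarrow> int. \<forall>x. (x \<in> UNIV \<longrightarrow> f x \<in> {-M..M}) \<and> (x \<notin> UNIV \<longrightarrow> f x = 0)}"
  proof
    fix v :: "int ^ 'j" assume "v \<in> {v. \<forall>j. \<bar>v $ j\<bar> \<le> M}"
    then show "v \<in> vec_lambda ` {f :: 'j \<Rightarrow> int. \<forall>x. (x \<in> UNIV \<longrightarrow> f x \<in> {-M..M}) \<and> (x \<notin> UNIV \<longrightarrow> f x = 0)}"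
      by (intro image_eqI[of _ _ "($) v"]) (auto simp: abs_le_iff minus_le_iff)
  qed
  ultimately show ?thesis
    using finite_surj by blast
qed

lemma real_vec_simps [simp]:
  "real_vec (u + v) = real_vec u + real_vec v" "real_vec (n *s u) = of_int n *\<^sub>R real_vec u"
  "real_vec (- u) = - real_vec u" "real_vec 0 = 0" "real_vec (u - v) = real_vec u - real_vec v"
  by (simp_all add: real_vec_def vec_eq_iff)

lemma real_vec_eq_iff [simp]: "real_vec u = real_vec v \<longleftrightarrow> u = v"
  by (simp add: real_vec_def vec_eq_iff)

lemma real_vec_sum: "real_vec (\<Sum>x\<in>X. f x) = (\<Sum>x\<in>X. real_vec (f x))"
  by (induction X rule: infinite_finite_induct) auto

text \<open>Pigeonhole on the fractional parts of the multiples of a real relation.\<close>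

lemma real_relation_imp_integer_relation:
  fixes c :: "'b \<Rightarrow> real" and v :: "'b \<Rightarrow> int ^ 'j::finite"
  assumes "finite B" "(\<Sum>b\<in>B. c b) = 0" "(\<Sum>b\<in>B. c b *\<^sub>R real_vec (v b)) = real_vec u"
  obtains D k where "D \<ge> (1::nat)" "(\<Sum>b\<in>B. k b) = (0::int)" "(\<Sum>b\<in>B. k b *s v b) = int D *s u"
proof -
  define f where "f n b = \<lfloor>real n * c b\<rfloor>" for n b
  \<comment> \<open>What rounding down the coefficients leaves of the two relations. It stays in a
    finite box, and two equal values, at \<open>m < n\<close>, give an integer relation with
    \<open>D = n - m\<close>.\<close>
  define rest where "rest n = (\<Sum>b\<in>B. f n b, int n *s u - (\<Sum>b\<in>B. f n b *s v b))" for n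
  define M where "M = (\<Sum>j\<in>UNIV. \<Sum>b\<in>B. \<bar>v b $ j\<bar>)"
  have frac: "\<bar>real n * c b - of_int (f n b)\<bar> \<le> 1" for n b
    unfolding f_def by linarith
  have "rest n \<in> {- int (card B)..int (card B)} \<times> {v. \<forall>j. \<bar>v $ j\<bar> \<le> M}" for n
  proof -
    have "real_of_int (\<Sum>b\<in>B. f n b) = - (\<Sum>b\<in>B. real n * c b - of_int (f n b))"
      by (simp add: sum_subtractf flip: sum_distrib_left) (simp add: assms(2))
    then have "\<bar>real_of_int (\<Sum>b\<in>B. f n b)\<bar> \<le> (\<Sum>b\<in>B. \<bar>real n * c b - of_int (f n b)\<bar>)"
      by (simp only: abs_minus_cancel sum_abs)
    also have "\<dots> \<le> (\<Sum>b\<in>B. 1)" by (intro sum_mono frac)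
    finally have "real_of_int \<bar>\<Sum>b\<in>B. f n b\<bar> \<le> real_of_int (int (card B))" by simp
    then have 1: "\<bar>\<Sum>b\<in>B. f n b\<bar> \<le> int (card B)" by (simp only: of_int_le_iff)
    have 2: "\<bar>(int n *s u - (\<Sum>b\<in>B. f n b *s v b)) $ j\<bar> \<le> M" for j
    proof -
      have "real_of_int (u $ j) = (\<Sum>b\<in>B. c b * of_int (v b $ j))"
        using arg_cong[OF assms(3), of "\<lambda>x. x $ j"] by (simp add: real_vec_def)
      then have "real_of_int ((int n *s u - (\<Sum>b\<in>B. f n b *s v b)) $ j) =
          (\<Sum>b\<in>B. (real n * c b - of_int (f n b)) * of_int (v b $ j))"
        by (simp add: sum_distrib_left left_diff_distrib sum_subtractf mult.assoc)
      then have "\<bar>real_of_int ((int n *s u - (\<Sum>b\<in>B. f n b *s v b)) $ j)\<bar> \<le>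
          (\<Sum>b\<in>B. \<bar>(real n * c b - of_int (f n b)) * of_int (v b $ j)\<bar>)"
        by (simp only: sum_abs)
      also have "\<dots> \<le> (\<Sum>b\<in>B. \<bar>of_int (v b $ j)\<bar>)"
        using frac by (intro sum_mono) (simp add: abs_mult mult_left_le_one_le)
      also have "\<dots> = of_int (\<Sum>b\<in>B. \<bar>v b $ j\<bar>)" by simp
      finally have "\<bar>(int n *s u - (\<Sum>b\<in>B. f n b *s v b)) $ j\<bar> \<le> (\<Sum>b\<in>B. \<bar>v b $ j\<bar>)" by linarith
      also have "\<dots> \<le> M"
        unfolding M_def by (rule member_le_sum) (auto intro: sum_nonneg)
      finally show ?thesis .
    qed
    from 1 2 show ?thesis
      by (auto simp: rest_def abs_le_iff)
  qed
  then have "range rest \<subseteq> {- int (card B)..int (card B)} \<times> {v. \<forall>j. \<bar>v $ j\<bar> \<le> M}" by blast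
  then have "finite (range rest)"
    by (rule finite_subset[OF _ finite_cartesian_product[OF finite_atLeastAtMost_int finite_bounded_int_vecs]])
  then have "\<not> inj rest"
    using finite_imageD[of rest UNIV] infinite_UNIV_nat by auto
  then obtain m n where mn: "rest m = rest n" "m \<noteq> n"
    unfolding inj_def by auto
  then obtain m n where "rest m = rest n" "m < n"
    by (cases "m < n") (auto dest: sym)
  then show ?thesis by (intro that[of "n - m" "\<lambda>b. f n b - f m b"])
       (auto simp: rest_def sum_subtractf of_nat_diff vec_eq_iff algebra_simps)
qed

lemma generated_monoid_cases:
  assumes "\<And>s. s \<in> A \<Longrightarrow> fst s \<ge> 1" "s \<in> {sum_list xs |xs. set xs \<subseteq> A}"
  obtains "s = 0" | "fst s \<ge> 1" "s \<in> {sum_list xs |xs. xs \<noteq> [] \<and> set xs \<subseteq> (A :: (nat \<times> 'm::comm_monoid_add) set)}"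
proof -
  obtain xs where xs: "s = sum_list xs" "set xs \<subseteq> A"
    using assms(2) by blast
  show ?thesis
  proof (cases xs)
    case (Cons a ys)
    then have "fst s \<ge> 1"
      using xs assms(1)[of a] by simp
    then show ?thesis
      using xs Cons by (intro that(2)) (blast intro: list.discI)+
  qed (use xs that in auto)
qed

text \<open>The grading \<open>X\<close> can be chosen freely. Suitable choices turn the
  surjectivity of the substitution \<open>g\<close> into combinatorial facts about
  \<open>S\<close>.\<close>

lemma eval_with_piece:
  fixes g :: "'v::finite \<Rightarrow> 'm::comm_monoid_add \<Rightarrow>\<^sub>0 'c::comm_ring_1"
  assumes "graded_exponents X" "\<And>i. keys (g i) \<subseteq> X (1::nat)" "homogeneous l F"
  shows "keys (eval_with (single 0) g F) \<subseteq> X l"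
proof -
  interpret graded_exponents X by fact
  interpret nat_graded_exponents X by unfold_locales
  have "piece l (single 0 (lookup F e) * expo_eval g e)"
    if e: "e \<in> keys F" for e
  proof -
    have l: "l = 0 + (\<Sum>i\<in>UNIV. lookup e i * 1)"
      using assms(3) e by (simp add: homogeneous_def)
    have "expo_eval g e = (\<Prod>i\<in>UNIV. g i ^ lookup e i)" by (rule expo_eval_superset) auto
    then show ?thesis
      unfolding l using zero assms(2) by (simp only:) (intro piece_mult piece_prod piece_power, auto)
  qed
  then show ?thesis
    unfolding eval_with_def by (rule piece_sum)
qed

text \<open>The central fiber \<open>Proj \<complex>[S]\<close> in the embedding given by
  \<open>g\<close>. Full dimension enters through the affine hull of the part of degree
  \<open>d\<close>, saturation through the division of exponents by integers.\<close>

locale semigroup_proj =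
  fixes S A :: "(nat \<times> (int ^ 'j::finite)) set" and d :: nat
    and g :: "'p::finite \<Rightarrow> (nat \<times> (int ^ 'j)) \<Rightarrow>\<^sub>0 complex"
  assumes finite_A: "finite A" and S_gen: "S = {sum_list xs |xs. xs \<noteq> [] \<and> set xs \<subseteq> A}"
    and S_pos: "\<And>s. s \<in> S \<Longrightarrow> fst s \<ge> 1"
    and sat: "saturated S" and full: "interior (NO_body S) \<noteq> {}"
    and d_pos: "d \<ge> 1"
    and g_deg: "\<And>i. keys (g i) \<subseteq> {s\<in>S. fst s = d}"
    and g_surj: "\<And>l. l \<ge> 1 \<Longrightarrow> eval_with (single 0) g ` {F. homogeneous l F} =
              {b. keys b \<subseteq> {s\<in>S. fst s = d * l}}"
begin

abbreviation \<Phi> :: "('p, complex) mpoly \<Rightarrow> (nat \<times> (int ^ 'j)) \<Rightarrow>\<^sub>0 complex" where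
  "\<Phi> \<equiv> eval_with (single 0) g"

text \<open>\<open>S\<close> with the unit adjoined: constants live in degree zero, while all
  degrees in \<open>S\<close> are positive.\<close>

definition P :: "(nat \<times> (int ^ 'j)) set" where
  "P = {sum_list xs |xs. set xs \<subseteq> A}"

definition I :: "('p, complex) mpoly set" where
  "I = {F. \<Phi> F = 0}"

definition V :: "(complex ^ 'p) set" where
  "V = zero_locus I"

definition B :: "(nat \<times> (int ^ 'j)) set" where
  "B = {s\<in>S. fst s = d}"

lemma A_S: "A \<subseteq> S"
  unfolding S_gen by (auto intro!: exI[of _ "[_]"])

lemma S_P: "S \<subseteq> P"
  by (auto simp: S_gen P_def)

lemma P_cases:
  assumes "s \<in> P"
  obtains "s = 0" | "fst s \<ge> 1" "s \<in> S"
  using generated_monoid_cases[of A s] assms S_pos A_S unfolding P_def S_gen[symmetric] by blast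

lemma P_imp_S: "s \<in> P \<Longrightarrow> fst s \<ge> 1 \<Longrightarrow> s \<in> S"
  by (erule P_cases) auto

lemma zero_P: "0 \<in> P"
  unfolding P_def by (auto intro!: exI[of _ "[]"])

lemma add_P: "s \<in> P \<Longrightarrow> t \<in> P \<Longrightarrow> s + t \<in> P"
proof -
  assume "s \<in> P" "t \<in> P"
  then obtain xs ys where "s = sum_list xs" "set xs \<subseteq> A" "t = sum_list ys" "set ys \<subseteq> A"
    by (auto simp: P_def)
  then show ?thesis
    unfolding P_def by (auto intro!: exI[of _ "xs @ ys"])
qed

lemma sum_P: "(\<And>x. x \<in> X \<Longrightarrow> f x \<in> P) \<Longrightarrow> sum f X \<in> P"
  by (induction X rule: infinite_finite_induct) (auto intro: add_P zero_P)

lemma nscale_P: "s \<in> P \<Longrightarrow> nscale n s \<in> P"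
  by (induction n) (auto simp: nscale_Suc intro: add_P zero_P)

lemma sat_P:
  assumes "k \<ge> 1" "(k * r, int k *s u) \<in> P"
  shows "(r, u) \<in> P"
  using assms(2)
proof (cases rule: P_cases)
  case 1
  then have "r = 0" "u = 0"
    using assms(1) by (auto simp: prod_eq_iff vec_eq_iff)
  then show ?thesis
    using zero_P by (simp add: zero_prod_def)
next
  case 2
  then have "(r, u) \<in> S"
    using sat unfolding saturated_def by blast
  then show ?thesis
    using S_P by blast
qed

lemma \<Phi>_ring_map: "ring_map \<Phi>"
  by (rule ring_map_eval_with[OF ring_map_single_0])

lemmas \<Phi>_simps [simp] =
  ring_map_0[OF \<Phi>_ring_map] ring_map_1[OF \<Phi>_ring_map] ring_map_add[OF \<Phi>_ring_map]
  ring_map_mult[OF \<Phi>_ring_map] ring_map_diff[OF \<Phi>_ring_map] ring_map_power[OF \<Phi>_ring_map]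
  ring_map_sum[OF \<Phi>_ring_map] ring_map_prod[OF \<Phi>_ring_map]
  eval_with_Var[OF ring_map_single_0, of g] eval_with_Const[OF ring_map_single_0, of g]

lemma keys_\<Phi>:
  assumes "homogeneous l F"
  shows "keys (\<Phi> F) \<subseteq> {s\<in>P. fst s = d * l}"
proof (rule eval_with_piece[OF _ _ assms])
  show "graded_exponents (\<lambda>l. {s\<in>P. fst s = d * l})"
    by unfold_locales (auto simp: zero_P add_P algebra_simps)
  show "keys (g i) \<subseteq> {s \<in> P. fst s = d * 1}" for i
    using g_deg[of i] S_P by auto
qed

lemma form_over:
  assumes "keys b \<subseteq> {s\<in>S. fst s = d * l}" "l \<ge> 1"
  obtains F where "homogeneous l F" "\<Phi> F = b"
proof -
  have "b \<in> \<Phi> ` {F. homogeneous l F}"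
    unfolding g_surj[OF assms(2)] using assms(1) by simp
  then show ?thesis
    using that by auto
qed

text \<open>Some linear form maps to \<open>single b 1\<close>, so \<open>b\<close> must occur in
  some \<open>g i\<close>. The grading \<open>Y\<close> makes this precise: in degree one it admits
  exactly the exponents of the \<open>g i\<close>.\<close>

lemma B_eq: "B = (\<Union>i. keys (g i))"
proof
  show "(\<Union>i. keys (g i)) \<subseteq> B"
    using g_deg by (auto simp: B_def)
  show "B \<subseteq> (\<Union>i. keys (g i))"
  proof
    fix b assume b: "b \<in> B"
    obtain F where F: "homogeneous 1 F" "\<Phi> F = single b 1"
      by (rule form_over[of "single b 1" 1]) (use b in \<open>auto simp: B_def\<close>)
    define Y where "Y l = (if l = 0 then {0} else if l = 1 then (\<Union>i. keys (g i)) else UNIV)" for l :: nat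
    have "graded_exponents Y" by unfold_locales (auto simp: Y_def)
    from eval_with_piece[OF this _ F(1)] have "keys (\<Phi> F) \<subseteq> Y 1"
      by (auto simp: Y_def)
    then show "b \<in> (\<Union>i. keys (g i))" by (simp add: F(2) Y_def)
  qed
qed

lemma finite_B: "finite B"
  unfolding B_eq by simp

text \<open>\<open>L b\<close> is a linear form whose restriction to \<open>Proj \<complex>[S]\<close> is the monomial \<open>b\<close>. The values of the
  \<open>L b\<close> are the coordinates in which the variety is cut out by binomials.\<close>

definition L :: "nat \<times> (int ^ 'j) \<Rightarrow> ('p, complex) mpoly" where
  "L b = (SOME F. homogeneous 1 F \<and> \<Phi> F = single b 1)"

lemma L:
  assumes "b \<in> B"
  shows homogeneous_L: "homogeneous 1 (L b)" and \<Phi>_L: "\<Phi> (L b) = single b 1"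
proof -
  have "\<exists>F. homogeneous 1 F \<and> \<Phi> F = single b 1"
    by (rule form_over[of "single b 1" 1]) (use assms in \<open>auto simp: B_def\<close>)
  from someI_ex[OF this] show "homogeneous 1 (L b)" "\<Phi> (L b) = single b 1"
    by (simp_all add: L_def)
qed

section \<open>Generation in degree \<open>d\<close> and lattice relations\<close>

definition msum :: "(nat \<times> (int ^ 'j) \<Rightarrow> nat) \<Rightarrow> nat \<times> (int ^ 'j)" where
  "msum m = (\<Sum>b\<in>B. nscale (m b) b)"

lemma fst_msum: "fst (msum m) = d * (\<Sum>b\<in>B. m b)"
  by (simp add: msum_def fst_sum nscale_def B_def sum_distrib_left mult.commute)

lemma snd_msum: "snd (msum m) = (\<Sum>b\<in>B. int (m b) *s snd b)"
  by (simp add: msum_def snd_sum nscale_def)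

lemma msum_P: "msum m \<in> P"
  unfolding msum_def using S_P by (intro sum_P nscale_P) (auto simp: B_def)

text \<open>The monomial \<open>s\<close> is the image of a form of degree \<open>l\<close>, and
  only sums of \<open>l\<close> elements of \<open>B\<close>, with repetition, can be exponents of
  such an image.\<close>

lemma piece_is_msum:
  assumes "s \<in> S" "fst s = d * l" "l \<ge> 1"
  obtains m where "(\<Sum>b\<in>B. m b) = l" "s = msum m"
proof -
  obtain F where F: "homogeneous l F" "\<Phi> F = single s 1"
    by (rule form_over[of "single s 1" l]) (use assms in auto)
  have "keys (\<Phi> F) \<subseteq> {msum m |m. (\<Sum>b\<in>B. m b) = l}"
  proof (rule eval_with_piece[OF _ _ F(1)])
    show "graded_exponents (\<lambda>l. {msum m |m. (\<Sum>b\<in>B. m b) = l})"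
    proof
      show "0 \<in> {msum m |m. (\<Sum>b\<in>B. m b) = 0}"
        by (auto simp: msum_def intro!: exI[of _ "\<lambda>_. 0"])
      show "x + y \<in> {msum m |m. (\<Sum>b\<in>B. m b) = i + j}"
        if xy: "x \<in> {msum m |m. (\<Sum>b\<in>B. m b) = i}" "y \<in> {msum m |m. (\<Sum>b\<in>B. m b) = j}" for x y i j
      proof -
        obtain m m' where "x = msum m" "(\<Sum>b\<in>B. m b) = i" "y = msum m'" "(\<Sum>b\<in>B. m' b) = j"
          using xy by blast
        then show ?thesis
          by (auto intro!: exI[of _ "\<lambda>b. m b + m' b"] simp: msum_def nscale_add sum.distrib)
      qed
    qed
    show "keys (g i) \<subseteq> {msum m |m. (\<Sum>b\<in>B. m b) = 1}" for i
    proof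
      fix b assume "b \<in> keys (g i)"
      then have "b \<in> B" by (auto simp: B_eq)
      moreover have "nscale (if c = b then 1 else 0) c = (if c = b then b else 0)" for c
        by simp
      ultimately have "msum (\<lambda>c. if c = b then 1 else 0) = b" "(\<Sum>c\<in>B. if c = b then 1 else 0) = (1::nat)"
        using finite_B by (simp_all add: msum_def)
      then show "b \<in> {msum m |m. (\<Sum>b\<in>B. m b) = 1}"
        by (intro CollectI exI[of _ "\<lambda>c. if c = b then 1 else 0"]) simp
    qed
  qed
  then show ?thesis
    using that by (auto simp: F(2))
qed

text \<open>For \<open>(k, u)\<close> in \<open>S\<close>, the multiple by \<open>d\<close> is a sum
  of \<open>k\<close> elements of \<open>B\<close>, so \<open>u / k\<close> is a convex combination
  of the scaled elements of \<open>B\<close>. Their hull therefore contains the body, which has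
  interior points.\<close>

lemma affine_hull_B: "affine hull ((\<lambda>b. (1 / real d) *\<^sub>R real_vec (snd b)) ` B) = UNIV"
proof -
  let ?B = "(\<lambda>b. (1 / real d) *\<^sub>R real_vec (snd b)) ` B"
  have "{(1 / real k) *\<^sub>R real_vec u |k u. (k, u) \<in> S} \<subseteq> convex hull ?B"
  proof clarify
    fix k u assume ku: "(k, u) \<in> S"
    then have k: "k \<ge> 1"
      using S_pos by fastforce
    have "nscale d (k, u) \<in> P"
      using ku S_P by (intro nscale_P) auto
    then have "(d * k, int d *s u) \<in> S"
      using d_pos k by (intro P_imp_S) (auto simp: nscale_def)
    then obtain m where m: "(\<Sum>b\<in>B. m b) = k" "(d * k, int d *s u) = msum m"
      using piece_is_msum[of "(d * k, int d *s u)" k] k by auto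
    have "int d *s u = (\<Sum>b\<in>B. int (m b) *s snd b)"
      using m(2) snd_msum[of m] by (metis snd_conv)
    then have "real_vec (int d *s u) = real_vec (\<Sum>b\<in>B. int (m b) *s snd b)" by (simp only:)
    then have "real d *\<^sub>R real_vec u = (\<Sum>b\<in>B. real (m b) *\<^sub>R real_vec (snd b))"
      by (simp add: real_vec_sum)
    moreover have "(1 / real k) *\<^sub>R real_vec u = (1 / (real d * real k)) *\<^sub>R real d *\<^sub>R real_vec u"
      using d_pos by simp
    ultimately have "(1 / real k) *\<^sub>R real_vec u = (1 / (real d * real k)) *\<^sub>R (\<Sum>b\<in>B. real (m b) *\<^sub>R real_vec (snd b))"
      by simp
    also have "\<dots> = (\<Sum>b\<in>B. (real (m b) / real k) *\<^sub>R (1 / real d) *\<^sub>R real_vec (snd b))"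
      by (simp add: scaleR_sum_right mult.commute)
    also have "\<dots> \<in> convex hull ?B"
    proof (rule convex_sum[OF finite_B convex_convex_hull])
      show "(\<Sum>b\<in>B. real (m b) / real k) = 1"
        using m(1) k by (simp flip: sum_divide_distrib of_nat_sum)
    qed (auto intro!: hull_inc)
    finally show "(1 / real k) *\<^sub>R real_vec u \<in> convex hull ?B" .
  qed
  then have "NO_body S \<subseteq> convex hull ?B"
    unfolding NO_body_def
    by (intro closure_minimal hull_minimal compact_imp_closed finite_imp_compact_convex_hull)
       (auto intro: finite_B)
  then have "interior (convex hull ?B) \<noteq> {}"
    using full interior_mono by blast
  then have "affine hull (convex hull ?B) = UNIV" by (rule affine_hull_nonempty_interior)
  then show ?thesis by (simp add: affine_hull_convex_hull)
qed

lemma B_nonempty: "B \<noteq> {}"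
  using affine_hull_B by auto

text \<open>Take the difference of two affine combinations of the scaled elements of
  \<open>B\<close>, one representing \<open>u\<close> and one the origin.\<close>

lemma real_relation:
  obtains c where "(\<Sum>b\<in>B. c b) = 0" "(\<Sum>b\<in>B. c b *\<^sub>R real_vec (snd b)) = real_vec u"
proof -
  let ?f = "\<lambda>b. (1 / real d) *\<^sub>R real_vec (snd b) :: real ^ 'j"
  have inj: "inj_on ?f B"
    using d_pos by (auto simp: inj_on_def B_def prod_eq_iff)
  have *: "\<exists>t. (\<Sum>b\<in>B. t b) = 1 \<and> (\<Sum>b\<in>B. t b *\<^sub>R ?f b) = y" for y
  proof -
    have "y \<in> affine hull (?f ` B)" by (simp add: affine_hull_B)
    then obtain t where "sum t (?f ` B) = 1" "(\<Sum>v\<in>?f ` B. t v *\<^sub>R v) = y"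
      using affine_hull_finite[of "?f ` B"] finite_B by auto
    then show ?thesis by (intro exI[of _ "t \<circ> ?f"]) (simp add: sum.reindex[OF inj])
  qed
  obtain t0 where t0: "(\<Sum>b\<in>B. t0 b) = 1" "(\<Sum>b\<in>B. t0 b *\<^sub>R ?f b) = 0"
    using *[of 0] by blast
  obtain t1 where t1: "(\<Sum>b\<in>B. t1 b) = 1" "(\<Sum>b\<in>B. t1 b *\<^sub>R ?f b) = real_vec u"
    using *[of "real_vec u"] by blast
  note t = t0 t1
  show ?thesis
  proof (rule that[of "\<lambda>b. (t1 b - t0 b) / real d"])
    show "(\<Sum>b\<in>B. (t1 b - t0 b) / real d) = 0"
      using t by (simp add: sum_subtractf flip: sum_divide_distrib)
    show "(\<Sum>b\<in>B. ((t1 b - t0 b) / real d) *\<^sub>R real_vec (snd b)) = real_vec u"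
      using t by (simp add: diff_divide_distrib scaleR_left_diff_distrib sum_subtractf)
  qed
qed

text \<open>A multiple \<open>D u\<close> satisfies an integer relation. Adding a large multiple of the sum of \<open>B\<close> makes
  the coefficients nonnegative, and saturation removes the factor \<open>D\<close>.\<close>

lemma lattice_relation:
  obtains n where "(\<Sum>b\<in>B. n b) = (0::int)" "(\<Sum>b\<in>B. n b *s snd b) = u"
proof -
  obtain c where c: "(\<Sum>b\<in>B. c b) = 0" "(\<Sum>b\<in>B. c b *\<^sub>R real_vec (snd b)) = real_vec u"
    by (rule real_relation)
  obtain D k where D: "D \<ge> (1::nat)" "(\<Sum>b\<in>B. k b) = (0::int)" "(\<Sum>b\<in>B. k b *s snd b) = int D *s u"
    by (rule real_relation_imp_integer_relation[OF finite_B c])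
  \<comment> \<open>The sum bounds every \<open>\<bar>k b\<bar>\<close>; the summand 1 makes
    \<open>l\<close> positive, as \<open>piece_is_msum\<close> requires.\<close>
  define N where "N = 1 + nat (\<Sum>b\<in>B. \<bar>k b\<bar>)"
  have N: "int (D * N) + k b \<ge> 0" if "b \<in> B" for b
  proof -
    have "\<bar>k b\<bar> \<le> (\<Sum>b\<in>B. \<bar>k b\<bar>)"
      using that finite_B by (intro member_le_sum) auto
    then have "\<bar>k b\<bar> \<le> int N" by (simp add: N_def)
    moreover have "int N \<le> int (D * N)"
      unfolding of_nat_le_iff using D(1) by (cases D) auto
    ultimately show ?thesis by linarith
  qed
  define m where "m b = nat (int (D * N) + k b)" for b
  have m: "int (m b) = int (D * N) + k b" if "b \<in> B" for b
    using N[OF that] by (simp add: m_def)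
  define l where "l = N * card B"
  define q where "q = int N *s (\<Sum>b\<in>B. snd b) + u"
  have "int (\<Sum>b\<in>B. m b) = int (D * l)" by (simp add: m D(2) sum.distrib l_def)
  then have m_sum: "(\<Sum>b\<in>B. m b) = D * l" by (simp only: of_nat_eq_iff)
  have "(\<Sum>b\<in>B. int (m b) *s snd b) = (\<Sum>b\<in>B. int (D * N) *s snd b + k b *s snd b)"
    by (rule sum.cong) (auto simp: m vec_eq_iff algebra_simps)
  also have "\<dots> = int D *s q"
    using D(3) by (simp add: sum.distrib q_def vec_eq_iff sum_distrib_left algebra_simps)
  finally have "msum m = (D * (d * l), int D *s q)"
    by (simp add: prod_eq_iff fst_msum snd_msum m_sum)
  then have "(d * l, q) \<in> P"
    using msum_P[of m] sat_P[OF D(1), of "d * l" q] by simp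
  moreover have l: "l \<ge> 1"
    using finite_B B_nonempty by (simp add: l_def N_def Suc_le_eq card_gt_0_iff)
  ultimately have "(d * l, q) \<in> S"
    using d_pos by (intro P_imp_S) auto
  then obtain m' where m': "(\<Sum>b\<in>B. m' b) = l" "(d * l, q) = msum m'"
    using piece_is_msum[of "(d * l, q)" l] l by auto
  show ?thesis
  \<comment> \<open>Subtracting \<open>N\<close> from every multiplicity undoes the shift in
    \<open>q\<close> and brings the sum of the coefficients back to zero.\<close>
  proof (rule that[of "\<lambda>b. int (m' b) - int N"])
    show "(\<Sum>b\<in>B. int (m' b) - int N) = 0"
      using arg_cong[OF m'(1), of int] by (simp add: sum_subtractf l_def)
    have "q = (\<Sum>b\<in>B. int (m' b) *s snd b)"
      using m'(2) snd_msum[of m'] by (metis snd_conv)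
    then show "(\<Sum>b\<in>B. (int (m' b) - int N) *s snd b) = u"
      by (simp add: q_def vec_eq_iff sum_subtractf sum_distrib_left left_diff_distrib algebra_simps)
  qed
qed

end

lemma eval_scale:
  fixes x :: "complex ^ 'v::finite"
  assumes "homogeneous k F"
  shows "eval F (c *s x) = c ^ k * eval F x"
proof -
  have "($) (c *s x) = (\<lambda>i. c * x $ i)" by (simp add: fun_eq_iff)
  then show ?thesis
    using eval_with_homogeneous_scale[OF assms, of "\<lambda>c. c" c "($) x"] by (simp only:)
qed

lemma eval_zero: "homogeneous 1 F \<Longrightarrow> eval F (0 :: complex ^ 'v::finite) = 0"
  using eval_scale[of 1 F 0 0] by simp

text \<open>Two forms, each vanishing on one of the closed sets but not on all of \<open>V\<close>,
  would have a product that vanishes on \<open>V\<close>.\<close>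

lemma (in irreducible_zero_set) closed_imp_proj_variety:
  assumes "proj_closed V"
  shows "proj_variety V"
  unfolding proj_variety_def
proof (intro conjI allI impI)
  fix Y Z assume "proj_closed Y" "proj_closed Z" and V: "V = Y \<union> Z"
  then obtain A1 A2 where A: "\<forall>F\<in>A1. \<exists>k. homogeneous k F" "Y = zero_locus A1"
    "\<forall>F\<in>A2. \<exists>k. homogeneous k F" "Z = zero_locus A2"
    unfolding proj_closed_def by auto
  show "V = Y \<or> V = Z"
  proof (rule ccontr)
    assume "\<not> (V = Y \<or> V = Z)"
    then obtain x y where xy: "x \<in> Z" "x \<notin> Y" "y \<in> Y" "y \<notin> Z"
      using V by blast
    then obtain F G where FG: "F \<in> A1" "eval F x \<noteq> 0" "G \<in> A2" "eval G y \<noteq> 0"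
      unfolding A by (auto simp: zero_locus_def)
    have "F * G \<in> vanishing_ideal V"
      unfolding vanishing_ideal_def V A using FG by (auto simp: zero_locus_def)
    then have "F \<in> vanishing_ideal V \<or> G \<in> vanishing_ideal V"
      using prime A FG by blast
    then show False
      using FG xy V by (auto simp: vanishing_ideal_def)
  qed
qed (use assms nonempty in auto)

text \<open>Division takes place among Laurent polynomials, whose exponents form a group. On each
  single degree nothing is lost.\<close>

definition forget_degree :: "((nat \<times> 'm::comm_monoid_add) \<Rightarrow>\<^sub>0 complex) \<Rightarrow> 'm \<Rightarrow>\<^sub>0 complex" where
  "forget_degree = lift_char (single 0) (\<lambda>s. single (snd s) 1)"

lemma ring_map_forget_degree: "ring_map forget_degree"
  unfolding forget_degree_def
  by (intro ring_map_lift_char ring_map_single_0) (auto simp: character_def mult_single)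

lemma lookup_forget_degree:
  assumes "keys f \<subseteq> {s. fst s = k}"
  shows "lookup (forget_degree f) u = lookup f (k, u)"
proof -
  have "lookup (forget_degree f) u =
      (\<Sum>s\<in>keys f. if s = (k, u) then lookup f s else 0)"
    unfolding forget_degree_def lift_char_def lookup_sum
    using assms by (intro sum.cong) (auto simp: mult_single lookup_single when_def)
  then show ?thesis by (simp add: in_keys_iff)
qed

lemma forget_degree_inj:
  assumes "keys f \<subseteq> {s. fst s = k}" "keys f' \<subseteq> {s. fst s = k}"
    "forget_degree f = forget_degree f'"
  shows "f = f'"
proof (rule poly_mapping_eqI)
  fix s
  show "lookup f s = lookup f' s"
  proof (cases "fst s = k")
    case True
    then show ?thesis
      using lookup_forget_degree[OF assms(1), of "snd s"] lookup_forget_degree[OF assms(2), of "snd s"]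
        assms(3) by (metis prod.collapse)
  next
    case False
    then show ?thesis
      using assms(1,2) by (metis (mono_tags) in_keys_iff mem_Collect_eq subsetD)
  qed
qed

section \<open>Reducedness and irreducibility of the central fiber\<close>

context semigroup_proj
begin

definition point :: "(nat \<times> (int ^ 'j) \<Rightarrow> complex) \<Rightarrow> complex ^ 'p" where
  "point \<omega> = (\<chi> i. at_point \<omega> (g i))"

lemma eval_point:
  assumes "character \<omega>"
  shows "eval F (point \<omega>) = at_point \<omega> (\<Phi> F)"
proof -
  have "at_point \<omega> (\<Phi> F) = eval_with (\<lambda>c. at_point \<omega> (single 0 c)) (\<lambda>i. at_point \<omega> (g i)) F"
    by (rule eval_with_comp[OF ring_map_single_0 ring_map_lift_char[OF ring_map_id assms]])
  moreover have "at_point \<omega> (single 0 c) = c" for c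
    using assms by (simp add: lift_char_single ring_map_id character_def)
  moreover have "($) (point \<omega>) = (\<lambda>i. at_point \<omega> (g i))" by (simp add: point_def fun_eq_iff)
  ultimately show ?thesis by simp
qed

lemma eval_L_point: "torus_character \<omega> \<Longrightarrow> b \<in> B \<Longrightarrow> eval (L b) (point \<omega>) = \<omega> b"
  by (simp add: eval_point torus_character_def \<Phi>_L lift_char_single ring_map_id)

lemma point_in_V:
  assumes "torus_character \<omega>"
  shows "point \<omega> \<in> V"
proof -
  obtain b where b: "b \<in> B"
    using B_nonempty by blast
  have "eval (L b) (point \<omega>) \<noteq> 0"
    unfolding eval_L_point[OF assms b] using assms unfolding torus_character_def by blast
  then have "point \<omega> \<noteq> 0"
    using eval_zero[OF homogeneous_L[OF b]] by auto
  moreover have "eval F (point \<omega>) = 0" if "F \<in> I" for F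
    using that assms eval_point[of \<omega> F] by (simp add: I_def torus_character_def lift_char_def)
  ultimately show ?thesis by (simp add: V_def zero_locus_def)
qed

text \<open>Torus points lie in \<open>V\<close> and already detect every nonzero element of the
  semigroup algebra.\<close>

lemma vanishing_ideal_V: "vanishing_ideal V = I"
proof
  show "I \<subseteq> vanishing_ideal V" by (auto simp: V_def zero_locus_def vanishing_ideal_def)
  show "vanishing_ideal V \<subseteq> I"
  proof
    fix F assume F: "F \<in> vanishing_ideal V"
    have "\<Phi> F = 0"
    proof (rule vanishing_at_all_points)
      fix \<omega> :: "nat \<times> (int ^ 'j) \<Rightarrow> complex" assume \<omega>: "torus_character \<omega>"
      then show "at_point \<omega> (\<Phi> F) = 0"
        using F point_in_V[OF \<omega>] eval_point[of \<omega> F] by (auto simp: vanishing_ideal_def torus_character_def)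
    qed
    then show "F \<in> I" by (simp add: I_def)
  qed
qed

lemma eval_cong:
  assumes "\<Phi> F = \<Phi> G" "x \<in> V"
  shows "eval F x = eval G x"
proof -
  have "F - G \<in> vanishing_ideal V"
    using assms(1) by (simp add: vanishing_ideal_V I_def)
  then have "eval (F - G) x = 0"
    using assms(2) by (simp only: vanishing_ideal_def) blast
  then show ?thesis by simp
qed

lemma \<Phi>_cong:
  assumes "\<And>x. x \<in> V \<Longrightarrow> eval F x = eval G x"
  shows "\<Phi> F = \<Phi> G"
proof -
  have "F - G \<in> vanishing_ideal V"
    using assms by (simp add: vanishing_ideal_def)
  then show ?thesis by (simp add: vanishing_ideal_V I_def)
qed

text \<open>\<open>\<Phi>\<close> multiplies degrees by \<open>d \<ge> 1\<close>, so the images of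
  the components have disjoint supports and vanish separately.\<close>

lemma component_I:
  assumes "F \<in> I"
  shows "component k F \<in> I"
proof -
  let ?K = "expo_deg ` keys F"
  have keys_comp: "lookup (\<Phi> (component k' F)) s = 0" if "fst s \<noteq> d * k'" for k' s
    using keys_\<Phi>[OF homogeneous_component, of k' F] that by (auto simp: in_keys_iff)
  have "\<Phi> (component k F) = 0"
  proof (rule poly_mapping_eqI)
    fix s
    show "lookup (\<Phi> (component k F)) s = lookup 0 s"
    proof (cases "fst s = d * k \<and> k \<in> ?K")
      case True
      have "\<Phi> F = (\<Sum>k'\<in>?K. \<Phi> (component k' F))" by (subst sum_component) simp
      then have "0 = (\<Sum>k'\<in>?K. lookup (\<Phi> (component k' F)) s)"
        using assms by (simp add: I_def flip: lookup_sum)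
      also have "\<dots> = (\<Sum>k'\<in>?K. if k' = k then lookup (\<Phi> (component k F)) s else 0)"
        using True keys_comp d_pos by (intro sum.cong) auto
      also have "\<dots> = lookup (\<Phi> (component k F)) s"
        using True by simp
      finally show ?thesis by simp
    next
      case False
      moreover have "component k F = 0" if "k \<notin> ?K"
        using that by (auto simp: component_def intro: sum.neutral)
      ultimately show ?thesis
        using keys_comp[of s k] by auto
    qed
  qed
  then show ?thesis by (simp add: I_def)
qed

lemma mem_V_iff: "x \<in> V \<longleftrightarrow> x \<noteq> 0 \<and> (\<forall>F\<in>I. \<forall>k. homogeneous k F \<longrightarrow> eval F x = 0)"
proof
  assume x: "x \<noteq> 0 \<and> (\<forall>F\<in>I. \<forall>k. homogeneous k F \<longrightarrow> eval F x = 0)"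
  have "eval F x = 0" if "F \<in> I" for F
  proof -
    have "eval F x = (\<Sum>k\<in>expo_deg ` keys F. eval (component k F) x)"
      by (subst sum_component) simp
    also have "\<dots> = 0"
      using x component_I[OF that] homogeneous_component by (intro sum.neutral) blast
    finally show ?thesis .
  qed
  then show "x \<in> V"
    using x by (simp add: V_def zero_locus_def)
qed (auto simp: V_def zero_locus_def)

lemma proj_closed_V: "proj_closed V"
  unfolding proj_closed_def
proof (intro exI conjI)
  show "V = zero_locus {F\<in>I. \<exists>k. homogeneous k F}"
    by (rule Set.set_eqI) (unfold mem_V_iff zero_locus_def, blast)
qed auto

sublocale irreducible_zero_set V
proof
  show "V \<noteq> {}"
    using point_in_V[OF torus_character_one] by blast
  show "F \<in> vanishing_ideal V \<or> G \<in> vanishing_ideal V" if "F * G \<in> vanishing_ideal V" for F G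
    using that monoid_algebra_no_zero_divisors[of "\<Phi> F" "\<Phi> G"]
    by (auto simp: vanishing_ideal_V I_def)
qed

lemma proj_variety_V: "proj_variety V"
  by (rule closed_imp_proj_variety[OF proj_closed_V])

lemma coordinates:
  assumes "x \<in> V"
  shows "x $ i = (\<Sum>b\<in>B. lookup (g i) b * eval (L b) x)"
proof -
  have "\<Phi> (Var i) = (\<Sum>b\<in>B. single b (lookup (g i) b))"
  proof -
    have "g i = (\<Sum>b\<in>keys (g i). single b (lookup (g i) b))" by (rule poly_mapping_expand)
    also have "\<dots> = (\<Sum>b\<in>B. single b (lookup (g i) b))"
      using finite_B by (intro sum.mono_neutral_left) (auto simp: B_eq in_keys_iff)
    finally show ?thesis by simp
  qed
  also have "\<dots> = \<Phi> (\<Sum>b\<in>B. Const (lookup (g i) b) * L b)" by (simp add: \<Phi>_L mult_single)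
  finally show ?thesis
    using eval_cong[OF _ assms, of "Var i" "\<Sum>b\<in>B. Const (lookup (g i) b) * L b"] by simp
qed

lemma some_L_nonzero:
  assumes "x \<in> V"
  obtains b where "b \<in> B" "eval (L b) x \<noteq> 0"
proof -
  have "x \<noteq> 0"
    using assms by (simp add: V_def zero_locus_def)
  then have "\<exists>b\<in>B. eval (L b) x \<noteq> 0"
    using coordinates[OF assms] by (auto simp: vec_eq_iff intro: ccontr)
  then show ?thesis
    using that by blast
qed

section \<open>Normality of the central fiber\<close>

lemma keys_forget_degree_\<Phi>:
  assumes "homogeneous l F"
  shows "keys (forget_degree (\<Phi> F)) \<subseteq> {u. (d * l, u) \<in> P}"
proof -
  have "keys (\<Phi> F) \<subseteq> {s. fst s = d * l}"
    using keys_\<Phi>[OF assms] by auto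
  from lookup_forget_degree[OF this] show ?thesis
    using keys_\<Phi>[OF assms] by (auto simp: in_keys_iff)
qed

text \<open>Write \<open>a = F / G\<close>. With \<open>H\<close> from the integral equation,
  \<open>H F / G\<close> is almost integral over the semigroup algebra and hence lies in it. So
  \<open>H F = F' G\<close> on \<open>V\<close> for a form \<open>F'\<close>, and
  \<open>a = F' / H\<close> has a denominator that is nonzero at \<open>x\<close>.\<close>

lemma integral_imp_local:
  assumes x: "x \<in> V" and a: "a \<in> carrier K" and int: "integral_over K (local_ring V x) a"
  shows "a \<in> local_ring V x"
proof -
  obtain k F G where FG: "fraction k F G" and a_eq: "a = ratfun V F G"
    using carrier_K_cases[OF a] by blast
  have "\<exists>n e0 H0 P0. n \<ge> 1 \<and> homogeneous e0 H0 \<and> eval H0 x \<noteq> 0 \<and> (\<forall>i<n. homogeneous e0 (P0 i)) \<and>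
    (\<forall>y\<in>V. eval F y ^ n * eval H0 y + (\<Sum>i<n. eval (P0 i) y * eval F y ^ i * eval G y ^ (n - i)) = 0)"
    by (rule integral_equation[OF FG x int[unfolded a_eq]]) (intro exI conjI allI ballI impI)
  then obtain n e0 H0 P0 where *: "n \<ge> 1 \<and> homogeneous e0 H0 \<and> eval H0 x \<noteq> 0 \<and>
    (\<forall>i<n. homogeneous e0 (P0 i)) \<and>
    (\<forall>y\<in>V. eval F y ^ n * eval H0 y + (\<Sum>i<n. eval (P0 i) y * eval F y ^ i * eval G y ^ (n - i)) = 0)"
    by (elim exE)
  note n = *[THEN conjunct1] and H0 = *[THEN conjunct2, THEN conjunct1] *[THEN conjunct2, THEN conjunct2, THEN conjunct1]
  have P0: "homogeneous e0 (P0 i)" if "i < n" for i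
    using * that by simp
  have eq0: "eval F y ^ n * eval H0 y + (\<Sum>i<n. eval (P0 i) y * eval F y ^ i * eval G y ^ (n - i)) = 0"
    if "y \<in> V" for y
    using * that by simp
  \<comment> \<open>The extra factor \<open>L b0\<close> is nonzero at \<open>x\<close> and makes
    the degree \<open>e\<close> positive, since \<open>form_over\<close> lifts only in positive
    degrees.\<close>
  obtain b0 where b0: "b0 \<in> B" "eval (L b0) x \<noteq> 0"
    using some_L_nonzero[OF x] by blast
  define H where "H = L b0 * H0"
  define P1 where "P1 i = L b0 * P0 i" for i
  define e where "e = 1 + e0"
  have H: "homogeneous e H" "eval H x \<noteq> 0"
    using H0 b0 by (simp_all add: H_def e_def homogeneous_mult[OF homogeneous_L, simplified])
  have P1: "homogeneous e (P1 i)" if "i < n" for i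
    using P0[OF that] b0 by (simp add: P1_def e_def homogeneous_mult[OF homogeneous_L, simplified])
  have eq: "eval F y ^ n * eval H y + (\<Sum>i<n. eval (P1 i) y * eval F y ^ i * eval G y ^ (n - i)) = 0"
    if "y \<in> V" for y
  proof -
    have "eval F y ^ n * eval H y + (\<Sum>i<n. eval (P1 i) y * eval F y ^ i * eval G y ^ (n - i)) =
      eval (L b0) y * (eval F y ^ n * eval H0 y + (\<Sum>i<n. eval (P0 i) y * eval F y ^ i * eval G y ^ (n - i)))"
      by (simp add: H_def P1_def distrib_left sum_distrib_left mult_ac)
    then show ?thesis
      using eq0[OF that] by simp
  qed
  have hom: "homogeneous k F" "homogeneous k G" and G_nz: "G \<notin> vanishing_ideal V"
    using FG by (auto simp: fraction_def)
  define \<Theta> where "\<Theta> F = forget_degree (\<Phi> F)" for F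
  have \<Theta>: "ring_map \<Theta>"
    unfolding \<Theta>_def by (rule ring_map_comp[OF ring_map_forget_degree \<Phi>_ring_map])
  have \<Theta>_inj: "\<Phi> F1 = \<Phi> F2" if "homogeneous l F1" "homogeneous l F2" "\<Theta> F1 = \<Theta> F2" for l F1 F2
    using that keys_\<Phi>[OF that(1)] keys_\<Phi>[OF that(2)] unfolding \<Theta>_def
    by (intro forget_degree_inj[of _ "d * l"]) auto
  have \<Theta>G: "\<Theta> G \<noteq> 0"
    using \<Theta>_inj[OF hom(2) homogeneous_0] G_nz by (auto simp: ring_map_0[OF \<Theta>] vanishing_ideal_V I_def)
  have "\<exists>R. homogeneous ((n - 1) * k + m * e) R \<and> \<Theta> G ^ (n - 1) * \<Theta> (H * F) ^ m = \<Theta> G ^ m * \<Theta> R" for m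
  proof -
    obtain R where R: "homogeneous ((n - 1) * k + m * e) R"
      "\<And>y. y \<in> V \<Longrightarrow> eval G y ^ (n - 1) * (eval H y * eval F y) ^ m = eval G y ^ m * eval R y"
      using integral_imp_almost_integral[OF hom H(1) P1 eq n] by blast
    have "\<Phi> (G ^ (n - 1) * (H * F) ^ m) = \<Phi> (G ^ m * R)" by (rule \<Phi>_cong) (use R(2) in simp)
    then have "\<Theta> (G ^ (n - 1) * (H * F) ^ m) = \<Theta> (G ^ m * R)" by (simp only: \<Theta>_def)
    then show ?thesis
      using R(1) by (auto simp: ring_map_simps[OF \<Theta>])
  qed
  then have "\<forall>m. \<exists>R. homogeneous ((n - 1) * k + m * e) R \<and>
    \<Theta> G ^ (n - 1) * \<Theta> (H * F) ^ m = \<Theta> G ^ m * \<Theta> R"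
    by blast
  from choice[OF this] obtain R where R': "\<forall>m. homogeneous ((n - 1) * k + m * e) (R m) \<and>
    \<Theta> G ^ (n - 1) * \<Theta> (H * F) ^ m = \<Theta> G ^ m * \<Theta> (R m)"
    by blast
  have R: "homogeneous ((n - 1) * k + m * e) (R m)"
    "\<Theta> G ^ (n - 1) * \<Theta> (H * F) ^ m = \<Theta> G ^ m * \<Theta> (R m)" for m
    using R' by blast+
  have c_nz: "\<Theta> G ^ (n - 1) \<noteq> 0" by (rule monoid_algebra_power_nonzero[OF \<Theta>G])
  have "\<Theta> G dvd \<Theta> (H * F)"
    by (rule laurent_dvd_if_powers_dvd[OF \<Theta>G c_nz]) (rule dvdI, rule R(2))
  then obtain b where b: "\<Theta> (H * F) = \<Theta> G * b"
    by (rule dvdE)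
  \<comment> \<open>After cancelling \<open>\<Theta> G ^ m\<close>, all products of
    \<open>\<Theta> G ^ (n - 1)\<close> with powers of \<open>b\<close> come from forms, whose
    degrees control the exponents.\<close>
  have cb: "\<Theta> G ^ (n - 1) * b ^ m = \<Theta> (R m)" for m
  proof -
    have "\<Theta> G ^ m * (\<Theta> G ^ (n - 1) * b ^ m) = \<Theta> G ^ m * \<Theta> (R m)"
      using R(2)[of m] unfolding b power_mult_distrib by (simp only: mult_ac)
    then have "\<Theta> G ^ m * (\<Theta> G ^ (n - 1) * b ^ m - \<Theta> (R m)) = 0"
      by (simp add: right_diff_distrib)
    then have "\<Theta> G ^ (n - 1) * b ^ m - \<Theta> (R m) = 0"
      using monoid_algebra_no_zero_divisors monoid_algebra_power_nonzero[OF \<Theta>G] by blast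
    then show ?thesis by simp
  qed
  have keys_b: "keys b \<subseteq> {u. (d * e, u) \<in> P}"
    unfolding P_def
  proof (rule almost_integral_in_semigroup_algebra[OF finite_A _ c_nz])
    show "(r, u) \<in> {sum_list xs |xs. set xs \<subseteq> A}"
      if "1 \<le> k" "(k * r, int k *s u) \<in> {sum_list xs |xs. set xs \<subseteq> A}" for k r u
      using sat_P[OF that(1)] that(2) unfolding P_def by blast
    show "keys (\<Theta> G ^ (n - 1) * b ^ m) \<subseteq>
        {u. (d * ((n - 1) * k) + m * (d * e), u) \<in> {sum_list xs |xs. set xs \<subseteq> A}}" for m
    proof -
      have "d * ((n - 1) * k) + m * (d * e) = d * ((n - 1) * k + m * e)"
        by (simp add: algebra_simps)
      then show ?thesis
        using keys_forget_degree_\<Phi>[OF R(1), of m, folded \<Theta>_def, unfolded P_def]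
        by (simp only: cb)
    qed
  qed
  \<comment> \<open>The exponents of \<open>b\<close> get back their degree \<open>d * e\<close>, so
    that a form can be found over \<open>b'\<close>.\<close>
  define b' where "b' = (\<Sum>u\<in>keys b. single (d * e, u) (lookup b u))"
  have "keys b' \<subseteq> {s\<in>S. fst s = d * e}"
  proof -
    have "keys b' \<subseteq> (\<lambda>u. (d * e, u)) ` keys b"
      unfolding b'_def using keys_sum by (fastforce split: if_splits)
    moreover have "d * e \<ge> 1"
      using d_pos by (simp add: e_def)
    ultimately show ?thesis
      using keys_b P_imp_S by fastforce
  qed
  then obtain F' where F': "homogeneous e F'" "\<Phi> F' = b'"
    by (rule form_over) (simp add: e_def)
  have "\<Theta> F' = b"
    unfolding \<Theta>_def F'(2) b'_def ring_map_sum[OF ring_map_forget_degree]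
    by (simp add: forget_degree_def lift_char_single ring_map_single_0 mult_single poly_mapping_expand[symmetric])
  then have "\<Phi> (H * F) = \<Phi> (F' * G)"
    using b homogeneous_mult[OF H(1) hom(1)] homogeneous_mult[OF F'(1) hom(2)]
    by (intro \<Theta>_inj) (auto simp: ring_map_mult[OF \<Theta>] mult.commute)
  then have "eval F y * eval H y = eval F' y * eval G y" if "y \<in> V" for y
    using eval_cong[OF _ that, of "H * F" "F' * G"] by (simp add: mult.commute)
  moreover have "fraction e F' H"
    using F' H x by (auto simp: fraction_def vanishing_ideal_def)
  ultimately have "a = ratfun V F' H"
    unfolding a_eq using ratfun_eq_iff[OF FG, of e F' H] by simp
  then show ?thesis
    using F' H by (auto simp: local_ring_def)
qed

lemma normal_V: "normal_at_all_points V"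
  unfolding normal_at_all_points_def using integral_imp_local by blast

end

section \<open>The torus action\<close>

text \<open>\<open>torus\<close> numbers its coordinates, whereas exponents are indexed by
  \<open>'j\<close>; any enumeration will do.\<close>

definition idx :: "'j::finite \<Rightarrow> nat" where
  "idx = (SOME h. bij_betw h UNIV {..<CARD('j)})"

lemma bij_idx: "bij_betw (idx :: 'j::finite \<Rightarrow> nat) UNIV {..<CARD('j)}"
proof -
  have "\<exists>h. bij_betw h (UNIV :: 'j set) {..<CARD('j)}"
    using ex_bij_betw_finite_nat[of "UNIV :: 'j set"] by (simp add: atLeast0LessThan)
  then show ?thesis
    unfolding idx_def by (rule someI_ex)
qed

lemma idx_less: "idx (j :: 'j::finite) < CARD('j)"
  using bij_idx by (auto simp: bij_betw_def)

lemma inj_idx: "inj idx"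
  using bij_idx by (auto simp: bij_betw_def)

lemma idx_cases:
  assumes "i < CARD('j)"
  obtains j :: "'j::finite" where "i = idx j"
  using bij_idx assms unfolding bij_betw_def by (metis imageE lessThan_iff)

definition monomial :: "(nat \<Rightarrow> complex) \<Rightarrow> int ^ 'j::finite \<Rightarrow> complex" where
  "monomial z u = (\<Prod>j\<in>UNIV. z (idx j) powi (u $ j))"

lemma torus_nz: "z \<in> torus r \<Longrightarrow> z i \<noteq> 0"
  by (auto simp: torus_def dest: spec[of _ i] split: if_splits)

lemma torus_mult: "z \<in> torus r \<Longrightarrow> z' \<in> torus r \<Longrightarrow> (\<lambda>i. z i * z' i) \<in> torus r"
  unfolding torus_def by (auto split: if_splits)

lemma monomial_nz: "z \<in> torus r \<Longrightarrow> monomial z u \<noteq> 0"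
  by (simp add: monomial_def torus_nz)

lemma monomial_0 [simp]: "monomial z 0 = 1"
  by (simp add: monomial_def)

lemma monomial_add: "z \<in> torus r \<Longrightarrow> monomial z (u + v) = monomial z u * monomial z v"
  by (simp add: monomial_def power_int_add torus_nz prod.distrib)

lemma prod_powi:
  fixes f :: "'a \<Rightarrow> complex"
  shows "(\<Prod>x\<in>X. f x) powi n = (\<Prod>x\<in>X. f x powi n)"
  by (induction X rule: infinite_finite_induct) (auto simp: power_int_mult_distrib)

lemma monomial_scale: "z \<in> torus r \<Longrightarrow> monomial z (n *s u) = monomial z u powi n"
  by (simp add: monomial_def power_int_mult[symmetric] prod_powi mult.commute)

lemma monomial_sum:
  "z \<in> torus r \<Longrightarrow> monomial z (\<Sum>b\<in>X. n b *s v b) = (\<Prod>b\<in>X. monomial z (v b) powi n b)"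
  by (induction X rule: infinite_finite_induct) (auto simp: monomial_add monomial_scale)

lemma monomial_mult: "monomial (\<lambda>i. z i * z' i) u = monomial z u * monomial z' u"
  by (simp add: monomial_def power_int_mult_distrib prod.distrib)

lemma monomial_one [simp]: "monomial (\<lambda>_. 1) u = 1"
  by (simp add: monomial_def)

lemma monomial_axis: "monomial z (axis j 1) = z (idx j)"
proof -
  have "monomial z (axis j 1) = (\<Prod>k\<in>UNIV. if k = j then z (idx j) else 1)"
    unfolding monomial_def by (intro prod.cong) (auto simp: axis_def)
  then show ?thesis by simp
qed

lemma vec_sum_axis: "u = (\<Sum>j\<in>UNIV. (u $ j) *s axis j (1::int))"
  by (simp add: vec_eq_iff axis_def if_distrib cong: if_cong)

lemma prod_powi_sum_exponents:
  fixes c :: complex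
  assumes "finite X" "c \<noteq> 0"
  shows "(\<Prod>b\<in>X. c powi n b) = c powi (\<Sum>b\<in>X. n b)"
  using assms(1) by (induction X rule: finite_induct) (auto simp: power_int_add assms(2))

lemma powi_eq_nat_quotient:
  fixes c :: complex
  shows "c powi n = c ^ nat n / c ^ nat (- n)"
  by (auto simp: power_int_def field_simps)

text \<open>Morphisms are to be given by polynomials. Multiplying all monomials by the same power of
  the product of the coordinates clears negative exponents without moving the projective
  point.\<close>

definition shifted_monomial :: "nat \<Rightarrow> int ^ 'j::finite \<Rightarrow> (nat, complex) mpoly" where
  "shifted_monomial N u = (\<Prod>j\<in>UNIV. Var (idx j) ^ nat (u $ j + int N))"

lemma eval_shifted_monomial:
  fixes u :: "int ^ 'j::finite"
  assumes "z \<in> torus r" "\<And>j. u $ j + int N \<ge> 0"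
  shows "eval_with (\<lambda>c. c) z (shifted_monomial N u) = (\<Prod>j\<in>(UNIV :: 'j set). z (idx j)) ^ N * monomial z u"
proof -
  have "z (idx j) ^ nat (u $ j + int N) = z (idx j) ^ N * z (idx j) powi (u $ j)" for j
    using assms(2)[of j] torus_nz[OF assms(1)]
    by (metis power_int_add power_int_of_nat mult.commute nat_0_le)
  then show ?thesis
    unfolding shifted_monomial_def monomial_def
    by (simp add: ring_map_prod[OF ring_map_eval] ring_map_power[OF ring_map_eval]
        eval_with_Var[OF ring_map_id] prod.distrib prod_power_distrib)
qed

lemma proj_eq_refl: "proj_eq x x"
  unfolding proj_eq_def by (rule exI[of _ 1]) simp

lemma proj_eqI_scale: "c \<noteq> 0 \<Longrightarrow> (\<And>i. y $ i = c * x $ i) \<Longrightarrow> proj_eq x y"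
  unfolding proj_eq_def by (rule exI[of _ "inverse c"]) (simp add: vec_eq_iff)

section \<open>The open orbit\<close>

context semigroup_proj
begin

abbreviation coef :: "'p \<Rightarrow> nat \<times> (int ^ 'j) \<Rightarrow> complex" where
  "coef i b \<equiv> lookup (g i) b"

definition torus_map :: "(nat \<Rightarrow> complex) \<Rightarrow> complex ^ 'p" where
  "torus_map z = point (\<lambda>s. monomial z (snd s))"

text \<open>Diagonal in the values of the \<open>L b\<close>; the coefficients of the
  \<open>g i\<close> translate back to the homogeneous coordinates.\<close>

definition action :: "(nat \<Rightarrow> complex) \<Rightarrow> complex ^ 'p \<Rightarrow> complex ^ 'p" where
  "action z x = (\<chi> i. \<Sum>b\<in>B. coef i b * monomial z (snd b) * eval (L b) x)"

lemma torus_character_monomial: "z \<in> torus k \<Longrightarrow> torus_character (\<lambda>s :: nat \<times> (int ^ 'j). monomial z (snd s))"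
  by (auto simp: torus_character_def character_def monomial_add monomial_nz)

lemma torus_map_in_V: "z \<in> torus CARD('j) \<Longrightarrow> torus_map z \<in> V"
  unfolding torus_map_def by (intro point_in_V torus_character_monomial)

lemma eval_L_torus_map: "z \<in> torus CARD('j) \<Longrightarrow> b \<in> B \<Longrightarrow> eval (L b) (torus_map z) = monomial z (snd b)"
  unfolding torus_map_def by (rule eval_L_point[OF torus_character_monomial])

lemma torus_map_nth: "z \<in> torus CARD('j) \<Longrightarrow> torus_map z $ i = (\<Sum>b\<in>B. coef i b * monomial z (snd b))"
  using coordinates[OF torus_map_in_V, of z i] by (simp add: eval_L_torus_map)

lemma V_nonzero: "x \<in> V \<Longrightarrow> \<exists>i. x $ i \<noteq> 0"
  by (auto simp: V_def zero_locus_def vec_eq_iff)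

definition shift :: nat where
  "shift = nat (\<Sum>b\<in>B. \<Sum>j\<in>UNIV. \<bar>snd b $ j\<bar>)"

lemma shift: "b \<in> B \<Longrightarrow> snd b $ j + int shift \<ge> 0"
proof -
  assume b: "b \<in> B"
  have "\<bar>snd b $ j\<bar> \<le> (\<Sum>j\<in>UNIV. \<bar>snd b $ j\<bar>)" by (rule member_le_sum) auto
  also have "\<dots> \<le> (\<Sum>b\<in>B. \<Sum>j\<in>UNIV. \<bar>snd b $ j\<bar>)"
    using b finite_B by (intro member_le_sum) (auto intro: sum_nonneg)
  finally have "\<bar>snd b $ j\<bar> \<le> int shift" by (simp add: shift_def sum_nonneg)
  then show ?thesis by linarith
qed

definition scaling :: "(nat \<Rightarrow> complex) \<Rightarrow> complex" where
  "scaling z = (\<Prod>j\<in>(UNIV :: 'j set). z (idx j)) ^ shift"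

lemma scaling_nz: "z \<in> torus CARD('j) \<Longrightarrow> scaling z \<noteq> 0"
  by (simp add: scaling_def torus_nz)

lemma eval_shifted_monomial_B:
  "z \<in> torus CARD('j) \<Longrightarrow> b \<in> B \<Longrightarrow>
    eval_with (\<lambda>c. c) z (shifted_monomial shift (snd b)) = scaling z * monomial z (snd b)"
  unfolding scaling_def by (rule eval_shifted_monomial) (auto intro: shift)

lemma regular_torus_map: "regular_on_torus CARD('j) torus_map"
  unfolding regular_on_torus_def
proof
  fix z assume z: "z \<in> torus CARD('j)"
  define F where "F i = (\<Sum>b\<in>B. Const (coef i b) * shifted_monomial shift (snd b))" for i
  have F: "eval_with (\<lambda>c. c) z' (F i) = scaling z' * torus_map z' $ i" if "z' \<in> torus CARD('j)" for z' i
    using that unfolding F_def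
    by (simp add: ring_map_simps[OF ring_map_eval] ring_map_sum[OF ring_map_eval]
        eval_with_Const[OF ring_map_id] eval_shifted_monomial_B torus_map_nth sum_distrib_left mult_ac)
  have "\<exists>i. eval_with (\<lambda>c. c) z (F i) \<noteq> 0"
    using V_nonzero[OF torus_map_in_V[OF z]] scaling_nz[OF z] by (auto simp: F[OF z])
  moreover have "proj_eq (torus_map z') (\<chi> i. eval_with (\<lambda>c. c) z' (F i))" if "z' \<in> torus CARD('j)" for z'
    using scaling_nz[OF that] by (intro proj_eqI_scale[of "scaling z'"]) (auto simp: F[OF that])
  ultimately show "\<exists>F :: 'p \<Rightarrow> (nat, complex) mpoly. (\<exists>i. eval_with (\<lambda>c. c) z (F i) \<noteq> 0) \<and>
     (\<forall>z'\<in>torus CARD('j). (\<exists>i. eval_with (\<lambda>c. c) z' (F i) \<noteq> 0) \<longrightarrow>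
        proj_eq (torus_map z') (\<chi> i. eval_with (\<lambda>c. c) z' (F i)))"
    by blast
qed

lemma torus_coordinate:
  assumes "z \<in> torus CARD('j)" "(\<Sum>b\<in>B. n b *s snd b) = u"
  shows "monomial z u = (\<Prod>b\<in>B. eval (L b) (torus_map z) powi n b)"
  using monomial_sum[OF assms(1), where X = B and n = n and v = snd] assms by (simp add: eval_L_torus_map)

text \<open>By \<open>lattice_relation\<close> each torus coordinate is a Laurent monomial of total
  degree zero in the values of the \<open>L b\<close>, so rescaling does not change it.\<close>

lemma torus_map_inj:
  assumes z: "z \<in> torus CARD('j)" "z' \<in> torus CARD('j)" and eq: "proj_eq (torus_map z) (torus_map z')"
  shows "z = z'"
proof
  fix i
  obtain c where c: "c \<noteq> 0" "torus_map z = c *s torus_map z'"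
    using eq by (auto simp: proj_eq_def)
  show "z i = z' i"
  proof (cases "i < CARD('j)")
    case True
    then obtain j :: 'j where j: "i = idx j"
      by (rule idx_cases)
    obtain n where n: "(\<Sum>b\<in>B. n b) = (0::int)" "(\<Sum>b\<in>B. n b *s snd b) = axis j 1"
      by (rule lattice_relation)
    have "z i = (\<Prod>b\<in>B. eval (L b) (torus_map z) powi n b)"
      using torus_coordinate[OF z(1) n(2)] by (simp add: monomial_axis j)
    also have "\<dots> = (\<Prod>b\<in>B. c powi n b * eval (L b) (torus_map z') powi n b)"
      using eval_scale[OF homogeneous_L] by (intro prod.cong) (auto simp: c(2) power_int_mult_distrib)
    also have "\<dots> = c powi (\<Sum>b\<in>B. n b) * (\<Prod>b\<in>B. eval (L b) (torus_map z') powi n b)"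
      by (simp add: prod.distrib prod_powi_sum_exponents[OF finite_B c(1)])
    also have "\<dots> = z' i"
      using torus_coordinate[OF z(2) n(2)] by (simp add: monomial_axis j n(1))
    finally show ?thesis .
  next
    case False
    then show ?thesis
      using z by (auto simp: torus_def dest!: spec[of _ i])
  qed
qed

text \<open>The positive and negative parts of a lattice relation give numerator and denominator.
  Their degrees agree because the coefficients add up to zero, and monomials do not vanish on the
  torus.\<close>

lemma torus_coordinate_rational:
  assumes "i < CARD('j)"
  shows "\<exists>k F G. homogeneous k F \<and> homogeneous k G \<and>
    (\<forall>z\<in>torus CARD('j). eval G (torus_map z) \<noteq> 0 \<and> z i = eval F (torus_map z) / eval G (torus_map z))"
proof -
  obtain j :: 'j where j: "i = idx j"
    using assms by (rule idx_cases)
  obtain n where n: "(\<Sum>b\<in>B. n b) = (0::int)" "(\<Sum>b\<in>B. n b *s snd b) = axis j 1"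
    by (rule lattice_relation)
  define F where "F = (\<Prod>b\<in>B. L b ^ nat (n b))"
  define G where "G = (\<Prod>b\<in>B. L b ^ nat (- n b))"
  have hom: "homogeneous (\<Sum>b\<in>B. m b * 1) (\<Prod>b\<in>B. L b ^ m b)" for m
    by (intro homogeneous_prod homogeneous_power homogeneous_L)
  have "int (\<Sum>b\<in>B. nat (n b)) - int (\<Sum>b\<in>B. nat (- n b)) = (\<Sum>b\<in>B. n b)"
    by (simp flip: sum_subtractf) (rule sum.cong, auto)
  then have "(\<Sum>b\<in>B. nat (- n b)) = (\<Sum>b\<in>B. nat (n b))" by (simp add: n(1) del: of_nat_sum)
  then have "homogeneous (\<Sum>b\<in>B. nat (n b)) F" "homogeneous (\<Sum>b\<in>B. nat (n b)) G"
    using hom[of "\<lambda>b. nat (n b)"] hom[of "\<lambda>b. nat (- n b)"] by (simp_all add: F_def G_def)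
  moreover have "eval G (torus_map z) \<noteq> 0 \<and> z i = eval F (torus_map z) / eval G (torus_map z)"
    if z: "z \<in> torus CARD('j)" for z
  proof
    show "eval G (torus_map z) \<noteq> 0"
      using finite_B by (simp add: G_def eval_L_torus_map[OF z] monomial_nz[OF z])
    have "z i = (\<Prod>b\<in>B. eval (L b) (torus_map z) powi n b)"
      using torus_coordinate[OF z n(2)] by (simp add: monomial_axis j)
    then show "z i = eval F (torus_map z) / eval G (torus_map z)"
      by (simp add: powi_eq_nat_quotient prod_dividef F_def G_def)
  qed
  ultimately show ?thesis by blast
qed

text \<open>The positive and negative parts of the relation are monomials in the \<open>L b\<close>
  with the same image under \<open>\<Phi>\<close>, hence equal on \<open>V\<close>.\<close>

lemma binomial_relation:
  assumes x: "x \<in> V" and nz: "\<And>b. b \<in> B \<Longrightarrow> eval (L b) x \<noteq> 0"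
    and k: "(\<Sum>b\<in>B. k b) = (0::int)" "(\<Sum>b\<in>B. k b *s snd b) = 0"
  shows "(\<Prod>b\<in>B. eval (L b) x powi k b) = 1"
proof -
  have \<Phi>_monomial: "\<Phi> (\<Prod>b\<in>B. L b ^ m b) = single (msum m) 1" for m
  proof -
    have "\<Phi> (\<Prod>b\<in>B. L b ^ m b) = (\<Prod>b\<in>B. single (nscale (m b) b) 1)"
      by (simp add: \<Phi>_L power_single_nscale)
    also have "(\<Prod>b\<in>X. single (nscale (m b) b) 1) =
        single (\<Sum>b\<in>X. nscale (m b) b) (1 :: complex)" if "finite X" for X
      using that by (induction X rule: finite_induct) (auto simp: mult_single)
    then have "(\<Prod>b\<in>B. single (nscale (m b) b) 1) = single (msum m) (1 :: complex)"
      using finite_B by (simp add: msum_def)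
    finally show ?thesis .
  qed
  have "msum (\<lambda>b. nat (k b)) = msum (\<lambda>b. nat (- k b))"
  proof (rule prod_eqI)
    have "int (\<Sum>b\<in>B. nat (k b)) - int (\<Sum>b\<in>B. nat (- k b)) = (\<Sum>b\<in>B. k b)"
      by (simp flip: sum_subtractf) (rule sum.cong, auto)
    then show "fst (msum (\<lambda>b. nat (k b))) = fst (msum (\<lambda>b. nat (- k b)))"
      by (simp add: k(1) fst_msum del: of_nat_sum)
    have "snd (msum (\<lambda>b. nat (k b))) - snd (msum (\<lambda>b. nat (- k b))) = (\<Sum>b\<in>B. k b *s snd b)"
      unfolding snd_msum sum_subtractf[symmetric] by (rule sum.cong) (auto simp: vec_eq_iff)
    then show "snd (msum (\<lambda>b. nat (k b))) = snd (msum (\<lambda>b. nat (- k b)))" by (simp add: k(2))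
  qed
  then have "eval (\<Prod>b\<in>B. L b ^ nat (k b)) x = eval (\<Prod>b\<in>B. L b ^ nat (- k b)) x"
    by (intro eval_cong[OF _ x]) (simp only: \<Phi>_monomial)
  then show ?thesis
    using nz finite_B by (simp add: powi_eq_nat_quotient prod_dividef)
qed

text \<open>Lattice relations for the unit vectors read off \<open>z\<close> from the values of the
  \<open>L b\<close> at \<open>x\<close>. Two relations for the same vector give the same value by
  \<open>binomial_relation\<close>, so \<open>x\<close> agrees with the torus point up to the factor
  \<open>c\<close>.\<close>

lemma in_torus_orbit:
  assumes x: "x \<in> V" and nz: "\<And>b. b \<in> B \<Longrightarrow> eval (L b) x \<noteq> 0"
  obtains z where "z \<in> torus CARD('j)" "proj_eq x (torus_map z)"
proof -
  define y where "y b = eval (L b) x" for b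
  have "\<forall>j :: 'j. \<exists>n. (\<Sum>b\<in>B. n b) = (0::int) \<and> (\<Sum>b\<in>B. n b *s snd b) = axis j 1"
    using lattice_relation by metis
  from choice[OF this] obtain n where
    n: "\<And>j :: 'j. (\<Sum>b\<in>B. n j b) = (0::int)" "\<And>j. (\<Sum>b\<in>B. n j b *s snd b) = axis j 1"
    by blast
  define z where "z i = (if i < CARD('j) then \<Prod>b\<in>B. y b powi n (inv_into UNIV idx i) b else 1)" for i
  have z: "z \<in> torus CARD('j)"
    using nz finite_B by (auto simp: torus_def z_def y_def)
  have z_idx: "z (idx j) = (\<Prod>b\<in>B. y b powi n j b)" for j
    by (simp add: z_def idx_less inv_into_f_f[OF inj_idx])
  obtain b0 where b0: "b0 \<in> B"
    using B_nonempty by blast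
  define c where "c = y b0 / monomial z (snd b0)"
  have y: "y b1 = c * monomial z (snd b1)" if b1: "b1 \<in> B" for b1
  proof -
    \<comment> \<open>Two relations for \<open>u\<close>: \<open>k\<close> is assembled from those
      of the unit vectors, and \<open>e\<close> is the evident one with \<open>b1\<close> and
      \<open>b0\<close>. Their difference is a binomial relation.\<close>
    define u where "u = snd b1 - snd b0"
    define k where "k b = (\<Sum>j\<in>UNIV. n j b * u $ j)" for b
    define e where "e b = (if b = b1 then 1 else 0) - (if b = b0 then 1 else 0 :: int)" for b
    have "monomial z u = (\<Prod>j\<in>UNIV. \<Prod>b\<in>B. y b powi (n j b * u $ j))"
      by (simp add: monomial_def z_idx prod_powi power_int_mult)
    also have "\<dots> = (\<Prod>b\<in>B. \<Prod>j\<in>UNIV. y b powi (n j b * u $ j))" by (rule prod.swap)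
    also have "\<dots> = (\<Prod>b\<in>B. y b powi k b)"
      using nz unfolding k_def by (intro prod.cong) (auto simp: prod_powi_sum_exponents y_def)
    finally have mono: "monomial z u = (\<Prod>b\<in>B. y b powi k b)" .
    have "(\<Sum>b\<in>B. k b) = 0"
      unfolding k_def by (subst sum.swap) (simp add: n(1) flip: sum_distrib_right)
    moreover have "(\<Sum>b\<in>B. k b *s snd b) = u"
    proof -
      have "(\<Sum>b\<in>B. k b *s snd b) = (\<Sum>j\<in>UNIV. u $ j *s (\<Sum>b\<in>B. n j b *s snd b))"
        unfolding k_def vec_eq_iff
        by (simp add: sum_distrib_right sum_distrib_left mult_ac) (intro allI sum.swap)
      also have "\<dots> = u"
        unfolding n(2) by (rule vec_sum_axis[symmetric])
      finally show ?thesis .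
    qed
    moreover have "(\<Sum>b\<in>B. e b) = 0" "(\<Sum>b\<in>B. e b *s snd b) = u"
      using b0 b1 finite_B
      by (simp_all add: e_def u_def sum_subtractf vec_eq_iff left_diff_distrib if_distrib[of "\<lambda>x. x * _"] cong: if_cong)
    ultimately have "(\<Prod>b\<in>B. eval (L b) x powi (e b - k b)) = 1"
      by (intro binomial_relation[OF x nz]) (auto simp: sum_subtractf vec_eq_iff left_diff_distrib)
    then have "(\<Prod>b\<in>B. y b powi e b) = (\<Prod>b\<in>B. y b powi k b)"
      using nz finite_B by (simp add: power_int_diff prod_dividef y_def)
    moreover have "(\<Prod>b\<in>B. y b powi e b) = y b1 / y b0"
    proof -
      have "(\<Prod>b\<in>B. y b powi e b) = (\<Prod>b\<in>B. (if b = b1 then y b1 else 1) / (if b = b0 then y b0 else 1))"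
        using nz by (intro prod.cong) (auto simp: e_def y_def inverse_eq_divide)
      also have "\<dots> = y b1 / y b0"
        using b0 b1 finite_B by (simp add: prod_dividef)
      finally show ?thesis .
    qed
    ultimately have "y b1 / y b0 = monomial z u"
      using mono by simp
    moreover have "monomial z (snd b1) = monomial z u * monomial z (snd b0)"
      by (simp add: u_def flip: monomial_add[OF z])
    ultimately show ?thesis
      using nz[OF b0] monomial_nz[OF z, of "snd b0"] by (simp add: c_def y_def field_simps)
  qed
  have "c \<noteq> 0"
    using nz[OF b0] monomial_nz[OF z] by (simp add: c_def y_def)
  moreover have "x = c *s torus_map z"
    using coordinates[OF x] torus_map_nth[OF z] y
    by (simp add: vec_eq_iff y_def sum_distrib_left mult_ac)
  ultimately show ?thesis
    using z that by (auto simp: proj_eq_def)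
qed

text \<open>The orbit consists of the points of \<open>V\<close> at which no \<open>L b\<close>
  vanishes, so the product of the \<open>L b\<close> cuts out its complement.\<close>

lemma boundary_closed: "proj_closed {x\<in>V. \<forall>z\<in>torus CARD('j). \<not> proj_eq x (torus_map z)}"
proof -
  have "x \<in> {x\<in>V. \<forall>z\<in>torus CARD('j). \<not> proj_eq x (torus_map z)} \<longleftrightarrow>
      x \<in> zero_locus ({F\<in>I. \<exists>k. homogeneous k F} \<union> {\<Prod>b\<in>B. L b})" for x
  proof -
    have "(\<forall>z\<in>torus CARD('j). \<not> proj_eq x (torus_map z)) \<longleftrightarrow> (\<Prod>b\<in>B. eval (L b) x) = 0" if x: "x \<in> V"
    proof
      assume "(\<Prod>b\<in>B. eval (L b) x) = 0"
      then obtain b where b: "b \<in> B" "eval (L b) x = 0"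
        using finite_B by auto
      show "\<forall>z\<in>torus CARD('j). \<not> proj_eq x (torus_map z)"
      proof (intro ballI notI)
        fix z assume z: "z \<in> torus CARD('j)" "proj_eq x (torus_map z)"
        then obtain c where "c \<noteq> 0" "x = c *s torus_map z"
          by (auto simp: proj_eq_def)
        then show False
          using b eval_scale[OF homogeneous_L[OF b(1)], of c "torus_map z"]
            eval_L_torus_map[OF z(1) b(1)] monomial_nz[OF z(1), of "snd b"] by simp
      qed
    next
      assume *: "\<forall>z\<in>torus CARD('j). \<not> proj_eq x (torus_map z)"
      show "(\<Prod>b\<in>B. eval (L b) x) = 0"
      proof (rule ccontr)
        assume "(\<Prod>b\<in>B. eval (L b) x) \<noteq> 0"
        then have "\<And>b. b \<in> B \<Longrightarrow> eval (L b) x \<noteq> 0"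
          using finite_B by auto
        then show False
          using in_torus_orbit[OF x] * by metis
      qed
    qed
    moreover have "x \<in> zero_locus ({F\<in>I. \<exists>k. homogeneous k F} \<union> {\<Prod>b\<in>B. L b}) \<longleftrightarrow>
        x \<in> V \<and> (\<Prod>b\<in>B. eval (L b) x) = 0"
      unfolding mem_V_iff zero_locus_def by auto
    ultimately show ?thesis by blast
  qed
  moreover have "\<exists>k. homogeneous k (\<Prod>b\<in>B. L b)"
    using homogeneous_prod[of B "\<lambda>_. 1" L] homogeneous_L by blast
  ultimately show ?thesis
    unfolding proj_closed_def
    by (intro exI[of _ "{F\<in>I. \<exists>k. homogeneous k F} \<union> {\<Prod>b\<in>B. L b}"]) auto
qed

section \<open>The torus action on the whole variety\<close>

definition twisted :: "(nat \<Rightarrow> complex) \<Rightarrow> ('p, complex) mpoly \<Rightarrow> ('p, complex) mpoly" where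
  "twisted z = eval_with Const (\<lambda>i. \<Sum>b\<in>B. Const (coef i b * monomial z (snd b)) * L b)"

lemma eval_twisted: "eval (twisted z F) x = eval F (action z x)"
proof -
  have "eval (twisted z F) x = eval_with (\<lambda>c. eval (Const c) x)
      (\<lambda>i. eval (\<Sum>b\<in>B. Const (coef i b * monomial z (snd b)) * L b) x) F"
    unfolding twisted_def by (rule eval_with_comp[OF ring_map_single_0 ring_map_eval])
  moreover have "($) (action z x) = (\<lambda>i. \<Sum>b\<in>B. coef i b * monomial z (snd b) * eval (L b) x)"
    by (simp add: action_def fun_eq_iff)
  ultimately show ?thesis by simp
qed

text \<open>\<open>twisted z\<close> is the pullback along \<open>action z\<close>. On the semigroup
  algebra it merely scales each exponent by a monomial in \<open>z\<close>, so it preserves the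
  kernel of \<open>\<Phi>\<close>, and the action preserves \<open>V\<close>.\<close>

lemma \<Phi>_twisted:
  assumes z: "z \<in> torus CARD('j)"
  shows "\<Phi> (twisted z F) = lift_char (single 0) (\<lambda>s. single s (monomial z (snd s))) (\<Phi> F)"
    (is "_ = ?tw (\<Phi> F)")
proof -
  have tw: "ring_map ?tw"
    using torus_character_monomial[OF z]
    by (intro ring_map_lift_char ring_map_single_0) (auto simp: character_def mult_single torus_character_def)
  have "\<Phi> (twisted z F) = eval_with (\<lambda>c. \<Phi> (Const c))
      (\<lambda>i. \<Phi> (\<Sum>b\<in>B. Const (coef i b * monomial z (snd b)) * L b)) F"
    unfolding twisted_def by (rule eval_with_comp[OF ring_map_single_0 \<Phi>_ring_map])
  also have "(\<lambda>i. \<Phi> (\<Sum>b\<in>B. Const (coef i b * monomial z (snd b)) * L b)) = (\<lambda>i. ?tw (g i))"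
  proof
    fix i
    have "?tw (g i) = (\<Sum>b\<in>B. single 0 (coef i b) * single b (monomial z (snd b)))"
      by (rule lift_char_superset) (auto simp: finite_B B_eq)
    then show "\<Phi> (\<Sum>b\<in>B. Const (coef i b * monomial z (snd b)) * L b) = ?tw (g i)"
      by (simp add: \<Phi>_L mult_single)
  qed
  also have "(\<lambda>c. \<Phi> (Const c)) = (\<lambda>c. ?tw (single 0 c))"
    by (simp add: fun_eq_iff lift_char_single ring_map_single_0)
  also have "eval_with (\<lambda>c. ?tw (single 0 c)) (\<lambda>i. ?tw (g i)) F = ?tw (\<Phi> F)"
    by (rule eval_with_comp[OF ring_map_single_0 tw, symmetric])
  finally show ?thesis .
qed

lemma eval_L_action:
  assumes "z \<in> torus CARD('j)" "x \<in> V" "b \<in> B"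
  shows "eval (L b) (action z x) = monomial z (snd b) * eval (L b) x"
proof -
  have "eval (twisted z (L b)) x = eval (Const (monomial z (snd b)) * L b) x"
    by (rule eval_cong[OF _ assms(2)])
       (simp add: \<Phi>_twisted[OF assms(1)] \<Phi>_L[OF assms(3)] lift_char_single ring_map_single_0 mult_single)
  then show ?thesis by (simp add: eval_twisted)
qed

lemma action_in_V:
  assumes z: "z \<in> torus CARD('j)" and x: "x \<in> V"
  shows "action z x \<in> V"
proof -
  obtain b where b: "b \<in> B" "eval (L b) x \<noteq> 0"
    using some_L_nonzero[OF x] by blast
  have "eval (L b) (action z x) \<noteq> 0"
    using b monomial_nz[OF z] by (simp add: eval_L_action[OF z x])
  then have "action z x \<noteq> 0"
    using eval_zero[OF homogeneous_L[OF b(1)]] by auto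
  moreover have "eval F (action z x) = 0" if "F \<in> I" for F
  proof -
    have "\<Phi> (twisted z F) = \<Phi> 0"
      using that by (simp add: \<Phi>_twisted[OF z] I_def lift_char_def)
    from eval_cong[OF this x] show ?thesis
      by (simp add: eval_twisted)
  qed
  ultimately show ?thesis by (simp add: V_def zero_locus_def)
qed

lemma regular_action: "regular_on_product CARD('j) V action"
  unfolding regular_on_product_def
proof (intro ballI)
  fix z x assume z: "z \<in> torus CARD('j)" and x: "x \<in> V"
  define T where "T b = eval_with Const (\<lambda>i. Var (Inl i)) (shifted_monomial shift (snd b)) *
    (eval_with Const (\<lambda>i. Var (Inr i)) (L b) :: (nat + 'p, complex) mpoly)" for b
  define F where "F i = (\<Sum>b\<in>B. Const (coef i b) * T b)" for i
  \<comment> \<open>Only homogeneous coordinates are counted: the torus factor of \<open>T b\<close>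
    has degree zero and \<open>L b\<close> contributes degree one.\<close>
  let ?deg = "\<lambda>e :: nat + 'p \<Rightarrow>\<^sub>0 nat. \<Sum>j\<in>UNIV. lookup e (Inr j)"
  interpret product_forms: nat_graded_exponents "\<lambda>k. {e. ?deg e = k}"
    by unfold_locales (auto simp: lookup_add sum.distrib)
  have ev: "eval_with (\<lambda>c. c) (case_sum z' (($) x')) (F i) = scaling z' * action z' x' $ i"
    if "z' \<in> torus CARD('j)" for z' x' i
  proof -
    note ev = ring_map_eval[of "case_sum z' (($) x')"]
    have "eval_with (\<lambda>c. c) (case_sum z' (($) x')) (T b) = scaling z' * monomial z' (snd b) * eval (L b) x'"
      if "b \<in> B" for b
      unfolding T_def
      by (simp add: ring_map_mult[OF ev] eval_with_comp[OF ring_map_single_0 ev]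
          eval_with_Const[OF ring_map_id] eval_with_Var[OF ring_map_id]
          eval_shifted_monomial_B[OF \<open>z' \<in> torus CARD('j)\<close> that])
    then show ?thesis by (simp add: F_def action_def ring_map_sum[OF ev] ring_map_mult[OF ev]
          eval_with_Const[OF ring_map_id] sum_distrib_left mult_ac)
  qed
  have "\<forall>i. \<forall>e\<in>keys (F i). ?deg e = 1"
  proof -
    have "product_forms.piece 0 (eval_with Const (\<lambda>i. Var (Inl i)) (shifted_monomial shift (snd b)))" for b :: "nat \<times> (int ^ 'j)"
    proof -
      have v: "product_forms.piece 0 (Var (Inl i) :: (nat + 'p, complex) mpoly)" for i
        by (simp add: Var_def lookup_single)
      have "product_forms.piece 0 ((Var (Inl i) :: (nat + 'p, complex) mpoly) ^ m)" for i m
        using product_forms.piece_power[OF v[of i], of m] by simp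
      then have "product_forms.piece (\<Sum>j\<in>(UNIV :: 'j set). 0)
          (\<Prod>j\<in>UNIV. (Var (Inl (idx j)) :: (nat + 'p, complex) mpoly) ^ nat (snd b $ j + int shift))"
        by (intro product_forms.piece_prod)
      then show ?thesis
        unfolding shifted_monomial_def
        by (simp add: ring_map_prod[OF ring_map_eval_with[OF ring_map_single_0]]
          ring_map_power[OF ring_map_eval_with[OF ring_map_single_0]] eval_with_Var[OF ring_map_single_0])
    qed
    moreover have "product_forms.piece 1 (eval_with Const (\<lambda>i. Var (Inr i)) (L b))" if "b \<in> B" for b
      by (rule eval_with_piece[OF _ _ homogeneous_L[OF that]])
         (auto simp: Var_def lookup_single when_def product_forms.graded_exponents_axioms)
    ultimately have "product_forms.piece (0 + (0 + 1)) (Const (coef i b) * T b)" if "b \<in> B" for b i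
      unfolding T_def using that by (intro product_forms.piece_mult) (auto simp: lookup_single)
    then have "product_forms.piece 1 (F i)" for i
      unfolding F_def by (intro product_forms.piece_sum) simp
    then show ?thesis by blast
  qed
  moreover have "\<exists>i. eval_with (\<lambda>c. c) (case_sum z (($) x)) (F i) \<noteq> 0"
    using V_nonzero[OF action_in_V[OF z x]] scaling_nz[OF z] by (auto simp: ev[OF z])
  moreover have "proj_eq (action z' x') (\<chi> i. eval_with (\<lambda>c. c) (case_sum z' (($) x')) (F i))"
    if "z' \<in> torus CARD('j)" for z' x'
    using scaling_nz[OF that] by (intro proj_eqI_scale[of "scaling z'"]) (auto simp: ev[OF that])
  ultimately show "\<exists>k (F :: 'p \<Rightarrow> (nat + 'p, complex) mpoly).
     (\<forall>i. \<forall>e\<in>keys (F i). ?deg e = k) \<and>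
     (\<exists>i. eval_with (\<lambda>c. c) (case_sum z (($) x)) (F i) \<noteq> 0) \<and>
     (\<forall>z'\<in>torus CARD('j). \<forall>x'\<in>V. (\<exists>i. eval_with (\<lambda>c. c) (case_sum z' (($) x')) (F i) \<noteq> 0) \<longrightarrow>
        proj_eq (action z' x') (\<chi> i. eval_with (\<lambda>c. c) (case_sum z' (($) x')) (F i)))"
    by (intro exI[of _ 1] exI[of _ F]) blast
qed

lemma action_one: "x \<in> V \<Longrightarrow> action (\<lambda>_. 1) x = x"
  using coordinates[of x] by (simp add: action_def vec_eq_iff)

lemma action_mult:
  "z \<in> torus CARD('j) \<Longrightarrow> z' \<in> torus CARD('j) \<Longrightarrow> x \<in> V \<Longrightarrow> action (\<lambda>i. z i * z' i) x = action z (action z' x)"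
  by (simp add: action_def[of "\<lambda>i. z i * z' i"] action_def[of z] vec_eq_iff eval_L_action monomial_mult mult_ac)

lemma action_torus_map:
  "z \<in> torus CARD('j) \<Longrightarrow> z' \<in> torus CARD('j) \<Longrightarrow> action z (torus_map z') = torus_map (\<lambda>i. z i * z' i)"
  by (simp add: action_def vec_eq_iff torus_map_nth[OF torus_mult] eval_L_torus_map monomial_mult mult_ac)

lemma toric_structure_V: "toric_structure V CARD('j) torus_map action"
  unfolding toric_structure_def
proof (intro conjI)
  show "\<forall>i<CARD('j). \<forall>z\<in>torus CARD('j). \<exists>k F G. homogeneous k F \<and> homogeneous k G \<and> eval G (torus_map z) \<noteq> 0 \<and>
      (\<forall>z'\<in>torus CARD('j). eval G (torus_map z') \<noteq> 0 \<longrightarrow> z' i = eval F (torus_map z') / eval G (torus_map z'))"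
    using torus_coordinate_rational by blast
qed (use torus_map_in_V regular_torus_map torus_map_inj boundary_closed action_in_V regular_action in
    \<open>auto simp: action_one action_mult action_torus_map proj_eq_refl\<close>)

theorem normal_toric_variety_I: "normal_toric_variety I"
  using vanishing_ideal_V proj_variety_V toric_structure_V normal_V
  unfolding normal_toric_variety_def toric_variety_def V_def by blast

end

section \<open>Tropical mutations of lattice points and polytopes\<close>

text \<open>One linear branch of a mutation, over any commutative ring so that integer and real
  vectors are treated alike.\<close>

definition shear :: "('j \<Rightarrow> int) \<Rightarrow> 'j \<Rightarrow> 'a::comm_ring_1 ^ 'j \<Rightarrow> 'a ^ 'j" where
  "shear a k u = (\<chi> j. if j = k then - (u $ k) else u $ j + of_int (a j) * u $ k)"

text \<open>The transpose of \<open>shear\<close>. It acts on dual polytopes and also describes how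
  coefficients change when a seed is mutated.\<close>

definition coshear :: "('j::finite \<Rightarrow> int) \<Rightarrow> 'j \<Rightarrow> 'a::comm_ring_1 ^ 'j \<Rightarrow> 'a ^ 'j" where
  "coshear a k w = (\<chi> j. if j = k then - (w $ k) + (\<Sum>i\<in>UNIV - {k}. of_int (a i) * w $ i) else w $ j)"

lemma shear_shear: "shear a k (shear a k u) = u"
  by (simp add: shear_def vec_eq_iff)

lemma coshear_coshear: "coshear a k (coshear a k w) = w"
  by (simp add: coshear_def vec_eq_iff)

lemma inner_shear: "shear a k u \<bullet> w = u \<bullet> coshear a k (w :: real ^ 'j::finite)"
proof -
  have "(\<Sum>j\<in>UNIV. shear a k u $ j * w $ j) = (\<Sum>j\<in>UNIV. u $ j * coshear a k w $ j)"
    unfolding sum.remove[OF finite_class.finite_UNIV UNIV_I, of _ k]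
    by (simp add: shear_def coshear_def sum.distrib algebra_simps sum_distrib_left)
  then show ?thesis by (simp add: inner_vec_def)
qed

lemma real_vec_coshear: "real_vec (coshear a k u) = coshear a k (real_vec u)"
  by (simp add: real_vec_def coshear_def vec_eq_iff)

lemma coshear_scaleR: "coshear a k (c *\<^sub>R u) = c *\<^sub>R coshear a k (u :: real ^ 'j::finite)"
  by (simp add: coshear_def vec_eq_iff algebra_simps sum_distrib_left)

lemma coshear_0 [simp]: "coshear a k 0 = 0"
  by (simp add: coshear_def vec_eq_iff)

text \<open>\<open>coshear\<close> is an involution with integer entries, so a common divisor of the
  new coordinates divides the old ones.\<close>

lemma primitive_coshear:
  assumes "primitive_vector (x :: real ^ 'j::finite)"
  shows "primitive_vector (coshear a k x)"
proof -
  obtain u where u: "x = real_vec u" "Gcd (range (($) u)) = 1"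
    using assms by (auto simp: primitive_vector_def)
  define g where "g = Gcd (range (($) (coshear a k u)))"
  have g: "g dvd coshear a k u $ j" for j
    by (simp add: g_def)
  have "g dvd coshear a k (coshear a k u) $ j" for j
    unfolding coshear_def[of a k "coshear a k u"]
    using g by (auto intro!: dvd_diff dvd_sum dvd_mult)
  then have "g dvd Gcd (range (($) u))"
    unfolding coshear_coshear by (intro Gcd_greatest) auto
  then have "g = 1"
    using u(2) by (simp add: g_def)
  then show ?thesis
    unfolding primitive_vector_def u(1)
    by (intro exI[of _ "coshear a k u"]) (simp add: real_vec_coshear g_def)
qed

lemma shear_nth_k: "shear a k u $ k = - (u $ k)"
  by (simp add: shear_def)

text \<open>The tropical mutation for an integer row \<open>E\<close>, on lattice points and real
  points alike. The two branches agree on the wall.\<close>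

definition mutation :: "('j \<Rightarrow> int) \<Rightarrow> 'j \<Rightarrow> 'a::linordered_idom ^ 'j \<Rightarrow> 'a ^ 'j" where
  "mutation E k u = shear (\<lambda>j. max (if u $ k \<ge> 0 then E j else - E j) 0) k u"

lemma mutation_pos: "u $ k \<ge> 0 \<Longrightarrow> mutation E k u = shear (\<lambda>j. max (E j) 0) k u"
  by (simp add: mutation_def)

lemma mutation_neg: "u $ k \<le> 0 \<Longrightarrow> mutation E k u = shear (\<lambda>j. max (- E j) 0) k u"
  by (cases "u $ k = 0") (auto simp: mutation_def shear_def vec_eq_iff)

lemma mutation_nth_k: "mutation E k u $ k = - (u $ k)"
  by (simp add: mutation_def shear_def)

text \<open>The mutation reverses the sign of coordinate \<open>k\<close> and negating
  \<open>E\<close> exchanges the branches, so the same shear is applied twice.\<close>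

lemma mutation_inverse: "mutation (\<lambda>j. - E j) k (mutation E k u) = u"
proof (cases "u $ k \<ge> 0")
  case True
  then show ?thesis
    using mutation_neg[of "mutation E k u" k "\<lambda>j. - E j"]
    by (simp add: shear_nth_k mutation_pos shear_shear)
next
  case False
  then show ?thesis
    using mutation_pos[of "mutation E k u" k "\<lambda>j. - E j"]
    by (simp add: shear_nth_k mutation_neg shear_shear)
qed

lemma mutation_inverse': "mutation E k (mutation (\<lambda>j. - E j) k u) = u"
  using mutation_inverse[of "\<lambda>j. - E j" k u] by simp

lemma mutation_scale:
  assumes "c \<ge> 0"
  shows "mutation E k (c *s u) = c *s mutation E k u"
proof (cases "u $ k \<ge> 0")
  case True
  then show ?thesis
    using assms by (simp add: mutation_pos) (simp add: shear_def vec_eq_iff algebra_simps)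
next
  case False
  then have "(c *s u) $ k \<le> 0"
    using assms by (simp add: mult_nonneg_nonpos)
  then show ?thesis
    using False by (simp add: mutation_neg) (simp add: shear_def vec_eq_iff algebra_simps)
qed

lemma mutation_scaleR: "c \<ge> 0 \<Longrightarrow> mutation E k (c *\<^sub>R u) = c *\<^sub>R mutation E k (u :: real ^ 'j)"
  using mutation_scale[of c E k u] by (simp add: scalar_mult_eq_scaleR)

lemma real_vec_mutation: "real_vec (mutation E k u) = mutation E k (real_vec u)"
  by (auto simp: mutation_def shear_def real_vec_def vec_eq_iff)

lemma mutation_translate:
  fixes c x :: "real ^ 'j"
  assumes "c $ k = 0 \<or> (\<forall>j. j \<noteq> k \<longrightarrow> E j = 0)"
  shows "mutation E k x - mutation E k c = mutation E k (x - c)"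
  using assms by (auto simp: mutation_def shear_def vec_eq_iff algebra_simps)

lemma continuous_on_mutation: "continuous_on A (mutation E k :: real ^ 'j \<Rightarrow> real ^ 'j)"
proof -
  have "mutation E k u = (\<chi> j. if j = k then - (u $ k) else
      u $ j + of_int (max (E j) 0) * max (u $ k) 0 + of_int (max (- E j) 0) * min (u $ k) 0)" for u :: "real ^ 'j"
    by (auto simp: mutation_def shear_def vec_eq_iff)
  moreover have "continuous_on A (\<lambda>u :: real ^ 'j. if j = k then - (u $ k) else
      u $ j + of_int (max (E j) 0) * max (u $ k) 0 + of_int (max (- E j) 0) * min (u $ k) 0)" for j
    by (cases "j = k") (auto intro!: continuous_intros)
  ultimately show ?thesis by (simp add: continuous_on_vec_lambda cong: continuous_on_cong)
qed

lemma mutation_image_eq_vimage: "mutation E k ` A = mutation (\<lambda>j. - E j) k -` A"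
  by (force simp: mutation_inverse mutation_inverse' image_iff intro: bexI[of _ "mutation (\<lambda>j. - E j) k _"])

lemma mutation_interior:
  fixes P :: "(real ^ 'j) set"
  assumes "c \<in> interior P"
  shows "mutation E k c \<in> interior (mutation E k ` P)"
proof -
  have "open (mutation E k ` interior P)"
    unfolding mutation_image_eq_vimage
    by (rule open_vimage[OF open_interior continuous_on_mutation])
  moreover have "mutation E k ` interior P \<subseteq> mutation E k ` P"
    by (intro image_mono interior_subset)
  ultimately show ?thesis
    using assms interior_maximal by blast
qed

lemma mutation_closure: "mutation E k ` closure A = closure (mutation E k ` (A :: (real ^ 'j) set))"
proof
  show "mutation E k ` closure A \<subseteq> closure (mutation E k ` A)"
    by (rule image_closure_subset[OF continuous_on_mutation]) (auto intro: closure_subset[THEN subsetD])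
  have "mutation (\<lambda>j. - E j) k ` closure (mutation E k ` A) \<subseteq> closure A"
    by (rule image_closure_subset[OF continuous_on_mutation])
       (auto simp: mutation_inverse intro: closure_subset[THEN subsetD])
  then show "closure (mutation E k ` A) \<subseteq> mutation E k ` closure A"
    unfolding mutation_image_eq_vimage[of E k "closure A"] by auto
qed

section \<open>Polar duals\<close>

lemma convex_polar_dual: "convex (polar_dual P)"
  unfolding polar_dual_def convex_alt
proof (intro ballI allI impI CollectI)
  fix x y t u assume *: "x \<in> {v. \<forall>u\<in>P. u \<bullet> v + 1 \<ge> 0}" "y \<in> {v. \<forall>u\<in>P. u \<bullet> v + 1 \<ge> 0}"
    "(0::real) \<le> t \<and> t \<le> 1" "u \<in> P"
  have "u \<bullet> ((1 - t) *\<^sub>R x + t *\<^sub>R y) + 1 = (1 - t) * (u \<bullet> x + 1) + t * (u \<bullet> y + 1)"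
    by (simp add: inner_right_distrib algebra_simps)
  also have "\<dots> \<ge> 0" by (rule add_nonneg_nonneg; rule mult_nonneg_nonneg) (use * in auto)
  finally show "u \<bullet> ((1 - t) *\<^sub>R x + t *\<^sub>R y) + 1 \<ge> 0" .
qed

lemma compact_polar_dual:
  fixes P :: "(real ^ 'j::finite) set"
  assumes "0 \<in> interior P"
  shows "compact (polar_dual P)"
proof -
  have "x + 1 \<ge> 0 \<longleftrightarrow> x \<ge> - 1" for x :: real
    by linarith
  then have "polar_dual P = (\<Inter>u\<in>P. {v. u \<bullet> v \<ge> - 1})" by (auto simp: polar_dual_def)
  then have "closed (polar_dual P)" by (auto intro: closed_halfspace_ge)
  moreover obtain e where e: "e > 0" "cball 0 e \<subseteq> P"
    using assms by (auto simp: mem_interior_cball)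
  have "norm v \<le> 1 / e" if v: "v \<in> polar_dual P" for v
  proof (cases "v = 0")
    case False
    \<comment> \<open>Testing \<open>v\<close> against the opposite point of a small ball in
      \<open>P\<close> bounds its norm.\<close>
    have "- (e / norm v) *\<^sub>R v \<in> P"
      using e False by (intro subsetD[OF e(2)]) auto
    then have "- (e / norm v) *\<^sub>R v \<bullet> v + 1 \<ge> 0"
      using v unfolding polar_dual_def by blast
    then have "e * norm v \<le> 1"
      using False by (simp add: power2_norm_eq_inner[symmetric] power2_eq_square)
    then show ?thesis
      using e(1) by (simp add: field_simps)
  qed (use e in auto)
  then have "bounded (polar_dual P)" by (auto simp: bounded_iff)
  ultimately show ?thesis by (simp add: compact_eq_bounded_closed)
qed

lemma polar_dual_convex_hull: "polar_dual (convex hull A) = polar_dual A"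
proof
  show "polar_dual (convex hull A) \<subseteq> polar_dual A"
    by (auto simp: polar_dual_def intro: hull_inc)
  show "polar_dual A \<subseteq> polar_dual (convex hull A)"
  proof
    fix v assume v: "v \<in> polar_dual A"
    have "convex hull A \<subseteq> {u. v \<bullet> u \<ge> - 1}"
      using v by (intro hull_minimal convex_halfspace_ge) (auto simp: polar_dual_def inner_commute algebra_simps)
    then show "v \<in> polar_dual (convex hull A)" by (force simp: polar_dual_def inner_commute)
  qed
qed

text \<open>At a vertex the active constraints span the space. Otherwise a direction orthogonal to
  them could be followed a little both ways, since the finitely many inactive constraints leave
  room.\<close>

lemma extreme_polar_dual_active:
  fixes A :: "(real ^ 'j::finite) set"
  assumes "finite A" and v: "v extreme_point_of polar_dual A"
    and y: "\<And>a. a \<in> A \<Longrightarrow> a \<bullet> v = - 1 \<Longrightarrow> a \<bullet> y = 0"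
  shows "y = 0"
proof (rule ccontr)
  assume "y \<noteq> 0"
  have v_polar: "v \<in> polar_dual A"
    using v by (simp add: extreme_point_of_def)
  have "\<exists>\<delta>>0. \<forall>a\<in>A. \<delta> * \<bar>a \<bullet> y\<bar> \<le> a \<bullet> v + 1"
    using assms(1) v_polar y
  proof (induction A)
    case (insert a A)
    obtain \<delta> where \<delta>: "\<delta> > 0" "\<forall>a\<in>A. \<delta> * \<bar>a \<bullet> y\<bar> \<le> a \<bullet> v + 1"
      using insert by (auto simp: polar_dual_def)
    have slack: "a \<bullet> v + 1 > 0" if "a \<bullet> y \<noteq> 0"
      using insert.prems that by (force simp: polar_dual_def)
    define \<delta>' where "\<delta>' = (if a \<bullet> y = 0 then \<delta> else min \<delta> ((a \<bullet> v + 1) / \<bar>a \<bullet> y\<bar>))"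
    have "\<delta>' > 0" "\<delta>' \<le> \<delta>"
      using \<delta>(1) slack by (auto simp: \<delta>'_def)
    moreover have "\<delta>' * \<bar>a \<bullet> y\<bar> \<le> a \<bullet> v + 1"
    proof (cases "a \<bullet> y = 0")
      case False
      then have "\<delta>' * \<bar>a \<bullet> y\<bar> \<le> (a \<bullet> v + 1) / \<bar>a \<bullet> y\<bar> * \<bar>a \<bullet> y\<bar>"
        by (intro mult_right_mono) (auto simp: \<delta>'_def)
      then show ?thesis
        using False by simp
    qed (use insert.prems in \<open>auto simp: polar_dual_def\<close>)
    moreover have "\<delta>' * \<bar>b \<bullet> y\<bar> \<le> b \<bullet> v + 1" if "b \<in> A" for b
      using \<delta>(2) that mult_right_mono[OF \<open>\<delta>' \<le> \<delta>\<close>, of "\<bar>b \<bullet> y\<bar>"] by force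
    ultimately show ?case by auto
  qed (auto intro: exI[of _ 1])
  then obtain \<delta> where \<delta>: "\<delta> > 0" "\<And>a. a \<in> A \<Longrightarrow> \<delta> * \<bar>a \<bullet> y\<bar> \<le> a \<bullet> v + 1"
    by blast
  have "v + \<delta> *\<^sub>R y \<in> polar_dual A" "v - \<delta> *\<^sub>R y \<in> polar_dual A"
    using \<delta> by (auto simp: polar_dual_def inner_add_right inner_diff_right abs_if split: if_splits dest!: \<delta>(2))
       (smt (verit) mult_minus_right mult_nonneg_nonneg mult_nonneg_nonpos)+
  moreover have "v \<in> open_segment (v + \<delta> *\<^sub>R y) (v - \<delta> *\<^sub>R y)"
  proof -
    have "v = midpoint (v + \<delta> *\<^sub>R y) (v - \<delta> *\<^sub>R y)"
      by (simp add: midpoint_def scaleR_add_right scaleR_diff_right flip: scaleR_add_left)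
    moreover have "v + \<delta> *\<^sub>R y \<noteq> v - \<delta> *\<^sub>R y"
    proof
      assume "v + \<delta> *\<^sub>R y = v - \<delta> *\<^sub>R y"
      then have "(2 * \<delta>) *\<^sub>R y = 0"
        by (simp add: algebra_simps scaleR_2 eq_neg_iff_add_eq_0 flip: scaleR_scaleR)
      then show False
        using \<open>y \<noteq> 0\<close> \<delta>(1) by simp
    qed
    ultimately show ?thesis
      using midpoint_in_open_segment by metis
  qed
  ultimately show False
    using v by (auto simp: extreme_point_of_def)
qed

text \<open>A constraint that is active inside a segment is active at both ends, so the direction of
  the segment is orthogonal to all active constraints.\<close>

lemma active_imp_extreme_polar_dual:
  fixes Q :: "(real ^ 'j::finite) set"
  assumes w: "w \<in> polar_dual Q"
    and active: "\<And>y. (\<And>q. q \<in> Q \<Longrightarrow> q \<bullet> w = - 1 \<Longrightarrow> q \<bullet> y = 0) \<Longrightarrow> y = 0"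
  shows "w extreme_point_of polar_dual Q"
  unfolding extreme_point_of_def
proof (intro conjI w ballI notI)
  fix a b assume ab: "a \<in> polar_dual Q" "b \<in> polar_dual Q" "w \<in> open_segment a b"
  then obtain t where t: "0 < t" "t < 1" "w = (1 - t) *\<^sub>R a + t *\<^sub>R b" "a \<noteq> b"
    by (auto simp: in_segment)
  have "a - b = 0"
  proof (rule active)
    fix q assume q: "q \<in> Q" "q \<bullet> w = - 1"
    have "q \<bullet> a + 1 \<ge> 0" "q \<bullet> b + 1 \<ge> 0"
      using ab(1,2) q(1) by (auto simp: polar_dual_def)
    moreover have sum0: "(1 - t) * (q \<bullet> a + 1) + t * (q \<bullet> b + 1) = 0"
      using q(2) unfolding t(3) by (simp add: inner_add_right algebra_simps)
    ultimately have "(1 - t) * (q \<bullet> a + 1) = 0" "t * (q \<bullet> b + 1) = 0"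
      using t(1,2) by (smt (verit) mult_nonneg_nonneg)+
    then show "q \<bullet> (a - b) = 0"
      using t(1,2) by (simp add: inner_diff_right)
  qed
  then show False
    using t(4) by simp
qed

text \<open>Used to stay on one side of the wall along a segment: \<open>s\<close> is the coordinate
  at the start and \<open>t\<close> its total change. The witness
  \<open>\<bar>s\<bar> / (\<bar>s\<bar> + \<bar>t\<bar>)\<close> times \<open>\<bar>t\<bar>\<close>
  is below \<open>\<bar>s\<bar>\<close>.\<close>

lemma small_step:
  fixes s t :: real
  assumes "s \<noteq> 0"
  obtains \<delta> where "0 < \<delta>" "\<delta> \<le> 1" "s > 0 \<Longrightarrow> s + \<delta> * t > 0" "s < 0 \<Longrightarrow> s + \<delta> * t < 0"
proof
  have pos: "\<bar>s\<bar> + \<bar>t\<bar> > 0"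
    using assms by linarith
  show "0 < \<bar>s\<bar> / (\<bar>s\<bar> + \<bar>t\<bar>)"
    using assms pos by simp
  show "\<bar>s\<bar> / (\<bar>s\<bar> + \<bar>t\<bar>) \<le> 1"
    unfolding divide_le_eq_1_pos[OF pos] by simp
  have "\<bar>s\<bar> * \<bar>t\<bar> / (\<bar>s\<bar> + \<bar>t\<bar>) < \<bar>s\<bar>"
    unfolding pos_divide_less_eq[OF pos] using assms by (simp add: distrib_left zero_less_mult_iff linorder_neq_iff disj_commute)
  then have "\<bar>\<bar>s\<bar> / (\<bar>s\<bar> + \<bar>t\<bar>) * t\<bar> < \<bar>s\<bar>"
    using pos by (simp add: abs_mult)
  then show "s > 0 \<Longrightarrow> s + \<bar>s\<bar> / (\<bar>s\<bar> + \<bar>t\<bar>) * t > 0" "s < 0 \<Longrightarrow> s + \<bar>s\<bar> / (\<bar>s\<bar> + \<bar>t\<bar>) * t < 0"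
    by linarith+
qed

text \<open>A vertex \<open>v\<close> of the polar dual of the mutated polytope has an active constraint off the wall;
  on its side of the wall the mutation is a shear, whose transpose carries \<open>v\<close> to a vertex.\<close>

lemma extreme_polar_dual_mutation:
  fixes Q :: "(real ^ 'j::finite) set"
  assumes "convex Q" "finite A" and Q': "mutation E k ` Q = convex hull A"
    and v: "v extreme_point_of polar_dual (mutation E k ` Q)"
  obtains a where "a \<in> {(\<lambda>j. max (E j) 0), (\<lambda>j. max (- E j) 0)}"
    "coshear a k v extreme_point_of polar_dual Q"
proof -
  let ?T = "mutation E k :: real ^ 'j \<Rightarrow> real ^ 'j"
  have v': "v extreme_point_of polar_dual A"
    using v unfolding Q' polar_dual_convex_hull .
  have v_polar: "?T q \<bullet> v + 1 \<ge> 0" if "q \<in> Q" for q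
    using v that by (auto simp: extreme_point_of_def polar_dual_def)
  \<comment> \<open>If all active constraints lay on the wall, the unit vector in direction
    \<open>k\<close> would be orthogonal to them.\<close>
  have "\<exists>b\<in>A. b \<bullet> v = - 1 \<and> b $ k \<noteq> 0"
  proof (rule ccontr)
    assume "\<not> (\<exists>b\<in>A. b \<bullet> v = - 1 \<and> b $ k \<noteq> 0)"
    then have "axis k (1::real) = (0 :: real ^ 'j)"
      by (intro extreme_polar_dual_active[OF assms(2) v']) (auto simp: inner_axis)
    then show False
      by simp
  qed
  then obtain b where b: "b \<in> A" "b \<bullet> v = - 1" "b $ k \<noteq> 0"
    by blast
  have "b \<in> ?T ` Q"
    using b(1) unfolding Q' by (rule hull_inc)
  then obtain p where p: "p \<in> Q" "b = ?T p"
    by blast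
  have p_k: "p $ k = - (b $ k)" by (simp add: p(2) mutation_nth_k)
  define a where "a = (if p $ k > 0 then (\<lambda>j. max (E j) 0) else (\<lambda>j. max (- E j) 0))"
  have T_shear: "?T q = shear a k q" if "p $ k > 0 \<Longrightarrow> q $ k \<ge> 0" "p $ k < 0 \<Longrightarrow> q $ k \<le> 0" for q
    using that b(3) p_k by (auto simp: a_def mutation_pos mutation_neg)
  define w where "w = coshear a k v"
  have pw: "p \<bullet> w = - 1"
    using b(2) T_shear[of p] by (simp add: w_def p(2) inner_shear)
  \<comment> \<open>The inequality at \<open>z\<close> is tested at a point \<open>q\<close> of the
    segment from \<open>p\<close> to \<open>z\<close>, so close to \<open>p\<close> that the
    mutation is the shear there. As \<open>p\<close> is active at \<open>w\<close>, the slack at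
    \<open>q\<close> is \<open>\<delta>\<close> times the slack at \<open>z\<close>.\<close>
  have w_polar: "w \<in> polar_dual Q"
    unfolding polar_dual_def
  proof (intro CollectI ballI)
    fix z assume z: "z \<in> Q"
    obtain \<delta> where \<delta>: "0 < \<delta>" "\<delta> \<le> 1" "p $ k > 0 \<Longrightarrow> p $ k + \<delta> * (z $ k - p $ k) > 0"
      "p $ k < 0 \<Longrightarrow> p $ k + \<delta> * (z $ k - p $ k) < 0"
      using b(3) p_k by (auto intro: small_step[of "p $ k" "z $ k - p $ k"])
    define q where "q = (1 - \<delta>) *\<^sub>R p + \<delta> *\<^sub>R z"
    have "q \<in> Q"
      unfolding q_def using \<delta> by (intro convexD[OF assms(1) p(1) z]) auto
    have "q $ k = p $ k + \<delta> * (z $ k - p $ k)" by (simp add: q_def algebra_simps)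
    then have "?T q = shear a k q"
      using \<delta>(3,4) by (intro T_shear) auto
    then have "q \<bullet> w + 1 \<ge> 0"
      using v_polar[OF \<open>q \<in> Q\<close>] by (simp add: w_def inner_shear)
    moreover have "q \<bullet> w + 1 = \<delta> * (z \<bullet> w + 1)"
      using pw by (simp add: q_def inner_add_left algebra_simps)
    ultimately show "z \<bullet> w + 1 \<ge> 0"
      using \<delta>(1) by (simp add: zero_le_mult_iff)
  qed
  have "w extreme_point_of polar_dual Q"
  proof (rule active_imp_extreme_polar_dual[OF w_polar])
    fix y assume y: "\<And>q. q \<in> Q \<Longrightarrow> q \<bullet> w = - 1 \<Longrightarrow> q \<bullet> y = 0"
    define y' where "y' = coshear a k y"
    have y_y': "y = coshear a k y'" by (simp add: y'_def coshear_coshear)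
    have by': "b \<bullet> y' = 0"
      using y[OF p(1) pw] T_shear[of p] by (simp add: p(2) y_y' inner_shear)
    have "y' = 0"
    proof (rule extreme_polar_dual_active[OF assms(2) v'])
      fix c assume c: "c \<in> A" "c \<bullet> v = - 1"
      \<comment> \<open>The active point \<open>c\<close> may lie across the wall. A point of the
        segment from \<open>b\<close> to \<open>c\<close> close to \<open>b\<close> is also active
        and lies where the mutation is the shear.\<close>
      obtain \<delta> where \<delta>: "0 < \<delta>" "\<delta> \<le> 1" "b $ k > 0 \<Longrightarrow> b $ k + \<delta> * (c $ k - b $ k) > 0"
        "b $ k < 0 \<Longrightarrow> b $ k + \<delta> * (c $ k - b $ k) < 0"
        using b(3) by (auto intro: small_step[of "b $ k" "c $ k - b $ k"])
      define q' where "q' = (1 - \<delta>) *\<^sub>R b + \<delta> *\<^sub>R c"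
      have "q' \<in> convex hull A"
        unfolding q'_def using \<delta> b(1) c(1) by (intro convexD[OF convex_convex_hull] hull_inc) auto
      then obtain q where q: "q \<in> Q" "q' = ?T q"
        unfolding Q'[symmetric] by blast
      have "q $ k = - (b $ k + \<delta> * (c $ k - b $ k))"
        using arg_cong[OF q(2), of "\<lambda>x. x $ k"] by (simp add: mutation_nth_k q'_def algebra_simps)
      then have T_q: "?T q = shear a k q"
        using \<delta>(3,4) p_k by (intro T_shear) auto
      have "q \<bullet> w = q' \<bullet> v" by (simp add: q(2) T_q w_def inner_shear)
      also have "\<dots> = - 1"
        using b(2) c(2) by (simp add: q'_def inner_add_left algebra_simps)
      finally have "q \<bullet> y = 0" by (rule y[OF q(1)])
      then have "q' \<bullet> y' = 0" by (simp add: q(2) T_q inner_shear y_y')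
      then show "c \<bullet> y' = 0"
        using by' \<delta>(1) by (simp add: q'_def inner_add_left)
    qed
    then show "y = 0" by (simp add: y_y')
  qed
  then show ?thesis
    using that[of a] by (auto simp: w_def a_def)
qed

lemma extreme_point_of_scaleR_image:
  fixes D :: "'a::euclidean_space set"
  assumes "c \<noteq> 0"
  shows "x extreme_point_of (*\<^sub>R) c ` D \<longleftrightarrow> (\<exists>v. v extreme_point_of D \<and> x = c *\<^sub>R v)"
proof -
  have inj: "inj ((*\<^sub>R) c :: 'a \<Rightarrow> 'a)"
    using assms by (auto simp: inj_on_def)
  have seg: "c *\<^sub>R v \<in> open_segment (c *\<^sub>R a) (c *\<^sub>R b) \<longleftrightarrow> v \<in> open_segment a b" for v a b :: 'a
    using open_segment_linear_image[OF linear_scaleR inj, of a b] inj_image_mem_iff[OF inj] by metis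
  have key: "c *\<^sub>R v extreme_point_of (*\<^sub>R) c ` D \<longleftrightarrow> v extreme_point_of D" for v
    using inj_image_mem_iff[OF inj, of v D] by (auto simp: extreme_point_of_def seg)
  have "\<exists>v. x = c *\<^sub>R v" if "x extreme_point_of (*\<^sub>R) c ` D"
    using that by (auto simp: extreme_point_of_def)
  then show ?thesis
    using key by blast
qed

lemma primitive_imp_real_vec: "primitive_vector x \<Longrightarrow> x \<in> range real_vec"
  by (auto simp: primitive_vector_def)

lemma zero_not_primitive: "\<not> primitive_vector (0 :: real ^ 'j::finite)"
proof
  assume "primitive_vector (0 :: real ^ 'j)"
  then obtain u :: "int ^ 'j" where u: "real_vec u = 0" "Gcd (range (($) u)) = 1"
    by (auto simp: primitive_vector_def)
  have "u = 0"
    using u(1) real_vec_eq_iff[of u 0] by simp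
  then show False
    using u(2) by simp
qed

text \<open>One of two shears carries each vertex of the new dual to a vertex of the old one. So the
  new vertices are finitely many and primitive after scaling, and by compactness their hull is the
  whole dual.\<close>

theorem Q_Gorenstein_Fano_mutation:
  fixes P :: "(real ^ 'j::finite) set"
  assumes Fano: "Q_Gorenstein_Fano P \<nu> c" and c: "c $ k = 0 \<or> (\<forall>j. j \<noteq> k \<longrightarrow> E j = 0)"
    and rat: "rational_polytope (mutation E k ` P)"
  shows "Q_Gorenstein_Fano (mutation E k ` P) \<nu> (mutation E k c)"
proof -
  let ?T = "mutation E k :: real ^ 'j \<Rightarrow> real ^ 'j"
  define Q where "Q = (\<lambda>x. x - c) ` P"
  define Q' where "Q' = (\<lambda>x. x - ?T c) ` ?T ` P"
  have Q': "Q' = ?T ` Q"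
    unfolding Q_def Q'_def image_image using mutation_translate[OF c] by auto
  have minus: "(\<lambda>x. x - a) ` B = (+) (- a) ` B" for a :: "real ^ 'j" and B
    by (simp add: add.commute)
  obtain A0 where A0: "P = convex hull A0"
    using Fano by (auto simp: Q_Gorenstein_Fano_def rational_polytope_def)
  have "convex Q"
    unfolding Q_def A0 minus by (intro convex_translation convex_convex_hull)
  obtain A1 where A1: "finite A1" "?T ` P = convex hull A1"
    using rat by (auto simp: rational_polytope_def)
  have hull: "Q' = convex hull ((+) (- ?T c) ` A1)"
    unfolding Q'_def A1(2) minus by (rule convex_hull_translation[symmetric])
  have c_int: "c \<in> interior P"
    using Fano by (simp add: Q_Gorenstein_Fano_def)
  have Tc_int: "?T c \<in> interior (?T ` P)" by (rule mutation_interior[OF c_int])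
  have "0 \<in> interior Q" "0 \<in> interior Q'"
    using c_int Tc_int unfolding Q_def Q'_def minus interior_translation
    by (auto intro: image_eqI[of _ _ c] image_eqI[of _ _ "?T c"])
  then have compact: "compact (polar_dual Q)" "compact (polar_dual Q')"
    by (auto intro: compact_polar_dual)
  have dual: "lattice_polytope ((*\<^sub>R) (real \<nu>) ` polar_dual Q)"
    "\<And>x. x extreme_point_of (*\<^sub>R) (real \<nu>) ` polar_dual Q \<Longrightarrow> primitive_vector x"
    using Fano by (auto simp: Q_Gorenstein_Fano_def Let_def Q_def)
  \<comment> \<open>Otherwise the scaled dual is the origin alone, and its vertex is not
    primitive.\<close>
  have "\<nu> \<noteq> 0"
  proof
    assume "\<nu> = 0"
    moreover have "0 \<in> polar_dual Q" by (simp add: polar_dual_def)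
    ultimately have "(*\<^sub>R) (real \<nu>) ` polar_dual Q = {0}" by auto
    then have "0 extreme_point_of (*\<^sub>R) (real \<nu>) ` polar_dual Q" by simp
    then show False
      using dual(2) zero_not_primitive by blast
  qed
  then have \<nu>: "real \<nu> \<noteq> 0" by simp
  note extreme_scale = extreme_point_of_scaleR_image[OF \<nu>]
  define V where "V = {w. w extreme_point_of polar_dual Q}"
  define V' where "V' = {v. v extreme_point_of polar_dual Q'}"
  have V: "primitive_vector (real \<nu> *\<^sub>R w)" if "w \<in> V" for w
    using dual(2) that unfolding extreme_scale V_def by blast
  have "finite V"
  proof -
    obtain A2 where A2: "finite A2" "(*\<^sub>R) (real \<nu>) ` polar_dual Q = convex hull A2"
      using dual(1) by (auto simp: lattice_polytope_def)
    have "(*\<^sub>R) (real \<nu>) ` V \<subseteq> A2"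
    proof
      fix x assume "x \<in> (*\<^sub>R) (real \<nu>) ` V"
      then have "x extreme_point_of convex hull A2"
        unfolding A2(2)[symmetric] extreme_scale V_def by blast
      then show "x \<in> A2" by (rule extreme_point_of_convex_hull)
    qed
    then show ?thesis
      using \<nu> A2(1) by (intro finite_imageD[of "(*\<^sub>R) (real \<nu>)" V]) (auto simp: inj_on_def intro: finite_subset)
  qed
  have sub: "\<exists>a\<in>{(\<lambda>j. max (E j) 0), (\<lambda>j. max (- E j) 0)}. coshear a k v \<in> V" if "v \<in> V'" for v
  proof -
    have "v extreme_point_of polar_dual (?T ` Q)"
      using that by (simp add: V'_def Q')
    then show ?thesis
      by (rule extreme_polar_dual_mutation[OF \<open>convex Q\<close> finite_imageI[OF A1(1)] hull[unfolded Q']])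
         (auto simp: V_def)
  qed
  have "V' \<subseteq> coshear (\<lambda>j. max (E j) 0) k ` V \<union> coshear (\<lambda>j. max (- E j) 0) k ` V"
  proof
    fix v assume "v \<in> V'"
    then obtain a where "a \<in> {(\<lambda>j. max (E j) 0), (\<lambda>j. max (- E j) 0)}" "coshear a k v \<in> V"
      using sub by blast
    moreover have "v = coshear a k (coshear a k v)" by (simp add: coshear_coshear)
    ultimately show "v \<in> coshear (\<lambda>j. max (E j) 0) k ` V \<union> coshear (\<lambda>j. max (- E j) 0) k ` V"
      by blast
  qed
  then have fin_V': "finite V'"
    using \<open>finite V\<close> by (meson finite_UnI finite_imageI finite_subset)
  have V': "primitive_vector (real \<nu> *\<^sub>R v)" if v: "v \<in> V'" for v
  proof -
    obtain a where "coshear a k v \<in> V"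
      using sub[OF v] by blast
    then have "primitive_vector (coshear a k (real \<nu> *\<^sub>R coshear a k v))"
      by (intro primitive_coshear V)
    then show ?thesis by (simp add: coshear_scaleR coshear_coshear)
  qed
  have "polar_dual Q' = convex hull V'"
    unfolding V'_def by (rule Krein_Milman_Minkowski[OF compact(2) convex_polar_dual])
  then have "(*\<^sub>R) (real \<nu>) ` polar_dual Q' = convex hull ((*\<^sub>R) (real \<nu>) ` V')"
    by (simp add: convex_hull_scaling)
  then have "lattice_polytope ((*\<^sub>R) (real \<nu>) ` polar_dual Q')"
    unfolding lattice_polytope_def using fin_V' primitive_imp_real_vec[OF V']
    by (intro exI[of _ "(*\<^sub>R) (real \<nu>) ` V'"]) blast
  moreover have "primitive_vector x" if "x extreme_point_of (*\<^sub>R) (real \<nu>) ` polar_dual Q'" for x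
    using that V' unfolding extreme_scale V'_def by blast
  ultimately show ?thesis
    using rat Tc_int unfolding Q_Gorenstein_Fano_def Let_def Q'_def[symmetric] by blast
qed

section \<open>Newton--Okounkov bodies of affine semigroups\<close>

abbreviation slice_point :: "nat \<times> (int ^ 'j::finite) \<Rightarrow> real ^ 'j" where
  "slice_point s \<equiv> (1 / real (fst s)) *\<^sub>R real_vec (snd s)"

lemma NO_body_slice_points: "NO_body S = closure (convex hull (slice_point ` S))"
proof -
  have "{(1 / real k) *\<^sub>R real_vec u |k u. (k, u) \<in> S} = slice_point ` S" by force
  then show ?thesis by (simp add: NO_body_def)
qed

lemma slice_point_add:
  assumes "fst s \<ge> 1" "fst t \<ge> 1"
  shows "slice_point (s + t) =
    (real (fst s) / real (fst s + fst t)) *\<^sub>R slice_point s + (real (fst t) / real (fst s + fst t)) *\<^sub>R slice_point t"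
  using assms by (simp add: scaleR_add_right)

text \<open>The scaled point of a sum is the average of the scaled points, weighted by
  degree.\<close>

lemma NO_body_generators:
  assumes "finite A" and S: "S = {sum_list xs |xs. xs \<noteq> [] \<and> set xs \<subseteq> A}"
    and pos: "\<And>s. s \<in> S \<Longrightarrow> fst s \<ge> 1"
  shows "NO_body S = convex hull (slice_point ` A)"
proof
  have "A \<subseteq> S"
    unfolding S by (auto intro!: exI[of _ "[_]"])
  then have A_pos: "fst x \<ge> 1" if "x \<in> A" for x
    using that pos by blast
  show "convex hull (slice_point ` A) \<subseteq> NO_body S"
    unfolding NO_body_slice_points using \<open>A \<subseteq> S\<close>
    by (meson closure_subset dual_order.trans hull_mono image_mono)
  have "slice_point (sum_list xs) \<in> convex hull (slice_point ` A) \<and> fst (sum_list xs) \<ge> 1"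
    if "xs \<noteq> []" "set xs \<subseteq> A" for xs
    using that
  proof (induction xs rule: list_nonempty_induct)
    case (single x)
    then show ?case
      using A_pos[of x] by (auto intro: hull_inc)
  next
    case (cons x xs)
    then have IH: "slice_point (sum_list xs) \<in> convex hull (slice_point ` A)" "fst (sum_list xs) \<ge> 1"
      by auto
    have x: "slice_point x \<in> convex hull (slice_point ` A)" "fst x \<ge> 1"
      using cons.prems A_pos[of x] by (auto intro: hull_inc)
    have "slice_point (x + sum_list xs) \<in> convex hull (slice_point ` A)"
      unfolding slice_point_add[OF x(2) IH(2)] using x IH
      by (intro convexD[OF convex_convex_hull]) (auto simp: add_divide_distrib[symmetric])
    then show ?case
      using x(2) by simp
  qed
  then have "slice_point ` S \<subseteq> convex hull (slice_point ` A)"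
    unfolding S by auto
  then show "NO_body S \<subseteq> convex hull (slice_point ` A)"
    unfolding NO_body_slice_points using assms(1)
    by (intro closure_minimal hull_minimal compact_imp_closed finite_imp_compact_convex_hull) auto
qed

lemma rational_polytope_NO_body:
  assumes "finite A" "S = {sum_list xs |xs. xs \<noteq> [] \<and> set xs \<subseteq> A}" "\<And>s. s \<in> S \<Longrightarrow> fst s \<ge> 1"
  shows "rational_polytope (NO_body S)"
  unfolding rational_polytope_def
proof (intro exI conjI)
  show "NO_body S = convex hull (slice_point ` A)"
    by (rule NO_body_generators) (use assms in auto)
  show "\<forall>x\<in>slice_point ` A. \<forall>j. x $ j \<in> \<rat>" by (auto simp: real_vec_def)
qed (use assms(1) in auto)

text \<open>The multiples of \<open>s\<close> and \<open>t\<close> must have degrees in the ratio of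
  \<open>n - m\<close> to \<open>m\<close>; hence the factors \<open>(n - m) * fst t\<close> and
  \<open>m * fst s\<close>. The ends \<open>m = 0\<close> and \<open>m = n\<close> are separate
  because a multiple by zero would leave \<open>S\<close>.\<close>

lemma slice_points_rational_convex:
  assumes add: "\<And>s t. s \<in> S \<Longrightarrow> t \<in> S \<Longrightarrow> s + t \<in> S" and pos: "\<And>s. s \<in> S \<Longrightarrow> fst s \<ge> 1"
    and st: "s \<in> S" "t \<in> S" and mn: "m \<le> n" "n \<ge> 1"
  shows "(1 - real m / real n) *\<^sub>R slice_point s + (real m / real n) *\<^sub>R slice_point t \<in> slice_point ` S"
proof -
  have scale: "nscale k s \<in> S \<and> slice_point (nscale k s) = slice_point s \<and> fst (nscale k s) = k * fst s"
    if "s \<in> S" "k \<ge> 1" for s k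
  proof -
    have "nscale k s \<in> S"
      using that(2)
    proof (induction k rule: nat_induct_at_least)
      case base
      then show ?case
        using that(1) by simp
    next
      case (Suc k)
      then show ?case
        using add[OF that(1)] by (simp add: nscale_Suc)
    qed
    then show ?thesis
      using that(2) by (simp add: nscale_def)
  qed
  consider "m = 0" | "m = n" | "m \<ge> 1" "m < n"
    using mn by linarith
  then show ?thesis
  proof cases
    case 3
    define s' t' where "s' = nscale ((n - m) * fst t) s" and "t' = nscale (m * fst s) t"
    have "(n - m) * fst t \<ge> 1" "m * fst s \<ge> 1"
      using 3 pos[OF st(1)] pos[OF st(2)] by auto
    then have s': "s' \<in> S" "slice_point s' = slice_point s" "fst s' = (n - m) * fst t * fst s"
      and t': "t' \<in> S" "slice_point t' = slice_point t" "fst t' = m * fst s * fst t"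
      unfolding s'_def t'_def using scale[OF st(1)] scale[OF st(2)] by blast+
    have total: "fst s' + fst t' = n * (fst s * fst t)"
      unfolding s'(3) t'(3) using 3 by (simp add: algebra_simps flip: add_mult_distrib2)
    have "real (fst s') / real (n * (fst s * fst t)) = 1 - real m / real n"
      using pos[OF st(1)] pos[OF st(2)] 3 unfolding s'(3) by (simp add: of_nat_diff field_simps)
    moreover have "real (fst t') / real (n * (fst s * fst t)) = real m / real n"
      using pos[OF st(1)] pos[OF st(2)] 3 unfolding t'(3) by (simp add: field_simps)
    ultimately have eq: "slice_point (s' + t') = (1 - real m / real n) *\<^sub>R slice_point s + (real m / real n) *\<^sub>R slice_point t"
      using slice_point_add[OF pos[OF s'(1)] pos[OF t'(1)]] by (simp only: total s'(2) t'(2))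
    show ?thesis
      unfolding eq[symmetric] by (rule imageI[OF add[OF s'(1) t'(1)]])
  qed (use st mn in auto)
qed

text \<open>Removes the convex hull, with which a mutation does not commute: rational convex
  combinations of scaled points are scaled points, and real ones are limits of these.\<close>

lemma NO_body_eq_closure:
  assumes add: "\<And>s t. s \<in> S \<Longrightarrow> t \<in> S \<Longrightarrow> s + t \<in> S" and pos: "\<And>s. s \<in> S \<Longrightarrow> fst s \<ge> 1"
  shows "NO_body S = closure (slice_point ` S)"
proof
  show "closure (slice_point ` S) \<subseteq> NO_body S"
    unfolding NO_body_slice_points by (intro closure_mono hull_subset)
  have "convex (closure (slice_point ` S))"
    unfolding convex_alt
  proof (intro ballI allI impI)
    fix x y :: "real ^ 'a" and t :: real
    assume xy: "x \<in> closure (slice_point ` S)" "y \<in> closure (slice_point ` S)" and t: "0 \<le> t \<and> t \<le> 1"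
    obtain f where f: "\<And>n. f n \<in> slice_point ` S" "f \<longlonglongrightarrow> x"
      using xy(1) closure_sequential by blast
    obtain g where g: "\<And>n. g n \<in> slice_point ` S" "g \<longlonglongrightarrow> y"
      using xy(2) closure_sequential by blast
    \<comment> \<open>Approximation of \<open>t\<close> from below by a fraction with denominator
      \<open>Suc n\<close>.\<close>
    define m where "m n = nat \<lfloor>t * real (Suc n)\<rfloor>" for n
    define q where "q n = real (m n) / real (Suc n)" for n
    have m: "\<bar>real (m n) - t * real (Suc n)\<bar> \<le> 1" for n
    proof -
      have "t * real (Suc n) \<ge> 0"
        using t by simp
      then show ?thesis
        unfolding m_def by linarith
    qed
    have m_le: "m n \<le> Suc n" for n
    proof -
      have "t * real (Suc n) \<le> 1 * real (Suc n)"
        using t by (intro mult_right_mono) auto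
      then have "\<lfloor>t * real (Suc n)\<rfloor> \<le> int (Suc n)"
        unfolding floor_le_iff of_int_of_nat_eq mult_1 by linarith
      then show ?thesis by (simp add: m_def nat_le_iff)
    qed
    have "norm (q n - t) \<le> inverse (real (Suc n))" for n
    proof -
      have "q n - t = (real (m n) - t * real (Suc n)) / real (Suc n)"
        by (simp add: q_def diff_divide_distrib)
      then show ?thesis
        using m[of n] by (simp add: inverse_eq_divide divide_right_mono)
    qed
    then have "(\<lambda>n. q n - t) \<longlonglongrightarrow> 0"
      by (intro Lim_null_comparison[OF _ LIMSEQ_inverse_real_of_nat]) auto
    then have "q \<longlonglongrightarrow> t" by (rule LIM_zero_cancel)
    then have "(\<lambda>n. (1 - q n) *\<^sub>R f n + q n *\<^sub>R g n) \<longlonglongrightarrow> (1 - t) *\<^sub>R x + t *\<^sub>R y"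
      by (intro tendsto_intros f g)
    moreover have "(1 - q n) *\<^sub>R f n + q n *\<^sub>R g n \<in> slice_point ` S" for n
    proof -
      obtain s u where su: "s \<in> S" "f n = slice_point s" "u \<in> S" "g n = slice_point u"
        using f(1)[of n] g(1)[of n] by blast
      show ?thesis
        unfolding q_def su(2,4)
        by (rule slice_points_rational_convex[OF add pos su(1,3) m_le]) auto
    qed
    ultimately show "(1 - t) *\<^sub>R x + t *\<^sub>R y \<in> closure (slice_point ` S)"
      unfolding closure_sequential
      by (intro exI[of _ "\<lambda>n. (1 - q n) *\<^sub>R f n + q n *\<^sub>R g n"]) simp
  qed
  then show "NO_body S \<subseteq> closure (slice_point ` S)"
    unfolding NO_body_slice_points by (intro closure_minimal hull_minimal closure_subset closed_closure)
qed

lemma NO_body_mutation: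
  assumes "\<And>s t. s \<in> S \<Longrightarrow> t \<in> S \<Longrightarrow> s + t \<in> S" "\<And>s. s \<in> S \<Longrightarrow> fst s \<ge> 1"
    "\<And>s t. s \<in> S' \<Longrightarrow> t \<in> S' \<Longrightarrow> s + t \<in> S'" "\<And>s. s \<in> S' \<Longrightarrow> fst s \<ge> 1"
    and S': "S' = (\<lambda>(r, u). (r, mutation E k u)) ` S"
  shows "NO_body S' = mutation E k ` NO_body S"
proof -
  have "slice_point ` S' = mutation E k ` slice_point ` S"
    unfolding S' image_image by (intro image_cong refl) (auto simp: mutation_scaleR real_vec_mutation)
  moreover have "NO_body S = closure (slice_point ` S)"
    by (rule NO_body_eq_closure) (use assms(1,2) in auto)
  moreover have "NO_body S' = closure (slice_point ` S')"
    by (rule NO_body_eq_closure) (use assms(3,4) in auto)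
  ultimately show ?thesis by (simp only: mutation_closure)
qed

lemma saturated_mutation:
  assumes "saturated S" and S': "S' = (\<lambda>(r, u). (r, mutation E k u)) ` S"
  shows "saturated S'"
  unfolding saturated_def
proof (intro allI impI)
  fix r u n assume "(n * r, int n *s u) \<in> S'"
  then obtain v where v: "(n * r, v) \<in> S" "mutation E k v = int n *s u"
    by (auto simp: S')
  have "v = mutation (\<lambda>j. - E j) k (int n *s u)" by (simp add: mutation_inverse flip: v(2))
  also have "\<dots> = int n *s mutation (\<lambda>j. - E j) k u" by (rule mutation_scale) simp
  finally have "(r, mutation (\<lambda>j. - E j) k u) \<in> S"
    using assms(1) v(1) unfolding saturated_def by blast
  then show "(r, u) \<in> S'"
    unfolding S' by (intro image_eqI[of _ _ "(r, mutation (\<lambda>j. - E j) k u)"]) (auto simp: mutation_inverse')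
qed

lemma trop_mutation_eq_mutation:
  assumes "\<And>j. \<epsilon> k j = of_int (E j)"
  shows "trop_mutation \<epsilon> k u = mutation E k u"
proof -
  have "real_of_rat (max (of_int a) 0) = real_of_int (max a 0)" for a
    by (metis of_int_0 of_int_max of_rat_of_int_eq)
  moreover have "real_of_rat (max (- of_int a) 0) = real_of_int (max (- a) 0)" for a
    by (metis of_int_0 of_int_max of_int_minus of_rat_of_int_eq)
  ultimately show ?thesis
    by (auto simp: trop_mutation_def mutation_def shear_def vec_eq_iff assms)
qed

lemma real_points_mutation:
  assumes "\<And>j. \<epsilon> k j = of_int (E j)"
    and eq: "real_points S' = trop_mutation_hat (\<epsilon>) k ` real_points S"
  shows "S' = (\<lambda>(r, u). (r, mutation E k u)) ` S"
proof -
  let ?f = "\<lambda>(r, u). (real r, real_vec u) :: real \<times> (real ^ 'a)"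
  have "inj ?f" by (auto simp: inj_on_def)
  moreover have "?f ` S' = ?f ` (\<lambda>(r, u). (r, mutation E k u)) ` S"
    using eq unfolding real_points_def image_image
    by (simp add: trop_mutation_hat_def trop_mutation_eq_mutation[of \<epsilon> k E, OF assms(1)] real_vec_mutation case_prod_unfold)
  ultimately show ?thesis by (simp add: inj_image_eq_iff)
qed

section \<open>Seeds\<close>

lemma additive_scale_int:
  fixes F :: "int ^ 'j \<Rightarrow> 'a::ring_1"
  assumes "\<And>x y. F (x + y) = F x + F y"
  shows "F (n *s x) = of_int n * F x"
proof -
  have F0: "F 0 = 0"
    using assms[of 0 0] by simp
  have nat: "F (int m *s x) = of_nat m * F x" for m
  proof (induction m)
    case 0
    have "int 0 *s x = 0" by (simp add: vec_eq_iff)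
    then show ?case by (simp only: F0) simp
  next
    case (Suc m)
    have "int (Suc m) *s x = x + int m *s x" by (simp add: vec_eq_iff algebra_simps)
    then show ?case
      using Suc by (simp only: assms) (simp add: algebra_simps)
  qed
  show ?thesis
  proof (cases "n \<ge> 0")
    case True
    then show ?thesis
      using nat[of "nat n"] by simp
  next
    case False
    have "F (n *s x) + F ((- n) *s x) = F (n *s x + (- n) *s x)" by (rule assms[symmetric])
    also have "n *s x + (- n) *s x = 0" by (simp add: vec_eq_iff)
    finally have "F (n *s x) = - F ((- n) *s x)" by (simp add: F0 eq_neg_iff_add_eq_0)
    then show ?thesis
      using nat[of "nat (- n)"] False by simp
  qed
qed

lemma additive_sum:
  fixes F :: "'b::comm_monoid_add \<Rightarrow> 'a::ab_group_add"
  assumes "\<And>x y. F (x + y) = F x + F y"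
  shows "F (sum f X) = (\<Sum>x\<in>X. F (f x))"
proof -
  have "F 0 = 0"
    using assms[of 0 0] by simp
  then show ?thesis by (induction X rule: infinite_finite_induct) (auto simp: assms)
qed

abbreviation is_basis :: "('j \<Rightarrow> int ^ 'j::finite) \<Rightarrow> bool" where
  "is_basis s \<equiv> lattice_basis s UNIV UNIV"

lemma sum_indicator_scale:
  fixes f :: "'b \<Rightarrow> int ^ 'j"
  assumes "finite X" "k \<in> X"
  shows "(\<Sum>i\<in>X. (if i = k then 1 else 0) *s f i) = f k"
proof -
  have "(\<Sum>i\<in>X. (if i = k then 1 else 0) *s f i) = (\<Sum>i\<in>X. if i = k then f i else 0)"
    by (rule sum.cong) (auto simp: vec_eq_iff)
  then show ?thesis
    using assms by simp
qed

lemma lattice_basis_sum_mem: "lattice_basis b X L \<Longrightarrow> (\<Sum>i\<in>X. c i *s b i) \<in> L"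
  unfolding lattice_basis_def by blast

lemma lattice_basis_mem:
  assumes "lattice_basis b X L" "finite X" "k \<in> X"
  shows "b k \<in> L"
proof -
  have "(\<Sum>i\<in>X. (if i = k then 1 else 0) *s b i) \<in> L"
    by (rule lattice_basis_sum_mem[OF assms(1)])
  then show ?thesis by (simp only: sum_indicator_scale[OF assms(2,3)])
qed

lemma basis_unique:
  assumes "is_basis s" "(\<Sum>i\<in>UNIV. c i *s s i) = (\<Sum>i\<in>UNIV. c' i *s s i)"
  shows "c = c'"
proof -
  have "(\<Sum>i\<in>UNIV. (c i - c' i) *s s i) = (\<Sum>i\<in>UNIV. c i *s s i) - (\<Sum>i\<in>UNIV. c' i *s s i)"
    by (simp add: vec_eq_iff left_diff_distrib sum_subtractf)
  then have "(\<Sum>i\<in>UNIV. (c i - c' i) *s s i) = 0"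
    using assms(2) by simp
  then have "c i - c' i = 0" for i
    using assms(1) unfolding lattice_basis_def by (metis UNIV_I)
  then show ?thesis by (auto simp: fun_eq_iff)
qed

lemma dual_basis_eqI:
  assumes "is_basis s" "n = (\<Sum>i\<in>UNIV. c i *s s i)"
  shows "dual_basis s j n = c j"
proof -
  have "(THE c. n = (\<Sum>i\<in>UNIV. c i *s s i)) = c"
    using assms basis_unique[OF assms(1)] by (intro the_equality) auto
  then show ?thesis by (simp add: dual_basis_def)
qed

lemma dual_basis_expand:
  assumes "is_basis s"
  shows "n = (\<Sum>j\<in>UNIV. dual_basis s j n *s s j)"
proof -
  have "n \<in> {\<Sum>i\<in>UNIV. c i *s s i |c. True}"
    using assms unfolding lattice_basis_def by blast
  then obtain c where c: "n = (\<Sum>i\<in>UNIV. c i *s s i)"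
    by blast
  then have "dual_basis s j n = c j" for j
    by (rule dual_basis_eqI[OF assms])
  then show ?thesis
    using c by simp
qed

lemma dual_basis_self:
  assumes "is_basis s"
  shows "dual_basis s j (s i) = (if j = i then 1 else 0)"
  by (rule dual_basis_eqI[OF assms]) (simp only: sum_indicator_scale finite_class.finite_UNIV UNIV_I)

text \<open>The vectors \<open>d j *s s j\<close> are dual to \<open>f_basis\<close>, so the
  coordinates of \<open>u\<close> are its values on them.\<close>

lemma seed_coords_nth:
  assumes s: "is_basis s" and u: "u \<in> M_real" and d: "\<And>j. d j \<noteq> 0"
  shows "seed_coords d s u $ j = of_int (d j) * u (s j)"
proof -
  have add: "u (x + y) = u x + u y" for x y
    using u by (simp add: M_real_def)
  let ?c = "\<chi> j. of_int (d j) * u (s j)"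
  have "seed_coords d s u = ?c"
    unfolding seed_coords_def
  proof (rule the_equality)
    show "\<forall>n. u n = (\<Sum>j\<in>UNIV. ?c $ j * f_basis d s j n)"
    proof
      fix n
      have "u n = u (\<Sum>j\<in>UNIV. dual_basis s j n *s s j)"
        using dual_basis_expand[OF s, of n] by simp
      then show "u n = (\<Sum>j\<in>UNIV. ?c $ j * f_basis d s j n)"
        using d by (simp add: additive_sum[of u, OF add] additive_scale_int[of u, OF add] f_basis_def mult.commute)
    qed
  next
    fix c assume c: "\<forall>n. u n = (\<Sum>j\<in>UNIV. c $ j * f_basis d s j n)"
    have "c $ i = of_int (d i) * u (s i)" for i
    proof -
      have "u (s i) = (\<Sum>j\<in>UNIV. if j = i then c $ i / of_int (d i) else 0)"
        unfolding c[rule_format] by (intro sum.cong) (auto simp: f_basis_def dual_basis_self[OF s])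
      then show ?thesis
        using d[of i] by simp
    qed
    then show "c = ?c" by (simp add: vec_eq_iff)
  qed
  then show ?thesis by simp
qed

text \<open>Coefficients with respect to the two families are related by \<open>coshear\<close>,
  which is invertible.\<close>

lemma is_basis_mutate:
  fixes s :: "'j \<Rightarrow> int ^ 'j::finite"
  assumes "is_basis s"
  shows "is_basis (\<lambda>j. if j = k then - s k else s j + m j *s s k)" (is "is_basis ?s'")
proof -
  have change: "(\<Sum>j\<in>UNIV. c $ j *s ?s' j) = (\<Sum>j\<in>UNIV. coshear m k c $ j *s s j)" for c :: "int ^ 'j"
    unfolding sum.remove[OF finite_class.finite_UNIV UNIV_I, of _ k] vec_eq_iff
    by (simp add: coshear_def sum.distrib algebra_simps sum_distrib_left)
  show ?thesis
    unfolding lattice_basis_def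
  proof (intro conjI Set.set_eqI allI impI)
    fix n :: "int ^ 'j"
    have "n = (\<Sum>j\<in>UNIV. coshear m k (coshear m k (\<chi> j. dual_basis s j n)) $ j *s s j)"
      using dual_basis_expand[OF assms, of n] by (simp add: coshear_coshear)
    then have "n = (\<Sum>j\<in>UNIV. coshear m k (\<chi> j. dual_basis s j n) $ j *s ?s' j)"
      unfolding change[symmetric] .
    then show "n \<in> UNIV \<longleftrightarrow> n \<in> {\<Sum>i\<in>UNIV. c i *s ?s' i |c. True}" by blast
  next
    fix c assume "(\<Sum>i\<in>UNIV. c i *s ?s' i) = 0"
    then have "(\<Sum>j\<in>UNIV. coshear m k (\<chi> j. c j) $ j *s s j) = (\<Sum>j\<in>UNIV. 0 *s s j)"
      using change[of "\<chi> j. c j"] by (simp add: vec_eq_iff)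
    from basis_unique[OF assms this] have "coshear m k (\<chi> j. c j) = 0"
      by (simp add: fun_eq_iff vec_eq_iff)
    then have "coshear m k (coshear m k (\<chi> j. c j)) = 0" by simp
    then show "\<forall>i\<in>UNIV. c i = 0" by (simp add: coshear_coshear vec_eq_iff)
  qed
qed

lemma subgroup_of_uminus: "subgroup_of L \<Longrightarrow> x \<in> L \<Longrightarrow> - x \<in> L"
  unfolding subgroup_of_def by (metis diff_0)

lemma subgroup_of_add:
  assumes "subgroup_of L" "x \<in> L" "y \<in> L"
  shows "x + y \<in> L"
proof -
  have "x - (- y) \<in> L"
    using assms subgroup_of_uminus[OF assms(1,3)] unfolding subgroup_of_def by blast
  then show ?thesis by simp
qed

lemma subgroup_of_scale:
  fixes x :: "int ^ 'j"
  assumes "subgroup_of L" "x \<in> L"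
  shows "n *s x \<in> L"
proof -
  have nat: "int m *s x \<in> L" for m
  proof (induction m)
    case 0
    have "int 0 *s x = 0" by (simp add: vec_eq_iff)
    then show ?case
      using assms(1) by (simp add: subgroup_of_def)
  next
    case (Suc m)
    have "int (Suc m) *s x = x + int m *s x" by (simp add: vec_eq_iff algebra_simps)
    then show ?case
      using subgroup_of_add[OF assms(1,2) Suc] by (simp only:)
  qed
  show ?thesis
  proof (cases "n \<ge> 0")
    case False
    have "n *s x = - (int (nat (- n)) *s x)"
      using False by (simp add: vec_eq_iff)
    then show ?thesis
      using subgroup_of_uminus[OF assms(1) nat[of "nat (- n)"]] by (simp only:)
  qed (use nat[of "nat n"] in simp)
qed

section \<open>Mutation of seeds and the position of the center\<close>

locale seed_data =
  fixes form :: "int ^ 'j::finite \<Rightarrow> int ^ 'j \<Rightarrow> rat" and Juf :: "'j set"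
    and Nuf :: "(int ^ 'j) set" and d :: "'j \<Rightarrow> int" and Ncirc :: "(int ^ 'j) set"
  assumes data: "fixed_data form Juf Nuf d Ncirc"
begin

text \<open>The part of \<^const>\<open>is_seed\<close> that the argument needs.\<close>

definition good_seed :: "('j \<Rightarrow> int ^ 'j) \<Rightarrow> bool" where
  "good_seed s \<longleftrightarrow> is_basis s \<and> (\<forall>k\<in>Juf. s k \<in> Nuf) \<and> (\<forall>j. d j *s s j \<in> Ncirc)"

lemma form_add_left: "form (x + y) z = form x z + form y z"
proof -
  have "\<forall>x y z. form (x + y) z = form x z + form y z"
    using data unfolding fixed_data_def by (elim conjE)
  then show ?thesis by blast
qed

lemma form_skew: "form x y = - form y x"
proof -
  have "\<forall>x y. form x y = - form y x"
    using data unfolding fixed_data_def by (elim conjE)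
  then show ?thesis by (elim allE)
qed

lemma d_pos: "d j > 0"
  and sub_Nuf: "subgroup_of Nuf" and sub_Ncirc: "subgroup_of Ncirc"
proof -
  have "\<forall>j. d j > 0"
    using data unfolding fixed_data_def by (elim conjE)
  then show "d j > 0" by blast
  show "subgroup_of Nuf" "subgroup_of Ncirc"
    using data unfolding fixed_data_def by blast+
qed

lemma form_int1: "x \<in> Nuf \<Longrightarrow> y \<in> Ncirc \<Longrightarrow> form x y \<in> \<int>"
  and form_int2: "y \<in> Nuf \<Longrightarrow> y \<in> Ncirc \<Longrightarrow> form x y \<in> \<int>"
proof -
  have "\<forall>x\<in>Nuf. \<forall>y\<in>Ncirc. form x y \<in> \<int>"
    using data unfolding fixed_data_def by (elim conjE)
  then show "x \<in> Nuf \<Longrightarrow> y \<in> Ncirc \<Longrightarrow> form x y \<in> \<int>" by blast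
  have "\<forall>x. \<forall>y\<in>Nuf \<inter> Ncirc. form x y \<in> \<int>"
    using data unfolding fixed_data_def by (elim conjE)
  then show "y \<in> Nuf \<Longrightarrow> y \<in> Ncirc \<Longrightarrow> form x y \<in> \<int>" by blast
qed

lemma form_add_right: "form z (x + y) = form z x + form z y"
  using form_add_left[of x y z] form_skew[of z x] form_skew[of z y] form_skew[of z "x + y"] by simp

lemma form_scale_right: "form x (n *s y) = of_int n * form x y"
  by (rule additive_scale_int[of "form x"]) (rule form_add_right)

lemma form_self: "form x x = 0"
  using form_skew[of x x] by simp

lemma form_uminus_left: "form (- x) y = - form x y"
  using form_add_left[of x "- x" y] form_add_left[of 0 0 y] by simp

abbreviation \<epsilon> :: "('j \<Rightarrow> int ^ 'j) \<Rightarrow> 'j \<Rightarrow> 'j \<Rightarrow> rat" where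
  "\<epsilon> s \<equiv> exchange_matrix form d s"

definition E :: "('j \<Rightarrow> int ^ 'j) \<Rightarrow> 'j \<Rightarrow> 'j \<Rightarrow> int" where
  "E s k j = \<lfloor>\<epsilon> s k j\<rfloor>"

lemma \<epsilon>_row:
  assumes "good_seed s" "k \<in> Juf"
  shows "\<epsilon> s k j = of_int (E s k j)"
proof -
  have "form (s k) (d j *s s j) \<in> \<int>"
    using assms by (intro form_int1) (auto simp: good_seed_def)
  then have "\<epsilon> s k j \<in> \<int>" by (simp add: exchange_matrix_def form_scale_right mult.commute)
  then show ?thesis by (auto simp: E_def elim!: Ints_cases)
qed

text \<open>Seed mutation uses column \<open>k\<close> of the exchange matrix, tropical mutation row
  \<open>k\<close>. Skew-symmetry gives
  \<open>d j * \<epsilon> s j k = - \<epsilon> s k j * d k\<close>, and positive factors pass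
  through \<open>max\<close>.\<close>

lemma mutation_coefficient:
  assumes "good_seed s" "k \<in> Juf"
  shows "d j * \<lfloor>max (\<epsilon> s j k) 0\<rfloor> = max (- E s k j) 0 * d k"
proof -
  have "d k *s s k \<in> Nuf" "d k *s s k \<in> Ncirc"
    using assms subgroup_of_scale[OF sub_Nuf] by (auto simp: good_seed_def)
  then have "form (s j) (d k *s s k) \<in> \<int>" by (rule form_int2)
  then have "\<epsilon> s j k \<in> \<int>" by (simp add: exchange_matrix_def form_scale_right mult.commute)
  then obtain e where e: "\<epsilon> s j k = of_int e"
    by (auto elim: Ints_cases)
  have "of_int (d j) * \<epsilon> s j k = - \<epsilon> s k j * of_int (d k)"
    using form_skew[of "s j" "s k"] by (simp add: exchange_matrix_def mult_ac)
  then have "(of_int (d j * e) :: rat) = of_int (- E s k j * d k)"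
    by (simp add: e \<epsilon>_row[OF assms])
  then have eq: "d j * e = - E s k j * d k" by (simp only: of_int_eq_iff)
  have "\<lfloor>max (\<epsilon> s j k) 0\<rfloor> = max e 0"
    unfolding e by (metis floor_of_int of_int_0 of_int_max)
  moreover have "d j * max e 0 = max (d j * e) 0" "max (- E s k j) 0 * d k = max (- E s k j * d k) 0"
    using d_pos[of j] d_pos[of k] by (auto simp: max_def mult_le_0_iff zero_le_mult_iff)
  ultimately show ?thesis
    using eq by simp
qed

lemma good_seed_mutate:
  assumes "good_seed s" "k \<in> Juf"
  shows "good_seed (mutate_seed form d k s)"
proof -
  define m where "m j = \<lfloor>max (\<epsilon> s j k) 0\<rfloor>" for j
  have eq: "mutate_seed form d k s = (\<lambda>j. if j = k then - s k else s j + m j *s s k)"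
    by (simp add: mutate_seed_def m_def fun_eq_iff)
  have s: "is_basis s" "\<And>j. j \<in> Juf \<Longrightarrow> s j \<in> Nuf" "\<And>j. d j *s s j \<in> Ncirc"
    using assms(1) by (auto simp: good_seed_def)
  have "d j *s (s j + m j *s s k) \<in> Ncirc" for j
  proof -
    have "d j *s (s j + m j *s s k) = d j *s s j + max (- E s k j) 0 *s (d k *s s k)"
      using mutation_coefficient[OF assms, of j]
      by (simp add: m_def vec_eq_iff distrib_left mult.assoc[symmetric])
    then show ?thesis
      using subgroup_of_add[OF sub_Ncirc s(3) subgroup_of_scale[OF sub_Ncirc s(3)]] by (simp only:)
  qed
  moreover have "d k *s (- s k) \<in> Ncirc"
  proof -
    have "d k *s (- s k) = - (d k *s s k)" by (simp add: vec_eq_iff)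
    then show ?thesis
      using subgroup_of_uminus[OF sub_Ncirc s(3)[of k]] by (simp only:)
  qed
  moreover have "s j + m j *s s k \<in> Nuf" if "j \<in> Juf" for j
    using that assms(2) s(2) sub_Nuf by (intro subgroup_of_add subgroup_of_scale)
  ultimately show ?thesis
    using is_basis_mutate[OF s(1)] subgroup_of_uminus[OF sub_Nuf s(2)] assms(2)
    unfolding eq good_seed_def by auto
qed

lemma good_seed_at:
  assumes "is_seed Juf Nuf d Ncirc s0" "t \<in> lists Juf"
  shows "good_seed (seed_at form d s0 t)"
  using assms(2)
proof (induction t)
  case Nil
  have basis: "is_basis s0" "lattice_basis s0 Juf Nuf" "lattice_basis (\<lambda>j. d j *s s0 j) UNIV Ncirc"
    using assms(1) unfolding is_seed_def by blast+
  have "s0 k \<in> Nuf" if "k \<in> Juf" for k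
    by (rule lattice_basis_mem[OF basis(2) finite that])
  moreover have "d k *s s0 k \<in> Ncirc" for k
    by (rule lattice_basis_mem[OF basis(3) finite UNIV_I])
  ultimately show ?case
    using basis(1) by (simp add: good_seed_def)
next
  case (Cons k t)
  then have "good_seed (seed_at form d s0 t)" "k \<in> Juf" by auto
  then show ?case by (simp add: good_seed_mutate)
qed

text \<open>The coefficients \<open>max (- E s k j) 0\<close> are those of the branch of
  \<open>mutation\<close> for nonpositive coordinate \<open>k\<close>.\<close>

lemma seed_coords_mutate:
  assumes "good_seed s" "k \<in> Juf" "u \<in> M_real"
  shows "seed_coords d (mutate_seed form d k s) u $ j = (if j = k then - (seed_coords d s u $ k)
    else seed_coords d s u $ j + of_int (max (- E s k j) 0) * seed_coords d s u $ k)"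
proof -
  have add: "u (x + y) = u x + u y" for x y
    using assms(3) by (simp add: M_real_def)
  have d: "d j \<noteq> 0" for j
    using d_pos[of j] by simp
  have basis: "is_basis s" "is_basis (mutate_seed form d k s)"
    using assms good_seed_mutate by (auto simp: good_seed_def)
  have scale: "u (n *s x) = of_int n * u x" for n x
    by (rule additive_scale_int[of u, OF add])
  have "u (- x) = - u x" for x
    using add[of x "- x"] add[of 0 0] by simp
  moreover have "of_int (d j) * (of_int \<lfloor>max (\<epsilon> s j k) 0\<rfloor> * u (s k)) =
      of_int (max (- E s k j) 0) * (of_int (d k) * u (s k))"
    using arg_cong[OF mutation_coefficient[OF assms(1,2), of j], of real_of_int]
    by (simp only: of_int_mult mult.assoc[symmetric])
  ultimately show ?thesis
    unfolding seed_coords_nth[OF basis(1) assms(3) d] seed_coords_nth[OF basis(2) assms(3) d]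
    by (simp add: mutate_seed_def add scale distrib_left)
qed

lemma E_mutate:
  assumes "j \<noteq> k"
  shows "\<epsilon> (mutate_seed form d k s) k j = - \<epsilon> s k j"
  using assms by (simp add: exchange_matrix_def mutate_seed_def form_add_right form_scale_right
      form_uminus_left form_self)

text \<open>If the center lies strictly on the positive side of the wall, the coordinate change and the
  tropical mutation can only agree when the row of \<open>\<epsilon>\<close> vanishes. The negative side is the positive
  side seen from the mutated seed.\<close>

lemma fixed_center:
  assumes s: "good_seed s" and k: "k \<in> Juf" and u: "u \<in> M_real"
    and fixed: "trop_mutation (\<epsilon> s) k (seed_coords d s u) = seed_coords d (mutate_seed form d k s) u"
      "trop_mutation (\<epsilon> (mutate_seed form d k s)) k (seed_coords d (mutate_seed form d k s) u) =
        seed_coords d (mutate_seed form d k (mutate_seed form d k s)) u"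
  shows "seed_coords d s u $ k = 0 \<or> (\<forall>j. j \<noteq> k \<longrightarrow> E s k j = 0)"
proof -
  have pos: "E s k j = 0" if "good_seed s" "j \<noteq> k" "seed_coords d s u $ k > 0"
    "trop_mutation (\<epsilon> s) k (seed_coords d s u) = seed_coords d (mutate_seed form d k s) u" for s j
  proof -
    have "mutation (E s k) k (seed_coords d s u) $ j = seed_coords d (mutate_seed form d k s) u $ j"
      using that(4) trop_mutation_eq_mutation[of "\<epsilon> s" k "E s k", OF \<epsilon>_row[OF that(1) k]] by simp
    then have "of_int (max (E s k j) 0) * seed_coords d s u $ k = of_int (max (- E s k j) 0) * seed_coords d s u $ k"
      using that(2,3) unfolding seed_coords_mutate[OF that(1) k u]
      by (simp add: mutation_pos) (simp add: shear_def)
    then have "real_of_int (max (E s k j) 0) = real_of_int (max (- E s k j) 0)"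
      using that(3) by simp
    then have "max (E s k j) 0 = max (- E s k j) 0" by (simp only: of_int_eq_iff)
    then show ?thesis by linarith
  qed
  consider "seed_coords d s u $ k = 0" | "seed_coords d s u $ k > 0" | "seed_coords d s u $ k < 0"
    by linarith
  then show ?thesis
  proof cases
    case 3
    let ?s' = "mutate_seed form d k s"
    have s': "good_seed ?s'" by (rule good_seed_mutate[OF s k])
    have "seed_coords d ?s' u $ k > 0"
      using 3 by (simp add: seed_coords_mutate[OF s k u])
    then have "E ?s' k j = 0" if "j \<noteq> k" for j
      using pos[OF s' that _ fixed(2)] by blast
    then have "E s k j = 0" if "j \<noteq> k" for j
      using E_mutate[OF that, of s] that \<epsilon>_row[OF s k, of j] \<epsilon>_row[OF s' k, of j] by simp
    then show ?thesis by blast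
  qed (use pos[OF s _ _ fixed(1)] in auto)
qed

end

lemma fin_gen_semigroup_add:
  assumes "fin_gen_semigroup S" "s \<in> S" "t \<in> S"
  shows "s + t \<in> S"
proof -
  obtain A where S: "S = {sum_list xs |xs. xs \<noteq> [] \<and> set xs \<subseteq> A}"
    using assms(1) by (auto simp: fin_gen_semigroup_def)
  obtain xs ys where "s = sum_list xs" "xs \<noteq> []" "set xs \<subseteq> A" "t = sum_list ys" "set ys \<subseteq> A"
    using assms(2,3) unfolding S by blast
  then show ?thesis
    unfolding S by (auto intro!: exI[of _ "xs @ ys"])
qed

lemma toric_degeneration_normal:
  assumes "fin_gen_semigroup S" "\<And>s. s \<in> S \<Longrightarrow> fst s \<ge> 1" "saturated S" "interior (NO_body S) \<noteq> {}"
    and "toric_degeneration X S I"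
  shows "normal_toric_variety (fiber_ideal I 0)"
proof -
  obtain A where A: "finite A" "S = {sum_list xs |xs. xs \<noteq> [] \<and> set xs \<subseteq> A}"
    using assms(1) by (auto simp: fin_gen_semigroup_def)
  obtain d where d: "d \<ge> 1" "is_Proj_semigroup_algebra S d (fiber_ideal I 0)"
    using assms(5) unfolding toric_degeneration_def by blast
  obtain g where g: "fiber_ideal I 0 = {F. eval_with (single 0) g F = 0}"
    "\<And>i. keys (g i) \<subseteq> {s\<in>S. fst s = d}"
    "\<And>l. l \<ge> 1 \<Longrightarrow> eval_with (single 0) g ` {F. homogeneous l F} =
              {b. keys b \<subseteq> {s\<in>S. fst s = d * l}}"
    using d(2) unfolding is_Proj_semigroup_algebra_def by blast
  interpret semigroup_proj S A d g
    by unfold_locales (use A assms(2-4) d(1) g(2,3) in auto)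
  show ?thesis
    using normal_toric_variety_I by (simp add: g(1) I_def)
qed

theorem proposition4p11:
  fixes X :: "(complex ^ 'n::finite) set"
    and h :: "('n, complex) mpoly"
    and form :: "int ^ 'j::finite \<Rightarrow> int ^ 'j \<Rightarrow> rat"
    and Juf :: "'j set" and Nuf Ncirc :: "(int ^ 'j) set"
    and d :: "'j \<Rightarrow> int" and s0 :: "'j \<Rightarrow> int ^ 'j"
    and ordr :: "'j list \<Rightarrow> (int ^ 'j) rel"
    and v :: "'j list \<Rightarrow> (('n, complex) mpoly \<times> ('n, complex) mpoly) set \<Rightarrow> int ^ 'j"
    and S :: "'j list \<Rightarrow> (nat \<times> (int ^ 'j)) set"
    and \<Delta> :: "'j list \<Rightarrow> (real ^ 'j) set"
    and s :: "'j list \<Rightarrow> 'j \<Rightarrow> int ^ 'j"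
    and \<epsilon> :: "'j list \<Rightarrow> 'j \<Rightarrow> 'j \<Rightarrow> rat"
    and u0 :: "int ^ 'j \<Rightarrow> real" and \<nu> :: nat
  assumes X: "proj_variety X" "smooth X" "has_dim X CARD('j)"
    and very_ample: "embedded_by_complete_linear_system X"
    and h: "homogeneous 1 h" "h \<notin> vanishing_ideal X"
    and lattice_data: "fixed_data form Juf Nuf d Ncirc"
    and initial_seed: "is_seed Juf Nuf d Ncirc s0"
    and s: "\<And>t. s t = seed_at form d s0 t"
    and \<epsilon>: "\<And>t. \<epsilon> t = exchange_matrix form d (s t)"
    and v: "\<And>t. t \<in> lists Juf \<Longrightarrow> is_valuation X (ordr t) (v t) \<and> one_dim_leaves X (ordr t) (v t)"
    and S: "\<And>t. S t = NO_semigroup X h (v t)"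
    and \<Delta>: "\<And>t. \<Delta> t = NO_body (S t)"
    and fin_gen: "\<And>t. t \<in> lists Juf \<Longrightarrow> fin_gen_semigroup (S t)"
    and tropical_cluster: "semigroups_tropical_cluster Juf \<epsilon> S"
    and saturated_root: "saturated (S [])"
    and u0: "u0 \<in> M_real"
    and Fano_root: "Q_Gorenstein_Fano (\<Delta> []) \<nu> (seed_coords d (s []) u0)"
    and center_fixed: "\<And>k t. k \<in> Juf \<Longrightarrow> t \<in> lists Juf \<Longrightarrow>
      trop_mutation (\<epsilon> t) k (seed_coords d (s t) u0) = seed_coords d (s (k # t)) u0"
  shows "\<forall>t\<in>lists Juf. Q_Gorenstein_Fano (\<Delta> t) \<nu> (seed_coords d (s t) u0) \<and>
    (\<forall>I :: ('p::finite, complex poly) mpoly set.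
       toric_degeneration X (S t) I \<longrightarrow> normal_toric_variety (fiber_ideal I 0))"
proof -
  interpret seed_data form Juf Nuf d Ncirc
    by unfold_locales (rule lattice_data)
  have pos: "fst x \<ge> 1" if "x \<in> S t" for x t
    using that by (auto simp: S NO_semigroup_def)
  have seeds: "good_seed (s t)" if "t \<in> lists Juf" for t
    unfolding s by (rule good_seed_at[OF initial_seed that])
  have s_Cons: "s (k # t) = mutate_seed form d k (s t)" for k t
    by (simp add: s)
  have add: "x + y \<in> S t" if "t \<in> lists Juf" "x \<in> S t" "y \<in> S t" for x y t
    by (rule fin_gen_semigroup_add[OF fin_gen that(2,3)]) (rule that(1))
  have main: "saturated (S t) \<and> Q_Gorenstein_Fano (\<Delta> t) \<nu> (seed_coords d (s t) u0)"
    if "t \<in> lists Juf" for t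
    using that
  proof (induction t)
    case Nil
    then show ?case
      using saturated_root Fano_root by simp
  next
    case (Cons k t)
    have k: "k \<in> Juf" and t: "t \<in> lists Juf" and IH: "saturated (S t)"
      "Q_Gorenstein_Fano (\<Delta> t) \<nu> (seed_coords d (s t) u0)"
      using Cons by auto
    note row = \<epsilon>_row[OF seeds[OF t] k]
    have "real_points (S (k # t)) = trop_mutation_hat (exchange_matrix form d (s t)) k ` real_points (S t)"
      using tropical_cluster t k unfolding semigroups_tropical_cluster_def \<epsilon> by blast
    from real_points_mutation[of "exchange_matrix form d (s t)" k "E (s t) k", OF row this]
    have S': "S (k # t) = (\<lambda>(r, u). (r, mutation (E (s t) k) k u)) ` S t" .
    have \<Delta>': "\<Delta> (k # t) = mutation (E (s t) k) k ` \<Delta> t"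
      unfolding \<Delta> by (rule NO_body_mutation[OF _ _ _ _ S']) (use add pos t k in auto)
    \<comment> \<open>Not visible from the mutation, which could destroy convexity; it comes from
      finite generation of the new semigroup.\<close>
    have "rational_polytope (\<Delta> (k # t))"
    proof -
      have "fin_gen_semigroup (S (k # t))"
        using fin_gen k t by simp
      then obtain A where "finite A" "S (k # t) = {sum_list xs |xs. xs \<noteq> [] \<and> set xs \<subseteq> A}"
        by (auto simp: fin_gen_semigroup_def)
      then show ?thesis
        unfolding \<Delta> by (rule rational_polytope_NO_body) (rule pos)
    qed
    moreover have "seed_coords d (s t) u0 $ k = 0 \<or> (\<forall>j. j \<noteq> k \<longrightarrow> E (s t) k j = 0)"
      \<comment> \<open>The edge labelled \<open>k\<close> that leaves \<open>k # t\<close> supplies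
        the second equation. It leads to \<open>k # k # t\<close>, whose seed may differ from the
        one at \<open>t\<close>.\<close>
      using center_fixed[OF k t] center_fixed[OF k, of "k # t"] k t unfolding \<epsilon> s_Cons
      by (intro fixed_center[OF seeds[OF t] k u0]) auto
    ultimately have "Q_Gorenstein_Fano (\<Delta> (k # t)) \<nu> (mutation (E (s t) k) k (seed_coords d (s t) u0))"
      using IH(2) unfolding \<Delta>' by (intro Q_Gorenstein_Fano_mutation)
    moreover have "mutation (E (s t) k) k (seed_coords d (s t) u0) = seed_coords d (s (k # t)) u0"
      using center_fixed[OF k t] trop_mutation_eq_mutation[of "exchange_matrix form d (s t)" k "E (s t) k", OF row] unfolding \<epsilon> by simp
    ultimately show ?case
      using saturated_mutation[OF IH(1) S'] by simp
  qed
  show ?thesis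
  proof (intro ballI conjI allI impI)
    fix t assume t: "t \<in> lists Juf"
    show fano: "Q_Gorenstein_Fano (\<Delta> t) \<nu> (seed_coords d (s t) u0)"
      using main[OF t] by simp
    fix I :: "('p, complex poly) mpoly set" assume deg: "toric_degeneration X (S t) I"
    \<comment> \<open>The Fano property provides the full dimension that the torus of the central
      fiber requires.\<close>
    have "interior (NO_body (S t)) \<noteq> {}"
      using fano by (simp add: Q_Gorenstein_Fano_def \<Delta>)
    with deg show "normal_toric_variety (fiber_ideal I 0)"
      using main[OF t] by (intro toric_degeneration_normal[OF fin_gen[OF t]] pos) auto
  qed
qed

end
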